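(* Let $n\ge2$ and $k\ge0$ be integers, and let $\alpha_k$ be the measure $$\alpha_k=\mathrm{mes}(S^{n-2})\cdot t^{-n}\,a_k(t)\,(1-t^2)^{\frac{n-3}2}\,dt$$ on the interval $(0,1)$, extended by zero to the whole of $\mathbb R_{>0}$. The distribution $\alpha_k$ is invertible in the convolution algebra $A$. Its inverse $\beta_k$ is $$\beta_k(t)=\frac{1}{2^{n+k-2}\,\pi^{\frac{n-1}2}\,\Gamma\!\left(\frac{n+2k-1}2\right)}\;t^{k-1}\left(-\frac{d}{dt}\right)^{n+k-1}\left(t^{-k+1}(1-t^2)_+^{\frac{n+2k-3}2}\right)dt.$$ The Mellin transforms are given by $$\mathfrak M\beta_k(s)=\frac1{\mathfrak M\alpha_k(s)}=2^{1-n-k}\,\pi^{\frac{1-n}2}\,\frac{\Gamma(s+k)}{\Gamma(s-n+1)}\cdot\frac{\Gamma\!\left(\frac{s-n-k}2+1\right)}{\Gamma\!\left(\frac{s+k+1}2\right)}.$$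
   Context: $A$ is the space of distributions on $\mathbb R_{>0}$ supported on $(0,1]$, which is an algebra under the convolution product $*$ induced by multiplication on $\mathbb R_{>0}$ (unit: the delta distribution at $1$). $S^{n-1}$ is the unit sphere in $\mathbb R^n$; $\mathrm{mes}(S^{n-2})$ is the surface area of the unit $(n-2)$-sphere (so $\mathrm{mes}(S^0)=2$). $\mathcal C(S^{n-1})$ is the space of smooth $O(n)$-finite complex-valued functions on $S^{n-1}$, and $H^k$ is the space of harmonic homogeneous polynomials of degree $k$ on $\mathbb R^n$; the restrictions $H^k|S^{n-1}$ are irreducible, pairwise non-isomorphic $O(n)$-representations. For $t\in(-1,1)$ let $A_t:\mathcal C(S^{n-1})\to\mathcal C(S^{n-1})$ be the operator such that $(A_tf)(x)$ is the average of $f$ over the $(n-2)$-sphere $\{\omega\in S^{n-1}:\omega\cdot x=t\}$. It is $O(n)$-equivariant, hence acts on $H^k|S^{n-1}$ by a scalar, denoted $a_k(t)$; $a_k$ is a smooth function on $(-1,1)$, is real valued and satisfies $|a_k(t)|\le1$. The derivative $\frac d{dt}$ is taken in the sense of generalized functions on $\mathbb R_{>0}$. For $\mathrm{Re}(\lambda)>-1$, $(1-t)_+^\lambda$ is the generalized function equal to $(1-t)^\lambda$ on $(0,1)$ and $0$ on $[1,\infty)$ (extended by analytic continuation to $\lambda$ not a negative integer), and $(1-t^2)_+^\lambda=(1+t)^\lambda(1-t)_+^\lambda$. Mellin transform: $\mathfrak M\gamma(s)$ is obtained by integrating $t^s$ against the distribution $\gamma$, i.e. $\mathfrak M\gamma(s)=\int_{\mathbb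 R_{>0}}t^s\gamma(t)$, for $\mathrm{Re}(s)$ sufficiently large ($\mathrm{Re}(s)>n-1$ in the case of $\alpha_k$), and by analytic continuation elsewhere; the formulas are identities of meromorphic functions of $s\in\mathbb C$. *)

theory Defs
  imports "HOL-Complex_Analysis.Complex_Analysis" "HOL-Algebra.Module"
begin

definition nth_deriv :: "nat \<Rightarrow> (real \<Rightarrow> complex) \<Rightarrow> real \<Rightarrow> complex" where
  "nth_deriv j = ((\<lambda>f x. vector_derivative f (at x)) ^^ j)"

definition smooth :: "(real \<Rightarrow> complex) \<Rightarrow> bool" where
  "smooth f \<longleftrightarrow> (\<forall>j x. nth_deriv j f differentiable (at x))"

definition supp :: "(real \<Rightarrow> complex) \<Rightarrow> real set" where
  "supp f = closure {x. f x \<noteq> 0}"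

text \<open>Test functions on the open half-line are represented by their extensions by zero
  to the whole real line.\<close>

definition test_fun :: "(real \<Rightarrow> complex) \<Rightarrow> bool" where
  "test_fun \<phi> \<longleftrightarrow> smooth \<phi> \<and> compact (supp \<phi>) \<and> supp \<phi> \<subseteq> {0<..}"

type_synonym dist = "(real \<Rightarrow> complex) \<Rightarrow> complex"

text \<open>A distribution is a linear functional on the test functions satisfying the usual seminorm
  estimate on every compact set.  It takes the value 0 on functions that are not
  test functions, so that equality of distributions is equality in HOL.\<close>

definition distribution :: "dist \<Rightarrow> bool" where
  "distribution \<gamma> \<longleftrightarrow>
     (\<forall>\<phi>. \<not> test_fun \<phi> \<longrightarrow> \<gamma> \<phi> = 0) \<and>
     (\<forall>\<phi> \<psi>. test_fun \<phi> \<longrightarrow> test_fun \<psi> \<longrightarrow> \<gamma> (\<lambda>x. \<phi> x + \<psi> x) = \<gamma> \<phi> + \<gamma> \<psi>) \<and>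
     (\<forall>c \<phi>. test_fun \<phi> \<longrightarrow> \<gamma> (\<lambda>x. c * \<phi> x) = c * \<gamma> \<phi>) \<and>
     (\<forall>K. compact K \<and> K \<subseteq> {0<..} \<longrightarrow>
        (\<exists>C N. \<forall>\<phi>. test_fun \<phi> \<and> supp \<phi> \<subseteq> K \<longrightarrow>
           norm (\<gamma> \<phi>) \<le> C * (\<Sum>j\<le>N. SUP x. norm (nth_deriv j \<phi> x))))"

definition supported_on :: "dist \<Rightarrow> real set \<Rightarrow> bool" where
  "supported_on \<gamma> S \<longleftrightarrow> (\<forall>\<phi>. test_fun \<phi> \<and> supp \<phi> \<inter> S = {} \<longrightarrow> \<gamma> \<phi> = 0)"

definition regular_dist :: "(real \<Rightarrow> complex) \<Rightarrow> dist" where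
  "regular_dist f = (\<lambda>\<phi>. if test_fun \<phi> then (LBINT t:{0<..}. f t * \<phi> t) else 0)"

definition delta_one :: dist where
  "delta_one = (\<lambda>\<phi>. if test_fun \<phi> then \<phi> 1 else 0)"

definition dist_scale :: "complex \<Rightarrow> dist \<Rightarrow> dist" where
  "dist_scale c \<gamma> = (\<lambda>\<phi>. c * \<gamma> \<phi>)"

definition dist_add :: "dist \<Rightarrow> dist \<Rightarrow> dist" where
  "dist_add \<gamma> \<delta> = (\<lambda>\<phi>. \<gamma> \<phi> + \<delta> \<phi>)"

definition dist_fun_mult :: "(real \<Rightarrow> complex) \<Rightarrow> dist \<Rightarrow> dist" where
  "dist_fun_mult g \<gamma> = (\<lambda>\<phi>. if test_fun \<phi> then \<gamma> (\<lambda>t. g t * \<phi> t) else 0)"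

definition dist_deriv :: "dist \<Rightarrow> dist" where
  "dist_deriv \<gamma> = (\<lambda>\<phi>. if test_fun \<phi> then - \<gamma> (\<lambda>t. vector_derivative \<phi> (at t)) else 0)"

text \<open>A distribution supported on \<open>(0,1]\<close> can be applied to any smooth function \<open>f\<close> on the
  half-line that vanishes near 0: replace \<open>f\<close> by a test function that agrees with it on a
  neighbourhood of \<open>(0,1]\<close>; the value does not depend on the choice.\<close>

definition dist_apply :: "dist \<Rightarrow> (real \<Rightarrow> complex) \<Rightarrow> complex" where
  "dist_apply \<gamma> f = (THE c. \<exists>\<psi>. test_fun \<psi> \<and> (\<exists>e>0. \<forall>x\<in>{0<..<1+e}. \<psi> x = f x) \<and> c = \<gamma> \<psi>)"

text \<open>Convolution is the push-forward of the tensor product under \<open>(x, y) \<mapsto> x y\<close>.\<close>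

definition dist_conv :: "dist \<Rightarrow> dist \<Rightarrow> dist" where
  "dist_conv \<gamma> \<delta> =
     (\<lambda>\<phi>. if test_fun \<phi> then dist_apply \<gamma> (\<lambda>x. \<delta> (\<lambda>y. \<phi> (x * y))) else 0)"

definition conv_algebra :: "(complex, dist) module" where
  "conv_algebra =
     \<lparr>carrier = {\<gamma>. distribution \<gamma> \<and> supported_on \<gamma> {0<..1}},
      mult = dist_conv, one = delta_one,
      zero = (\<lambda>_. 0), add = dist_add, smult = dist_scale\<rparr>"

definition mellin_cutoff :: "(real \<Rightarrow> complex) \<Rightarrow> bool" where
  "mellin_cutoff h \<longleftrightarrow> smooth h \<and> (\<exists>a>0. \<forall>x\<le>a. h x = 0) \<and> (\<exists>b. \<forall>x\<ge>b. h x = 1)"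

text \<open>The function \<open>t\<^sup>s\<close> does not vanish near 0, so the integral of \<open>t\<^sup>s\<close> against \<open>\<gamma>\<close> is an
  improper one: the limit of the integrals of \<open>h (t/\<epsilon>) t\<^sup>s\<close>, for every smooth cutoff \<open>h\<close>.
  For a measure for which \<open>t\<^sup>s\<close> is absolutely integrable this is the ordinary integral,
  by dominated convergence.\<close>

definition has_mellin_integral :: "dist \<Rightarrow> complex \<Rightarrow> complex \<Rightarrow> bool" where
  "has_mellin_integral \<gamma> s c \<longleftrightarrow>
     (\<forall>h. mellin_cutoff h \<longrightarrow>
        ((\<lambda>\<epsilon>. dist_apply \<gamma> (\<lambda>t. h (t / \<epsilon>) * complex_of_real t powr s)) \<longlongrightarrow> c) (at_right 0))"

text \<open>Nice meromorphicity fixes the values at removable singularities by continuity and at poles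
  to be 0; this makes the analytic continuation unique as a function.\<close>

definition is_mellin_transform :: "dist \<Rightarrow> (complex \<Rightarrow> complex) \<Rightarrow> bool" where
  "is_mellin_transform \<gamma> F \<longleftrightarrow>
     F nicely_meromorphic_on UNIV \<and> (\<exists>\<sigma>. \<forall>s. Re s > \<sigma> \<longrightarrow> has_mellin_integral \<gamma> s (F s))"

definition mellin :: "dist \<Rightarrow> complex \<Rightarrow> complex" where
  "mellin \<gamma> = (THE F. is_mellin_transform \<gamma> F)"

text \<open>Surface measure on the unit sphere of the hyperplane orthogonal to the unit vector \<open>x\<close>,
  a sphere of dimension \<open>n - 2\<close>: the measure of \<open>E\<close> is \<open>n - 1\<close> times the \<open>(n - 1)\<close>-volume of the
  cone \<open>{r \<omega> | \<omega> \<in> E, 0 < r \<le> 1}\<close>, and the \<open>(n - 1)\<close>-volume of a subset of the hyperplane is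
  the \<open>n\<close>-volume of the cylinder of height 1 over it.\<close>

definition equator_measure :: "real ^ 'n \<Rightarrow> (real ^ 'n) measure" where
  "equator_measure x =
     scale_measure (of_nat (CARD('n) - 1))
       (distr (restrict_space lborel {y. 0 \<le> y \<bullet> x \<and> y \<bullet> x \<le> 1 \<and> norm (y - (y \<bullet> x) *\<^sub>R x) \<le> 1})
          borel (\<lambda>y. sgn (y - (y \<bullet> x) *\<^sub>R x)))"

text \<open>The average of \<open>f\<close> over \<open>{\<omega>. norm \<omega> = 1 \<and> \<omega> \<bullet> x = t}\<close>, the image of the equator
  under \<open>\<omega> \<mapsto> t x + \<surd>(1 - t\<^sup>2) \<omega>\<close>.\<close>

definition sphere_average :: "real \<Rightarrow> (real ^ 'n \<Rightarrow> complex) \<Rightarrow> real ^ 'n \<Rightarrow> complex" where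
  "sphere_average t f x =
     (\<integral>\<omega>. f (t *\<^sub>R x + sqrt (1 - t\<^sup>2) *\<^sub>R \<omega>) \<partial>equator_measure x)
       / of_real (measure (equator_measure x) UNIV)"

text \<open>The surface area of the unit sphere of dimension \<open>m\<close> is \<open>m + 1\<close> times the volume of the
  unit ball of dimension \<open>m + 1\<close>.\<close>

definition mes_sphere :: "nat \<Rightarrow> real" where
  "mes_sphere m = real (m + 1) * unit_ball_vol (real (m + 1))"

definition laplacian :: "(real ^ 'n \<Rightarrow> complex) \<Rightarrow> real ^ 'n \<Rightarrow> complex" where
  "laplacian p x =
     (\<Sum>b\<in>Basis. vector_derivative
        (\<lambda>s. vector_derivative (\<lambda>r. p (x + r *\<^sub>R b)) (at s)) (at 0))"

definition harmonic_polys :: "nat \<Rightarrow> (real ^ 'n \<Rightarrow> complex) set" where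
  "harmonic_polys k =
     {p. polynomial_function p \<and>
         (\<forall>c x. p (c *\<^sub>R x) = of_real (c ^ k) * p x) \<and>
         (\<forall>x. laplacian p x = 0)}"

text \<open>The scalar by which the averaging operator acts on restrictions of harmonic polynomials to the sphere.
  The argument of type \<^typ>\<open>'n itself\<close> fixes the dimension \<open>n = CARD('n)\<close>.\<close>

definition avg_eigenvalue :: "'n::finite itself \<Rightarrow> nat \<Rightarrow> real \<Rightarrow> complex" where
  "avg_eigenvalue _ k t =
     (THE c. \<forall>p \<in> (harmonic_polys k :: (real ^ 'n \<Rightarrow> complex) set).
        \<forall>x \<in> sphere 0 1. sphere_average t p x = c * p x)"

definition alpha :: "'n::finite itself \<Rightarrow> nat \<Rightarrow> dist" where
  "alpha T k =
     regular_dist (\<lambda>t. if t < 1 then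
         of_real (mes_sphere (CARD('n) - 2)) * of_real (t powi (- int CARD('n))) *
         avg_eigenvalue T k t * of_real ((1 - t\<^sup>2) powr ((real CARD('n) - 3) / 2))
       else 0)"

text \<open>The function \<open>(1 - t\<^sup>2)\<^sub>+\<^sup>l\<close> on the half-line; it is locally integrable for \<open>l > -1\<close>, the
  only case needed.\<close>

definition one_minus_sq_plus :: "real \<Rightarrow> real \<Rightarrow> real" where
  "one_minus_sq_plus l t = (if t < 1 then (1 - t\<^sup>2) powr l else 0)"

definition beta :: "nat \<Rightarrow> nat \<Rightarrow> dist" where
  "beta n k =
     dist_scale
       (of_real (1 / (2 ^ (n + k - 2) * pi powr ((real n - 1) / 2)
                      * Gamma ((real n + 2 * real k - 1) / 2))))
       (dist_fun_mult (\<lambda>t. of_real (t powi (int k - 1)))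
         (((\<lambda>\<gamma>. dist_scale (-1) (dist_deriv \<gamma>)) ^^ (n + k - 1))
           (regular_dist (\<lambda>t. of_real (t powi (1 - int k)
              * one_minus_sq_plus ((real n + 2 * real k - 3) / 2) t)))))"

end

theory Submission
  imports Defs
begin

text \<open>
  On a harmonic polynomial \<open>p\<close> of degree \<open>k\<close> the integral of \<open>\<omega> \<mapsto> p (x + \<rho> \<omega>)\<close> over the equator is a
  polynomial in \<open>\<rho>\<close>; the rotations fixing \<open>x\<close>, harmonicity and homogeneity give it a second-order
  differential equation, so the averaging operator acts by the Gegenbauer polynomial. The Mellin
  transforms of \<open>\<alpha>\<^sub>k\<close> and \<open>\<beta>\<^sub>k\<close> are then Beta integrals. Integration by parts turns \<open>\<beta>\<^sub>k\<close> into a density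
  paired with an Euler operator \<open>E\<close> applied to the test function. As \<open>E\<close> commutes with dilations, both
  \<open>\<alpha>\<^sub>k * \<beta>\<^sub>k\<close> and \<open>\<beta>\<^sub>k * \<alpha>\<^sub>k\<close> pair the convolution of the two densities with \<open>E \<phi>\<close>. By the duplication
  formula that convolution has the moments of \<open>t\<^sup>-\<^sup>n (1 - t)\<^sup>m\<^sup>-\<^sup>1 / (m - 1)!\<close> with \<open>m = n + k - 1\<close>,
  whose pairing with \<open>E \<phi>\<close> is \<open>\<phi> 1\<close> by Taylor's formula.
\<close>

section \<open>Smooth functions on the line\<close>

text \<open>The formula for \<beta> comes from the Mellin transform, which turns convolution into
  multiplication. What shapes the proof is that a distribution is not easily recovered from its
  transform, and that the factor t^(-n) leaves only moments of high order. Multiplying every density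
  by t^N with N = n + k makes it integrable on (0,1), and there an integrable density is determined
  by its moments of integer order; so the transforms are compared at integers only. The operator E
  acts on t^s as the scalar Gamma(s+k)/Gamma(s-n+1). This is the origin of that quotient in the
  transform of \<beta>, and t^(-n) (1-t)^(m-1) / (m-1)! is the density whose moments are its
  reciprocals; this is why the convolution can be compared with it. The power t^s is no test
  function, so E meets a cutoff as well: it turns a cutoff with limit 1 into one whose limit is the
  same scalar. The eigenvalue is found on each harmonic polynomial from the equation in \<rho>,
  whose solution is fixed by its value at \<rho> = 0 once odd powers are excluded.\<close>

definition smooth_on :: "real set \<Rightarrow> (real \<Rightarrow> complex) \<Rightarrow> bool" where
  "smooth_on S f \<longleftrightarrow> (\<forall>j. \<forall>x\<in>S. nth_deriv j f differentiable (at x))"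

lemma smooth_iff_smooth_on: "smooth f \<longleftrightarrow> smooth_on UNIV f"
  by (simp add: smooth_def smooth_on_def)

lemma nth_deriv_0 [simp]: "nth_deriv 0 f = f"
  by (simp add: nth_deriv_def)

lemma nth_deriv_Suc: "nth_deriv (Suc j) f = (\<lambda>x. vector_derivative (nth_deriv j f) (at x))"
  by (simp add: nth_deriv_def)

lemma nth_deriv_Suc': "nth_deriv (Suc j) f = nth_deriv j (\<lambda>x. vector_derivative f (at x))"
  by (induction j) (simp_all add: nth_deriv_Suc)

lemma smooth_on_has_vector_derivative:
  assumes "smooth_on S f" "x \<in> S"
  shows "(nth_deriv j f has_vector_derivative nth_deriv (Suc j) f x) (at x)"
  using assms vector_derivative_works by (auto simp: smooth_on_def nth_deriv_Suc)

text \<open>A derivative on an open set depends only on nearby values, so a sequence whose members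
  are successive derivatives there must be the sequence of iterated derivatives. Most explicit
  higher derivatives below are identified this way.\<close>

lemma nth_deriv_eqI:
  assumes S: "open S" and D: "\<And>j x. x \<in> S \<Longrightarrow> (D j has_vector_derivative D (Suc j) x) (at x)"
    and D0: "\<And>x. x \<in> S \<Longrightarrow> f x = D 0 x"
  shows "x \<in> S \<Longrightarrow> nth_deriv j f x = D j x"
proof (induction j arbitrary: x)
  case (Suc j)
  have "(nth_deriv j f has_vector_derivative D (Suc j) x) (at x)"
    by (rule has_vector_derivative_transform_within_open[OF D S]) (use Suc in auto)
  then show ?case
    by (simp add: nth_deriv_Suc vector_derivative_at)
qed (simp add: D0)

lemma smooth_on_sequenceI:
  assumes S: "open S" and D: "\<And>j x. x \<in> S \<Longrightarrow> (D j has_vector_derivative D (Suc j) x) (at x)"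
    and D0: "\<And>x. x \<in> S \<Longrightarrow> f x = D 0 x"
  shows "smooth_on S f"
  unfolding smooth_on_def
proof (intro allI ballI)
  fix j x assume x: "x \<in> S"
  have "(nth_deriv j f has_vector_derivative D (Suc j) x) (at x)"
    by (rule has_vector_derivative_transform_within_open[OF D S])
       (use x nth_deriv_eqI[OF assms] in auto)
  then show "nth_deriv j f differentiable (at x)"
    by (rule differentiableI_vector)
qed

text \<open>Coinduction: in a class closed under differentiation every member is smooth, because
  differentiation can be iterated inside the class. Choosing a large enough class replaces Leibniz
  and chain rule formulas of higher order.\<close>

lemma smooth_on_coinduct:
  assumes S: "open S" and "P f"
    and step: "\<And>g. P g \<Longrightarrow> \<exists>h. P h \<and> (\<forall>x\<in>S. (g has_vector_derivative h x) (at x))"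
  shows "smooth_on S f"
proof -
  obtain d where d: "\<And>g. P g \<Longrightarrow> P (d g) \<and> (\<forall>x\<in>S. (g has_vector_derivative d g x) (at x))"
    using step by metis
  have P: "P ((d ^^ j) f)" for j
    by (induction j) (use \<open>P f\<close> d in auto)
  show ?thesis
    by (rule smooth_on_sequenceI[where D = "\<lambda>j. (d ^^ j) f", OF S]) (use P d in auto)
qed

lemma smooth_on_vector_derivative:
  "smooth_on S f \<Longrightarrow> smooth_on S (\<lambda>x. vector_derivative f (at x))"
  unfolding smooth_on_def by (metis nth_deriv_Suc')

lemma smooth_on_nth_deriv: "smooth_on S f \<Longrightarrow> smooth_on S (nth_deriv j f)"
  by (induction j) (auto simp: nth_deriv_Suc intro: smooth_on_vector_derivative)

lemma smooth_on_deriv1: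
  "smooth_on S f \<Longrightarrow> x \<in> S \<Longrightarrow> (f has_vector_derivative vector_derivative f (at x)) (at x)"
  using smooth_on_has_vector_derivative[of S f x 0] by (simp add: nth_deriv_Suc)

lemma smooth_on_subset: "smooth_on S f \<Longrightarrow> T \<subseteq> S \<Longrightarrow> smooth_on T f"
  unfolding smooth_on_def by blast

lemma smooth_on_Un: "smooth_on S f \<Longrightarrow> smooth_on T f \<Longrightarrow> smooth_on (S \<union> T) f"
  unfolding smooth_on_def by blast

lemma nth_deriv_cong:
  assumes "open S" "\<And>x. x \<in> S \<Longrightarrow> f x = g x" "x \<in> S"
  shows "nth_deriv j f x = nth_deriv j g x"
  using assms(3)
proof (induction j arbitrary: x)
  case (Suc j)
  have "eventually (\<lambda>y. nth_deriv j f y = nth_deriv j g y) (nhds x)"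
    using Suc assms(1) by (auto simp: eventually_nhds)
  then show ?case
    unfolding nth_deriv_Suc by (intro vector_derivative_cong_eq) (auto simp: Suc)
qed (use assms in auto)

lemma smooth_on_cong:
  assumes "open S" "\<And>x. x \<in> S \<Longrightarrow> f x = g x" "smooth_on S g"
  shows "smooth_on S f"
  by (rule smooth_on_sequenceI[where D = "\<lambda>j. nth_deriv j g"])
     (use assms smooth_on_has_vector_derivative in auto)

lemma smooth_on_continuous:
  assumes "smooth_on S f" "x \<in> S"
  shows "isCont (nth_deriv j f) x"
  using assms differentiable_imp_continuous_within unfolding smooth_on_def by blast

lemma smooth_on_const [simp, intro]: "open S \<Longrightarrow> smooth_on S (\<lambda>x. c)"
  by (rule smooth_on_coinduct[where P = "\<lambda>f. \<exists>c. f = (\<lambda>x. c)"])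
     (auto intro!: exI[where x = "\<lambda>_. 0"] derivative_eq_intros)

lemma smooth_on_add [intro]:
  assumes "open S" "smooth_on S f" "smooth_on S g"
  shows "smooth_on S (\<lambda>x. f x + g x)"
  by (rule smooth_on_sequenceI[where D = "\<lambda>j x. nth_deriv j f x + nth_deriv j g x"])
     (use assms in \<open>auto intro!: derivative_intros smooth_on_has_vector_derivative\<close>)

text \<open>Products of smooth functions alone are not closed under differentiation; their finite
  sums are. This is the class to which the coinduction is applied.\<close>

inductive mult_closure :: "real set \<Rightarrow> (real \<Rightarrow> complex) \<Rightarrow> bool" for S where
  "smooth_on S f \<Longrightarrow> smooth_on S g \<Longrightarrow> mult_closure S (\<lambda>x. f x * g x)"
| "mult_closure S f \<Longrightarrow> mult_closure S g \<Longrightarrow> mult_closure S (\<lambda>x. f x + g x)"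

lemma smooth_on_mult [intro]:
  assumes "open S" "smooth_on S f" "smooth_on S g"
  shows "smooth_on S (\<lambda>x. f x * g x)"
proof (rule smooth_on_coinduct[where P = "mult_closure S"])
  fix h assume "mult_closure S h"
  then show "\<exists>h'. mult_closure S h' \<and> (\<forall>x\<in>S. (h has_vector_derivative h' x) (at x))"
  proof induction
    case (1 f g)
    show ?case
    proof (intro exI conjI ballI)
      show "mult_closure S (\<lambda>x. f x * vector_derivative g (at x) + vector_derivative f (at x) * g x)"
        using 1 smooth_on_vector_derivative by (intro mult_closure.intros) auto
    qed (use 1 in \<open>auto intro!: derivative_eq_intros smooth_on_deriv1\<close>)
  next
    case (2 f g)
    then obtain f' g' where "mult_closure S f'" "mult_closure S g'"
      "\<forall>x\<in>S. (f has_vector_derivative f' x) (at x)" "\<forall>x\<in>S. (g has_vector_derivative g' x) (at x)"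
      by blast
    then show ?case
      by (intro exI[of _ "\<lambda>x. f' x + g' x"]) (auto intro!: mult_closure.intros derivative_eq_intros)
  qed
qed (use assms in \<open>auto intro: mult_closure.intros\<close>)

lemma smooth_on_diff:
  assumes "open S" "smooth_on S f" "smooth_on S g"
  shows "smooth_on S (\<lambda>x. f x - g x)"
  using smooth_on_add[OF assms(1,2) smooth_on_mult[OF assms(1) smooth_on_const[of S "-1"] assms(3)]] assms(1)
  by simp

text \<open>The functions h / g^m with smooth h form a closed class: the derivative has numerator h'
  g - m h g' over g^(m+1).\<close>

lemma smooth_on_inverse:
  assumes S: "open S" and g: "smooth_on S g" and nz: "\<And>x. x \<in> S \<Longrightarrow> g x \<noteq> 0"
  shows "smooth_on S (\<lambda>x. inverse (g x))"
proof (rule smooth_on_coinduct[where P = "\<lambda>f. \<exists>h m. smooth_on S h \<and> f = (\<lambda>x. h x * inverse (g x) ^ m)"])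
  show "\<exists>h m. smooth_on S h \<and> (\<lambda>x. inverse (g x)) = (\<lambda>x. h x * inverse (g x) ^ m)"
    by (rule exI[of _ "\<lambda>_. 1"], rule exI[of _ 1]) (use S in auto)
next
  fix f assume "\<exists>h m. smooth_on S h \<and> f = (\<lambda>x. h x * inverse (g x) ^ m)"
  then obtain h m where h: "smooth_on S h" and f: "f = (\<lambda>x. h x * inverse (g x) ^ m)" by blast
  let ?h = "\<lambda>x. vector_derivative h (at x) * g x - of_nat m * (h x * vector_derivative g (at x))"
  have "smooth_on S ?h"
    by (intro smooth_on_diff smooth_on_mult smooth_on_const smooth_on_vector_derivative S g h)
  moreover have "(f has_vector_derivative ?h x * inverse (g x) ^ Suc m) (at x)" if x: "x \<in> S" for x
  proof -
    have p: "((\<lambda>z. inverse z ^ m) has_field_derivative - of_nat m * inverse (g x) ^ Suc m) (at (g x))"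
    proof (cases m)
      case (Suc i)
      have "(inverse has_field_derivative - (inverse (g x) * inverse (g x))) (at (g x))"
        using DERIV_inverse[OF nz[OF x]] by (simp add: power2_eq_square)
      from DERIV_power[OF this, of m] show ?thesis
        using Suc by (simp add: algebra_simps)
    qed auto
    have "((\<lambda>x. inverse (g x) ^ m) has_vector_derivative
        vector_derivative g (at x) * (- of_nat m * inverse (g x) ^ Suc m)) (at x)"
      using field_vector_diff_chain_at[OF smooth_on_deriv1[OF g x] p] by (simp add: o_def)
    from has_vector_derivative_mult[OF smooth_on_deriv1[OF h x] this]
    show ?thesis using nz[OF x] unfolding f by (simp add: field_simps)
  qed
  ultimately show "\<exists>h. (\<exists>ha m. smooth_on S ha \<and> h = (\<lambda>x. ha x * inverse (g x) ^ m)) \<and>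
        (\<forall>x\<in>S. (f has_vector_derivative h x) (at x))"
    by (intro exI[of _ "\<lambda>x. ?h x * inverse (g x) ^ Suc m"]) blast
qed (rule S)

lemma nth_deriv_affine_has_vector_derivative:
  assumes "smooth_on T f" "c * x + d \<in> T"
  shows "((\<lambda>x. of_real (c ^ j) * nth_deriv j f (c * x + d)) has_vector_derivative
          of_real (c ^ Suc j) * nth_deriv (Suc j) f (c * x + d)) (at x)"
proof -
  have "((\<lambda>x. c * x + d) has_vector_derivative c) (at x)"
    by (auto intro!: derivative_eq_intros)
  from vector_diff_chain_at[OF this smooth_on_has_vector_derivative[OF assms]]
  have "((\<lambda>x. nth_deriv j f (c * x + d)) has_vector_derivative c *\<^sub>R nth_deriv (Suc j) f (c * x + d)) (at x)"
    by (simp add: o_def)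
  then show ?thesis
    by (auto intro!: derivative_eq_intros simp: scaleR_conv_of_real)
qed

lemma smooth_on_affine:
  assumes "open S" "smooth_on T f" "\<And>x. x \<in> S \<Longrightarrow> c * x + d \<in> T"
  shows "smooth_on S (\<lambda>x. f (c * x + d))"
  by (rule smooth_on_sequenceI[where D = "\<lambda>j x. of_real (c ^ j) * nth_deriv j f (c * x + d)"])
     (use assms in \<open>auto intro: nth_deriv_affine_has_vector_derivative[simplified]\<close>)

lemma smooth_on_powr:
  "smooth_on {0<..} (\<lambda>t. complex_of_real t powr s)"
proof (rule smooth_on_coinduct[where P = "\<lambda>f. \<exists>c s. f = (\<lambda>t. c * complex_of_real t powr s)"])
  fix f assume "\<exists>c s. f = (\<lambda>t. c * complex_of_real t powr s)"
  then obtain c s where f: "f = (\<lambda>t. c * complex_of_real t powr s)" by blast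
  have "(f has_vector_derivative (c * s) * complex_of_real t powr (s - 1)) (at t)" if "t > 0" for t
  proof -
    have "((\<lambda>z. c * z powr s) has_field_derivative (c * s) * complex_of_real t powr (s - 1)) (at (of_real t))"
      using DERIV_cmult[OF has_field_derivative_powr[of "complex_of_real t" s]] that
      by (simp add: mult.assoc)
    moreover have "(complex_of_real has_vector_derivative 1) (at t)"
      using has_vector_derivative_of_real[OF DERIV_ident] by simp
    ultimately show ?thesis
      using field_vector_diff_chain_at[of complex_of_real 1 t] unfolding f by (simp add: o_def)
  qed
  then show "\<exists>h. (\<exists>c s. h = (\<lambda>t. c * complex_of_real t powr s)) \<and>
      (\<forall>x\<in>{0<..}. (f has_vector_derivative h x) (at x))"
    by (intro exI[of _ "\<lambda>t. (c * s) * complex_of_real t powr (s - 1)"]) auto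
next
  show "\<exists>c s'. (\<lambda>t. complex_of_real t powr s) = (\<lambda>t. c * complex_of_real t powr s')"
    by (rule exI[of _ 1], rule exI[of _ s]) simp
qed auto

section \<open>Supports, cutoffs and extension to test functions\<close>

lemma test_fun_smooth: "test_fun \<phi> \<Longrightarrow> smooth_on S \<phi>"
  using smooth_on_subset[of UNIV] by (auto simp: test_fun_def smooth_iff_smooth_on)

lemma supp_subset_closedI: "closed T \<Longrightarrow> (\<And>x. x \<notin> T \<Longrightarrow> f x = 0) \<Longrightarrow> supp f \<subseteq> T"
  unfolding supp_def by (rule closure_minimal) auto

lemma not_in_supp: "x \<notin> supp f \<Longrightarrow> f x = 0"
  using closure_subset[of "{x. f x \<noteq> 0}"] by (auto simp: supp_def)

text \<open>The profile \<open>P (1/x) exp (- 1/x)\<close> on the right half-line, for a polynomial \<open>P\<close>; this class is closed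
  under differentiation.\<close>

definition flat_fun :: "real poly \<Rightarrow> real \<Rightarrow> real" where
  "flat_fun P x = (if x > 0 then poly P (1 / x) * exp (- 1 / x) else 0)"

lemma poly_times_exp_minus_tendsto_0:
  fixes P :: "real poly"
  shows "((\<lambda>u. poly P u * exp (- u)) \<longlongrightarrow> 0) at_top"
proof -
  have "((\<lambda>u. \<Sum>i\<le>degree P. coeff P i * (u ^ i / exp u)) \<longlongrightarrow> (\<Sum>i\<le>degree P. coeff P i * 0)) at_top"
    by (intro tendsto_intros tendsto_power_div_exp_0)
  then show ?thesis
    by (simp add: poly_altdef sum_divide_distrib exp_minus flip: divide_inverse)
qed

text \<open>At 0 the difference quotient from the right is the profile of \<open>pCons 0 P\<close>,
  the polynomial times its variable; in u = 1/x it tends to 0 because exp outgrows every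
  polynomial.\<close>

lemma flat_fun_deriv_0: "(flat_fun P has_real_derivative 0) (at 0)"
proof -
  have *: "((\<lambda>u. poly (pCons 0 P) u * exp (- u)) \<longlongrightarrow> 0) at_top"
    by (rule poly_times_exp_minus_tendsto_0)
  have "((\<lambda>x. poly (pCons 0 P) (inverse x) * exp (- inverse x)) \<longlongrightarrow> 0) (at_right 0)"
    using filterlim_compose[OF * filterlim_inverse_at_top_right] .
  moreover have "eventually (\<lambda>x. poly (pCons 0 P) (inverse x) * exp (- inverse x) = flat_fun P x / x) (at_right 0)"
    using eventually_at_right_less[of "0::real"]
    by eventually_elim (simp add: flat_fun_def inverse_eq_divide)
  ultimately have r: "((\<lambda>x. flat_fun P x / x) \<longlongrightarrow> 0) (at_right 0)"
    by (rule Lim_transform_eventually)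
  have "eventually (\<lambda>x. 0 = flat_fun P x / x) (at_left 0)"
    by (rule eventually_at_leftI[of "-1"]) (auto simp: flat_fun_def)
  then have l: "((\<lambda>x. flat_fun P x / x) \<longlongrightarrow> 0) (at_left 0)"
    by (rule Lim_transform_eventually[OF tendsto_const])
  have "((\<lambda>x. flat_fun P x / x) \<longlongrightarrow> 0) (at 0)"
    using filterlim_split_at[OF l r] .
  then show ?thesis
    by (simp add: has_field_derivative_iff flat_fun_def[of P 0])
qed

text \<open>With u = 1/x one has d/dx = - u^2 d/du, which sends P(u) e^(-u) to u^2 (P - P')(u)
  e^(-u).\<close>

lemma flat_fun_deriv:
  "(flat_fun P has_real_derivative flat_fun (monom 1 2 * (P - pderiv P)) x) (at x)"
proof (cases x "0 :: real" rule: linorder_cases)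
  case less
  then show ?thesis
    using has_field_derivative_transform_within_open[of "\<lambda>_. 0" 0 x "{..<0}" "flat_fun P"]
    by (simp add: flat_fun_def)
next
  case equal
  then show ?thesis using flat_fun_deriv_0 by (simp add: flat_fun_def)
next
  case greater
  have i: "((\<lambda>x. 1 / x) has_real_derivative - (1 / x\<^sup>2)) (at x)"
    using DERIV_inverse[of x] greater by (simp add: divide_inverse power2_eq_square)
  have "((\<lambda>x. poly P (1 / x)) has_real_derivative poly (pderiv P) (1 / x) * - (1 / x\<^sup>2)) (at x)"
    by (rule DERIV_chain2[OF poly_DERIV i])
  moreover have "((\<lambda>x. exp (- (1 / x))) has_real_derivative exp (- (1 / x)) * (1 / x\<^sup>2)) (at x)"
    using DERIV_chain2[OF DERIV_exp DERIV_minus[OF i]] by simp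
  ultimately have "((\<lambda>x. poly P (1 / x) * exp (- (1 / x))) has_real_derivative
     poly (pderiv P) (1 / x) * - (1 / x\<^sup>2) * exp (- (1 / x)) + exp (- (1 / x)) * (1 / x\<^sup>2) * poly P (1 / x)) (at x)"
    by (rule DERIV_mult)
  also have "poly (pderiv P) (1 / x) * - (1 / x\<^sup>2) * exp (- (1 / x)) + exp (- (1 / x)) * (1 / x\<^sup>2) * poly P (1 / x) =
     flat_fun (monom 1 2 * (P - pderiv P)) x"
    using greater by (simp add: flat_fun_def poly_monom power_divide) (simp add: diff_divide_distrib left_diff_distrib)
  finally show ?thesis
    by (rule has_field_derivative_transform_within_open[where S = "{0<..}"])
       (use greater in \<open>auto simp: flat_fun_def\<close>)
qed

lemma smooth_on_flat_fun: "open S \<Longrightarrow> smooth_on S (\<lambda>x. complex_of_real (flat_fun P x))"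
proof (rule smooth_on_coinduct[where P = "\<lambda>f. \<exists>P. f = (\<lambda>x. complex_of_real (flat_fun P x))"])
  fix g assume "\<exists>P. g = (\<lambda>x. complex_of_real (flat_fun P x))"
  then obtain P where P: "g = (\<lambda>x. complex_of_real (flat_fun P x))" by blast
  show "\<exists>h. (\<exists>P. h = (\<lambda>x. complex_of_real (flat_fun P x))) \<and> (\<forall>x\<in>S. (g has_vector_derivative h x) (at x))"
    unfolding P
    by (intro exI[of _ "\<lambda>x. complex_of_real (flat_fun (monom 1 2 * (P - pderiv P)) x)"] conjI ballI
        has_vector_derivative_of_real flat_fun_deriv) blast
qed auto

text \<open>The denominator never vanishes, because x and 1 - x cannot both be nonpositive.\<close>

definition smooth_step :: "real \<Rightarrow> real" where
  "smooth_step x = flat_fun 1 x / (flat_fun 1 x + flat_fun 1 (1 - x))"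

lemma smooth_step_eq_0: "x \<le> 0 \<Longrightarrow> smooth_step x = 0"
  and smooth_step_eq_1: "x \<ge> 1 \<Longrightarrow> smooth_step x = 1"
  by (simp_all add: smooth_step_def flat_fun_def)

lemma smooth_smooth_step: "smooth_on UNIV (\<lambda>x. complex_of_real (smooth_step x))"
proof -
  let ?f = "\<lambda>x. complex_of_real (flat_fun 1 x)"
  have nz: "?f x + ?f (1 - x) \<noteq> 0" for x
  proof -
    have "flat_fun 1 x + flat_fun 1 (1 - x) > 0"
      by (auto simp: flat_fun_def intro!: add_pos_pos)
    then show ?thesis
      unfolding of_real_add[symmetric] of_real_eq_0_iff by simp
  qed
  have f: "smooth_on UNIV ?f"
    by (rule smooth_on_flat_fun) simp
  have "smooth_on UNIV (\<lambda>x. ?f x * inverse (?f x + ?f (1 - x)))"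
    using smooth_on_affine[of UNIV UNIV ?f "-1" 1]
    by (intro smooth_on_mult smooth_on_inverse smooth_on_add f nz) (auto simp: f)
  then show ?thesis
    by (simp add: smooth_step_def divide_inverse)
qed

text \<open>The existence of one cutoff keeps \<open>has_mellin_integral\<close> from holding
  vacuously for every value; uniqueness of Mellin integrals rests on it.\<close>

lemma mellin_cutoff_smooth_step: "mellin_cutoff (\<lambda>x. complex_of_real (smooth_step (x - 1)))"
  unfolding mellin_cutoff_def smooth_iff_smooth_on
proof (intro conjI)
  show "smooth_on UNIV (\<lambda>x. complex_of_real (smooth_step (x - 1)))"
    using smooth_on_affine[OF _ smooth_smooth_step, of UNIV 1 "-1"] by simp
  show "\<exists>a>0. \<forall>x\<le>a. complex_of_real (smooth_step (x - 1)) = 0"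
    by (rule exI[of _ 1]) (simp add: smooth_step_eq_0)
  show "\<exists>b. \<forall>x\<ge>b. complex_of_real (smooth_step (x - 1)) = 1"
    by (rule exI[of _ 2]) (simp add: smooth_step_eq_1)
qed

lemma compact_supp_subset:
  assumes "supp f \<subseteq> K" "compact K"
  shows "compact (supp f)"
  using assms bounded_subset[of K "supp f"] by (auto simp: compact_eq_bounded_closed supp_def)

lemma test_funI:
  assumes "smooth f" "a > 0" "\<And>x. x < a \<Longrightarrow> f x = 0" "\<And>x. x > b \<Longrightarrow> f x = 0"
  shows "test_fun f"
proof -
  have "supp f \<subseteq> {a..b}"
    by (rule supp_subset_closedI) (use assms in \<open>auto simp: not_le\<close>)
  moreover have "{a..b} \<subseteq> {0<..}"
    using assms(2) by auto
  ultimately show ?thesis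
    using assms(1) compact_supp_subset[of f "{a..b}"] unfolding test_fun_def by auto
qed

text \<open>The half-line and the ray below \<open>a\<close> are open and cover the line, and on
  each of them the extension is visibly smooth. The range (0,2) is a neighbourhood of (0,1], all
  that a distribution supported there can see.\<close>

lemma test_fun_extension:
  assumes f: "smooth_on {0<..} f" and a: "a > 0" "\<And>x. 0 < x \<Longrightarrow> x \<le> a \<Longrightarrow> f x = 0"
  shows "\<exists>\<psi>. test_fun \<psi> \<and> (\<forall>x\<in>{0<..<2}. \<psi> x = f x)"
proof (intro exI conjI ballI)
  \<comment> \<open>This cutoff is 1 up to 2 and 0 from 3 on.\<close>
  let ?c = "\<lambda>x. complex_of_real (smooth_step (3 - x))"
  let ?\<psi> = "\<lambda>x. if x \<le> a then 0 else f x * ?c x"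
  have c: "smooth_on S ?c" for S
    using smooth_on_subset[OF smooth_on_affine[OF _ smooth_smooth_step, of UNIV "-1" 3]] by simp
  have "smooth_on {0<..} ?\<psi>"
    by (rule smooth_on_cong[where g = "\<lambda>x. f x * ?c x"]) (use a in \<open>auto intro!: smooth_on_mult f c\<close>)
  moreover have "smooth_on {..<a} ?\<psi>"
    by (rule smooth_on_cong[where g = "\<lambda>x. 0"]) (use a in auto)
  ultimately have "smooth_on ({0<..} \<union> {..<a}) ?\<psi>"
    by (rule smooth_on_Un)
  moreover have "{0<..} \<union> {..<a} = UNIV"
    using a by auto
  ultimately have "smooth ?\<psi>"
    unfolding smooth_iff_smooth_on by metis
  then show "test_fun ?\<psi>"
    by (rule test_funI[of _ a 3]) (use a in \<open>auto simp: smooth_step_eq_0\<close>)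
  fix x :: real assume "x \<in> {0<..<2}"
  then show "?\<psi> x = f x"
    using a by (auto simp: smooth_step_eq_1)
qed

section \<open>Test functions and the convolution algebra\<close>

lemma test_funE:
  assumes "test_fun \<phi>"
  obtains a b where "0 < a" "a \<le> b" "\<And>x. x \<notin> {a..b} \<Longrightarrow> \<phi> x = 0"
proof -
  have c: "compact (supp \<phi>)" and s: "supp \<phi> \<subseteq> {0<..}"
    using assms by (auto simp: test_fun_def)
  show ?thesis
  proof (cases "supp \<phi> = {}")
    case True
    with that[of 1 1] show ?thesis using not_in_supp[of _ \<phi>] by auto
  next
    case False
    obtain a where a: "a \<in> supp \<phi>" "\<And>x. x \<in> supp \<phi> \<Longrightarrow> a \<le> x"
      using compact_attains_inf[OF c False] by blast
    obtain b where b: "b \<in> supp \<phi>" "\<And>x. x \<in> supp \<phi> \<Longrightarrow> x \<le> b"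
      using compact_attains_sup[OF c False] by blast
    have sub: "supp \<phi> \<subseteq> {a..b}" using a b by auto
    show ?thesis
    proof (rule that[of a b])
      show "0 < a" "a \<le> b" using a b s by auto
      show "\<phi> x = 0" if "x \<notin> {a..b}" for x using that sub not_in_supp by blast
    qed
  qed
qed

lemma test_fun_cmult:
  assumes "test_fun \<phi>"
  shows "test_fun (\<lambda>x. c * \<phi> x)"
proof -
  obtain a b where ab: "0 < a" "a \<le> b" "\<And>x. x \<notin> {a..b} \<Longrightarrow> \<phi> x = 0" using assms by (rule test_funE) blast
  show ?thesis
  proof (rule test_funI[of _ a b])
    show "smooth (\<lambda>x. c * \<phi> x)"
      unfolding smooth_iff_smooth_on
      using smooth_on_mult[OF open_UNIV smooth_on_const[OF open_UNIV] test_fun_smooth[OF assms]] .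
  qed (use ab in auto)
qed

lemma test_fun_add:
  assumes "test_fun \<phi>" "test_fun \<psi>"
  shows "test_fun (\<lambda>x. \<phi> x + \<psi> x)"
proof -
  obtain a b where ab: "0 < a" "a \<le> b" "\<And>x. x \<notin> {a..b} \<Longrightarrow> \<phi> x = 0" using assms(1) by (rule test_funE) blast
  obtain c d where cd: "0 < c" "c \<le> d" "\<And>x. x \<notin> {c..d} \<Longrightarrow> \<psi> x = 0" using assms(2) by (rule test_funE) blast
  show ?thesis
  proof (rule test_funI[of _ "min a c" "max b d"])
    show "smooth (\<lambda>x. \<phi> x + \<psi> x)"
      unfolding smooth_iff_smooth_on using assms by (intro smooth_on_add test_fun_smooth) auto
  qed (use ab cd in auto)
qed

lemma test_fun_diff: "test_fun \<phi> \<Longrightarrow> test_fun \<psi> \<Longrightarrow> test_fun (\<lambda>x. \<phi> x - \<psi> x)"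
  using test_fun_add[OF _ test_fun_cmult[of \<psi> "-1"], of \<phi>] by simp

lemma test_fun_mult_smooth:
  assumes "test_fun \<phi>" "smooth_on {0<..} g"
  shows "test_fun (\<lambda>x. g x * \<phi> x)"
proof -
  obtain a b where ab: "0 < a" "a \<le> b" "\<And>x. x \<notin> {a..b} \<Longrightarrow> \<phi> x = 0" using assms(1) by (rule test_funE) blast
  have "smooth_on {0<..} (\<lambda>x. g x * \<phi> x)"
    using smooth_on_mult[OF open_greaterThan assms(2) test_fun_smooth[OF assms(1)]] .
  moreover have "smooth_on {..<a} (\<lambda>x. g x * \<phi> x)"
    by (rule smooth_on_cong[where g = "\<lambda>x. 0"]) (use ab in auto)
  ultimately have "smooth_on ({0<..} \<union> {..<a}) (\<lambda>x. g x * \<phi> x)"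
    by (rule smooth_on_Un)
  moreover have "{0<..} \<union> {..<a} = UNIV"
    using ab by auto
  ultimately have "smooth (\<lambda>x. g x * \<phi> x)"
    unfolding smooth_iff_smooth_on by metis
  then show ?thesis
    by (rule test_funI[of _ a b]) (use ab in auto)
qed

lemma closed_supp: "closed (supp \<phi>)"
  by (simp add: supp_def)

lemma vector_derivative_eq_0_outside:
  assumes "closed T" "\<And>x. x \<notin> T \<Longrightarrow> \<phi> x = 0" "x \<notin> T"
  shows "nth_deriv j \<phi> x = 0"
proof -
  have "nth_deriv j \<phi> x = nth_deriv j (\<lambda>_. 0) x"
    by (rule nth_deriv_cong[of "- T"]) (use assms in auto)
  also have "\<dots> = 0"
    by (rule nth_deriv_eqI[where S = UNIV and D = "\<lambda>_ _. 0"]) auto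
  finally show ?thesis .
qed

lemma test_fun_nth_deriv:
  assumes "test_fun \<phi>"
  shows "test_fun (nth_deriv j \<phi>)"
proof -
  obtain a b where ab: "0 < a" "a \<le> b" "\<And>x. x \<notin> {a..b} \<Longrightarrow> \<phi> x = 0" using assms by (rule test_funE) blast
  show ?thesis
  proof (rule test_funI[of _ a b])
    show "smooth (nth_deriv j \<phi>)"
      unfolding smooth_iff_smooth_on using assms by (intro smooth_on_nth_deriv test_fun_smooth)
  qed (use ab vector_derivative_eq_0_outside[of "{a..b}" \<phi>] in auto)
qed

lemma test_fun_vector_derivative: "test_fun \<phi> \<Longrightarrow> test_fun (\<lambda>x. vector_derivative \<phi> (at x))"
  using test_fun_nth_deriv[of \<phi> 1] by (simp add: nth_deriv_Suc)

lemma test_fun_dilation: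
  assumes "test_fun \<phi>" "c > 0"
  shows "test_fun (\<lambda>y. \<phi> (c * y))"
proof -
  obtain a b where ab: "0 < a" "a \<le> b" "\<And>x. x \<notin> {a..b} \<Longrightarrow> \<phi> x = 0" using assms(1) by (rule test_funE) blast
  show ?thesis
  proof (rule test_funI[of _ "a / c" "b / c"])
    show "smooth (\<lambda>y. \<phi> (c * y))"
      unfolding smooth_iff_smooth_on using smooth_on_affine[of UNIV UNIV \<phi> c 0] assms
      by (simp add: test_fun_smooth)
  qed (use assms ab in \<open>auto simp: field_simps\<close>)
qed

lemma test_fun_bounded:
  assumes "test_fun \<phi>"
  shows "bdd_above (range (\<lambda>x. norm (\<phi> x)))"
proof -
  obtain a b where ab: "0 < a" "a \<le> b" "\<And>x. x \<notin> {a..b} \<Longrightarrow> \<phi> x = 0" using assms by (rule test_funE) blast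
  have "continuous_on {a..b} \<phi>"
    using smooth_on_continuous[OF test_fun_smooth[OF assms, of UNIV], of _ 0]
    by (auto intro!: continuous_at_imp_continuous_on)
  then have "bounded (\<phi> ` {a..b})"
    by (intro compact_imp_bounded compact_continuous_image) auto
  then obtain B where B: "\<And>x. x \<in> {a..b} \<Longrightarrow> norm (\<phi> x) \<le> B"
    unfolding bounded_iff by blast
  have "norm (\<phi> x) \<le> max B 0" for x
    using B[of x] ab(3)[of x] by (cases "x \<in> {a..b}") auto
  then show ?thesis by (rule bdd_aboveI2)
qed

lemma test_fun_norm_le_SUP: "test_fun \<phi> \<Longrightarrow> norm (nth_deriv j \<phi> x) \<le> (SUP x. norm (nth_deriv j \<phi> x))"
  by (intro cSUP_upper test_fun_bounded test_fun_nth_deriv) auto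

lemma SUP_norm_nonneg: "test_fun \<phi> \<Longrightarrow> 0 \<le> (SUP x. norm (nth_deriv j \<phi> x))"
  using test_fun_norm_le_SUP[of \<phi> j 0] norm_ge_zero order_trans by blast

lemma vanish_outside_supp_subset: "supp \<phi> \<subseteq> K \<Longrightarrow> x \<notin> K \<Longrightarrow> \<phi> x = 0"
  using not_in_supp by blast

section \<open>Distributions supported on (0,1] and their values on smooth functions\<close>

lemma distribution_add: "distribution \<gamma> \<Longrightarrow> test_fun \<phi> \<Longrightarrow> test_fun \<psi> \<Longrightarrow> \<gamma> (\<lambda>x. \<phi> x + \<psi> x) = \<gamma> \<phi> + \<gamma> \<psi>"
  and distribution_cmult: "distribution \<gamma> \<Longrightarrow> test_fun \<phi> \<Longrightarrow> \<gamma> (\<lambda>x. c * \<phi> x) = c * \<gamma> \<phi>"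
  and distribution_not_test_fun: "distribution \<gamma> \<Longrightarrow> \<not> test_fun \<phi> \<Longrightarrow> \<gamma> \<phi> = 0"
  by (simp_all add: distribution_def)

lemma distribution_bound:
  assumes "distribution \<gamma>" "compact K \<and> K \<subseteq> {0<..}"
  obtains C N where "\<And>\<phi>. test_fun \<phi> \<and> supp \<phi> \<subseteq> K \<Longrightarrow>
    norm (\<gamma> \<phi>) \<le> C * (\<Sum>j\<le>N. SUP x. norm (nth_deriv j \<phi> x))"
proof -
  have "\<exists>C N. \<forall>\<phi>. test_fun \<phi> \<and> supp \<phi> \<subseteq> K \<longrightarrow>
    norm (\<gamma> \<phi>) \<le> C * (\<Sum>j\<le>N. SUP x. norm (nth_deriv j \<phi> x))"
    using assms unfolding distribution_def by (elim conjE) (erule allE[of _ K], simp)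
  then show ?thesis using that by blast
qed

lemma distribution_boundI:
  assumes "\<And>\<phi>. test_fun \<phi> \<and> supp \<phi> \<subseteq> K \<Longrightarrow> norm (\<gamma> \<phi>) \<le> C * (\<Sum>j\<le>N. SUP x. norm (nth_deriv j \<phi> x))"
  shows "\<exists>C N. \<forall>\<phi>. test_fun \<phi> \<and> supp \<phi> \<subseteq> K \<longrightarrow>
    norm (\<gamma> \<phi>) \<le> C * (\<Sum>j\<le>N. SUP x. norm (nth_deriv j \<phi> x))"
  by (rule exI[of _ C], rule exI[of _ N]) (use assms in simp)

lemma distribution_diff:
  "distribution \<gamma> \<Longrightarrow> test_fun \<phi> \<Longrightarrow> test_fun \<psi> \<Longrightarrow> \<gamma> (\<lambda>x. \<phi> x - \<psi> x) = \<gamma> \<phi> - \<gamma> \<psi>"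
  using distribution_add[of \<gamma> \<phi> "\<lambda>x. -1 * \<psi> x"] distribution_cmult[of \<gamma> \<psi> "-1"] test_fun_cmult[of \<psi> "-1"]
  by simp

lemma supported_on_eq_0:
  assumes "supported_on \<gamma> S" "test_fun \<phi>" "open U" "S \<subseteq> U" "\<And>x. x \<in> U \<Longrightarrow> \<phi> x = 0"
  shows "\<gamma> \<phi> = 0"
proof -
  have "supp \<phi> \<subseteq> - U"
    by (rule supp_subset_closedI) (use assms in auto)
  then show ?thesis using assms(1,2,4) by (auto simp: supported_on_def)
qed

lemma conv_carrier_iff: "\<gamma> \<in> carrier conv_algebra \<longleftrightarrow> distribution \<gamma> \<and> supported_on \<gamma> {0<..1}"
  by (simp add: conv_algebra_def)

text \<open>The difference of the two test functions has its support outside (0,1]. This is the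
  independence of choice behind \<open>dist_apply\<close>.\<close>

lemma carrier_cong_near:
  assumes "\<gamma> \<in> carrier conv_algebra" "test_fun \<phi>" "test_fun \<psi>" "e > 0"
    and "\<And>x. 0 < x \<Longrightarrow> x < 1 + e \<Longrightarrow> \<phi> x = \<psi> x"
  shows "\<gamma> \<phi> = \<gamma> \<psi>"
proof -
  have "\<gamma> (\<lambda>x. \<phi> x - \<psi> x) = 0"
    by (rule supported_on_eq_0[where U = "{0<..<1+e}"])
       (use assms in \<open>auto simp: conv_carrier_iff intro: test_fun_diff\<close>)
  then show ?thesis
    using distribution_diff[of \<gamma> \<phi> \<psi>] assms(1-3) by (simp add: conv_carrier_iff)
qed

lemma dist_apply_eq:
  assumes "\<gamma> \<in> carrier conv_algebra" "test_fun \<psi>" "e > 0" "\<And>x. 0 < x \<Longrightarrow> x < 1 + e \<Longrightarrow> \<psi> x = f x"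
  shows "dist_apply \<gamma> f = \<gamma> \<psi>"
  unfolding dist_apply_def
proof (rule the_equality)
  show "\<exists>\<psi>'. test_fun \<psi>' \<and> (\<exists>e>0. \<forall>x\<in>{0<..<1+e}. \<psi>' x = f x) \<and> \<gamma> \<psi> = \<gamma> \<psi>'"
    by (rule exI[of _ \<psi>]) (use assms in \<open>auto intro!: exI[of _ e]\<close>)
  fix c assume "\<exists>\<psi>. test_fun \<psi> \<and> (\<exists>e>0. \<forall>x\<in>{0<..<1+e}. \<psi> x = f x) \<and> c = \<gamma> \<psi>"
  then obtain \<psi>' e' where *: "test_fun \<psi>'" "e' > 0" "\<And>x. x \<in> {0<..<1+e'} \<Longrightarrow> \<psi>' x = f x" "c = \<gamma> \<psi>'"
    by blast
  show "c = \<gamma> \<psi>"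
    unfolding *(4) by (rule carrier_cong_near[where e = "min e e'"]) (use * assms in auto)
qed

section \<open>Operations that stay inside the convolution algebra\<close>

lemma regular_dist_in_carrier:
  assumes f: "\<And>K. compact K \<Longrightarrow> K \<subseteq> {0<..} \<Longrightarrow> set_integrable lborel K f"
    and f1: "\<And>t. t > 1 \<Longrightarrow> f t = 0"
  shows "regular_dist f \<in> carrier conv_algebra"
proof -
  \<comment> \<open>The support of \<phi> stays away from 0, so integrability on compact subsets of
    the open half-line suffices; the resulting seminorm estimate has order 0.\<close>
  have bnd: "set_integrable lborel {0<..} (\<lambda>t. f t * \<phi> t) \<and>
      norm (LBINT t:{0<..}. f t * \<phi> t) \<le> (LBINT t:K. norm (f t)) * (SUP x. norm (\<phi> x))"
    if \<phi>: "test_fun \<phi>" and K: "compact K" "K \<subseteq> {0<..}" "supp \<phi> \<subseteq> K" for \<phi> K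
  proof -
    let ?S = "SUP x. norm (\<phi> x)"
    have z: "\<phi> t = 0" if "t \<notin> K" for t using that K(3) vanish_outside_supp_subset by blast
    have eq: "indicator {0<..} t *\<^sub>R (f t * \<phi> t) = (indicator K t *\<^sub>R f t) * \<phi> t" for t
      using K(2) z[of t] by (auto simp: indicator_def)
    have meas: "\<phi> \<in> borel_measurable borel"
      using smooth_on_continuous[OF test_fun_smooth[OF \<phi>, of UNIV], of _ 0]
      by (auto intro!: borel_measurable_continuous_onI continuous_at_imp_continuous_on)
    have fK: "integrable lborel (\<lambda>t. indicator K t *\<^sub>R f t)"
      using f[OF K(1,2)] by (simp add: set_integrable_def)
    have le: "norm (\<phi> t) \<le> ?S" for t
      using test_fun_norm_le_SUP[OF \<phi>, of 0 t] by simp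
    have nn: "?S \<ge> 0" using le norm_ge_zero order_trans by blast
    have n: "norm (indicator K t *\<^sub>R f t * \<phi> t) \<le> norm (indicator K t *\<^sub>R f t) * ?S" for t
      unfolding norm_mult by (intro mult_left_mono le) auto
    have m: "(\<lambda>t. (indicator K t *\<^sub>R f t) * \<phi> t) \<in> borel_measurable lborel"
      using borel_measurable_times[OF borel_measurable_integrable[OF fK]] meas by simp
    have dom: "integrable lborel (\<lambda>t. norm (indicator K t *\<^sub>R f t) * ?S)"
      by (rule integrable_mult_left[OF integrable_norm[OF fK]])
    have n': "norm (indicator K t *\<^sub>R f t * \<phi> t) \<le> norm (norm (indicator K t *\<^sub>R f t) * ?S)" for t
      using n[of t] by (rule order_trans) simp
    have int: "integrable lborel (\<lambda>t. (indicator K t *\<^sub>R f t) * \<phi> t)"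
      by (rule Bochner_Integration.integrable_bound[OF dom m]) (use n' in blast)
    have "norm (LBINT t. (indicator K t *\<^sub>R f t) * \<phi> t) \<le> (LBINT t. norm (indicator K t *\<^sub>R f t) * ?S)"
      by (rule Bochner_Integration.integral_norm_bound_integral[OF int dom n])
    also have "\<dots> = (LBINT t:K. norm (f t)) * ?S"
      by (simp add: set_lebesgue_integral_def)
    finally show ?thesis
      using int unfolding set_integrable_def set_lebesgue_integral_def eq by simp
  qed
  have bnd': "set_integrable lborel {0<..} (\<lambda>t. f t * \<phi> t)" if "test_fun \<phi>" for \<phi>
    using bnd[OF that, of "supp \<phi>"] that by (auto simp: test_fun_def)
  have "distribution (regular_dist f)"
    unfolding distribution_def
  proof (intro conjI allI impI)
    fix K :: "real set" assume K: "compact K \<and> K \<subseteq> {0<..}"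
    show "\<exists>C N. \<forall>\<phi>. test_fun \<phi> \<and> supp \<phi> \<subseteq> K \<longrightarrow>
           norm (regular_dist f \<phi>) \<le> C * (\<Sum>j\<le>N. SUP x. norm (nth_deriv j \<phi> x))"
      by (rule exI[of _ "LBINT t:K. norm (f t)"], rule exI[of _ 0])
         (use bnd[of _ K] K in \<open>auto simp: regular_dist_def\<close>)
  next
    fix \<phi> \<psi> assume "test_fun \<phi>" "test_fun \<psi>"
    then show "regular_dist f (\<lambda>x. \<phi> x + \<psi> x) = regular_dist f \<phi> + regular_dist f \<psi>"
      using set_integral_add(2)[OF bnd' bnd', of \<phi> \<psi>] test_fun_add
      by (simp add: regular_dist_def ring_distribs)
  next
    fix c \<phi> assume "test_fun \<phi>"
    then show "regular_dist f (\<lambda>x. c * \<phi> x) = c * regular_dist f \<phi>"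
      using test_fun_cmult by (simp add: regular_dist_def mult.left_commute)
  qed (simp add: regular_dist_def)
  moreover have "supported_on (regular_dist f) {0<..1}"
    unfolding supported_on_def
  proof (intro allI impI)
    fix \<phi> assume \<phi>: "test_fun \<phi> \<and> supp \<phi> \<inter> {0<..1} = {}"
    have z: "indicator {0<..} t *\<^sub>R (f t * \<phi> t) = 0" for t
    proof (cases "t \<in> {0<..1}")
      case True
      then have "t \<notin> supp \<phi>" using \<phi> by blast
      then show ?thesis using not_in_supp[of t \<phi>] by simp
    qed (use f1[of t] in auto)
    show "regular_dist f \<phi> = 0"
      unfolding regular_dist_def set_lebesgue_integral_def z by simp
  qed
  ultimately show ?thesis by (simp add: conv_carrier_iff)
qed

lemma dist_scale_in_carrier:
  assumes "\<gamma> \<in> carrier conv_algebra"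
  shows "dist_scale c \<gamma> \<in> carrier conv_algebra"
proof -
  have \<gamma>: "distribution \<gamma>" using assms by (simp add: conv_carrier_iff)
  have "distribution (dist_scale c \<gamma>)"
    unfolding distribution_def
  proof (intro conjI allI impI)
    fix K :: "real set" assume "compact K \<and> K \<subseteq> {0<..}"
    then obtain C N where CN: "\<And>\<phi>. test_fun \<phi> \<and> supp \<phi> \<subseteq> K \<Longrightarrow>
           norm (\<gamma> \<phi>) \<le> C * (\<Sum>j\<le>N. SUP x. norm (nth_deriv j \<phi> x))"
      using distribution_bound[OF \<gamma>] by metis
    show "\<exists>C N. \<forall>\<phi>. test_fun \<phi> \<and> supp \<phi> \<subseteq> K \<longrightarrow>
           norm (dist_scale c \<gamma> \<phi>) \<le> C * (\<Sum>j\<le>N. SUP x. norm (nth_deriv j \<phi> x))"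
      by (rule exI[of _ "norm c * C"], rule exI[of _ N])
         (auto simp: dist_scale_def norm_mult mult.assoc intro!: mult_left_mono CN)
  qed (auto simp: dist_scale_def distribution_add[OF \<gamma>] distribution_cmult[OF \<gamma>] distribution_not_test_fun[OF \<gamma>] algebra_simps)
  then show ?thesis
    using assms by (auto simp: conv_carrier_iff supported_on_def dist_scale_def)
qed

lemma supp_nth_deriv_subset: "supp (nth_deriv j \<phi>) \<subseteq> supp \<phi>"
  by (rule supp_subset_closedI[OF closed_supp]) (rule vector_derivative_eq_0_outside[OF closed_supp not_in_supp])

lemma test_fun_deriv1: "test_fun \<phi> \<Longrightarrow> (\<phi> has_vector_derivative vector_derivative \<phi> (at x)) (at x)"
  using smooth_on_deriv1[of UNIV \<phi> x] test_fun_smooth[of \<phi> UNIV] by simp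

lemma dist_deriv_in_carrier:
  assumes "\<gamma> \<in> carrier conv_algebra"
  shows "dist_deriv \<gamma> \<in> carrier conv_algebra"
proof -
  have supp': "supp (\<lambda>x. vector_derivative \<phi> (at x)) \<subseteq> supp \<phi>" for \<phi>
    using supp_nth_deriv_subset[of 1 \<phi>] by (simp add: nth_deriv_Suc)
  have \<gamma>: "distribution \<gamma>" using assms by (simp add: conv_carrier_iff)
  have "distribution (dist_deriv \<gamma>)"
    unfolding distribution_def
  proof (intro conjI allI impI)
    fix K :: "real set" assume K: "compact K \<and> K \<subseteq> {0<..}"
    then obtain C N where CN: "\<And>\<phi>. test_fun \<phi> \<and> supp \<phi> \<subseteq> K \<Longrightarrow>
           norm (\<gamma> \<phi>) \<le> C * (\<Sum>j\<le>N. SUP x. norm (nth_deriv j \<phi> x))"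
      using distribution_bound[OF \<gamma>] by metis
    \<comment> \<open>The absolute value guards against a negative constant; the derivative raises
      the order of the estimate by one.\<close>
    have "norm (dist_deriv \<gamma> \<phi>) \<le> \<bar>C\<bar> * (\<Sum>j\<le>Suc N. SUP x. norm (nth_deriv j \<phi> x))"
      if \<phi>: "test_fun \<phi> \<and> supp \<phi> \<subseteq> K" for \<phi>
    proof -
      have t: "test_fun (\<lambda>x. vector_derivative \<phi> (at x))"
        using \<phi> by (simp add: test_fun_vector_derivative)
      have "norm (dist_deriv \<gamma> \<phi>) = norm (\<gamma> (\<lambda>x. vector_derivative \<phi> (at x)))"
        using \<phi> by (simp add: dist_deriv_def)
      also have "\<dots> \<le> C * (\<Sum>j\<le>N. SUP x. norm (nth_deriv (Suc j) \<phi> x))"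
        using CN[of "\<lambda>x. vector_derivative \<phi> (at x)"] t order_trans[OF supp'[of \<phi>], of K] \<phi>
        by (simp add: nth_deriv_Suc')
      also have "\<dots> \<le> \<bar>C\<bar> * (\<Sum>j\<le>N. SUP x. norm (nth_deriv (Suc j) \<phi> x))"
        using \<phi> by (intro mult_right_mono sum_nonneg SUP_norm_nonneg) auto
      also have "\<dots> \<le> \<bar>C\<bar> * (\<Sum>j\<le>Suc N. SUP x. norm (nth_deriv j \<phi> x))"
        using \<phi> SUP_norm_nonneg[of \<phi> 0] by (subst sum.atMost_Suc_shift) (intro mult_left_mono, auto)
      finally show ?thesis .
    qed
    then show "\<exists>C N. \<forall>\<phi>. test_fun \<phi> \<and> supp \<phi> \<subseteq> K \<longrightarrow>
           norm (dist_deriv \<gamma> \<phi>) \<le> C * (\<Sum>j\<le>N. SUP x. norm (nth_deriv j \<phi> x))"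
      by (rule distribution_boundI)
  next
    fix \<phi> \<psi> assume *: "test_fun \<phi>" "test_fun \<psi>"
    have "vector_derivative (\<lambda>x. \<phi> x + \<psi> x) (at t) = vector_derivative \<phi> (at t) + vector_derivative \<psi> (at t)" for t
      by (rule vector_derivative_at[OF has_vector_derivative_add]) (rule test_fun_deriv1, fact)+
    then show "dist_deriv \<gamma> (\<lambda>x. \<phi> x + \<psi> x) = dist_deriv \<gamma> \<phi> + dist_deriv \<gamma> \<psi>"
      using * by (simp add: dist_deriv_def test_fun_add test_fun_vector_derivative distribution_add[OF \<gamma>])
  next
    fix c \<phi> assume *: "test_fun \<phi>"
    have "vector_derivative (\<lambda>x. c * \<phi> x) (at t) = c * vector_derivative \<phi> (at t)" for t
      by (rule vector_derivative_at[OF has_vector_derivative_mult_right]) (rule test_fun_deriv1, fact)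
    then show "dist_deriv \<gamma> (\<lambda>x. c * \<phi> x) = c * dist_deriv \<gamma> \<phi>"
      using * by (simp add: dist_deriv_def test_fun_cmult test_fun_vector_derivative distribution_cmult[OF \<gamma>])
  qed (simp add: dist_deriv_def)
  moreover have "supported_on (dist_deriv \<gamma>) {0<..1}"
    unfolding supported_on_def
  proof (intro allI impI)
    fix \<phi> assume \<phi>: "test_fun \<phi> \<and> supp \<phi> \<inter> {0<..1} = {}"
    then have "supp (\<lambda>x. vector_derivative \<phi> (at x)) \<inter> {0<..1} = {}"
      using supp'[of \<phi>] by auto
    then show "dist_deriv \<gamma> \<phi> = 0"
      using \<phi> assms test_fun_vector_derivative
      by (simp add: dist_deriv_def conv_carrier_iff supported_on_def)
  qed
  ultimately show ?thesis by (simp add: conv_carrier_iff)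
qed

text \<open>Induction on j with \<open>g\<close> arbitrary: (g \<phi>)' = g \<phi>' + g' \<phi>, and
  the hypothesis is applied once to g and \<phi>', once to g' and \<phi>. The constant depends on g,
  K and j but not on \<phi>, as the seminorm estimate demands.\<close>

lemma Leibniz_bound:
  assumes "smooth_on {0<..} g" "compact K" "K \<subseteq> {0<..}"
  shows "\<exists>C\<ge>0. \<forall>\<phi>. test_fun \<phi> \<and> supp \<phi> \<subseteq> K \<longrightarrow>
     (\<forall>x. norm (nth_deriv j (\<lambda>t. g t * \<phi> t) x) \<le> C * (\<Sum>i\<le>j. SUP x. norm (nth_deriv i \<phi> x)))"
  using assms
proof (induction j arbitrary: g)
  case 0
  have "continuous_on K g"
    using smooth_on_continuous[OF 0(1), of _ 0] 0(3) by (auto intro!: continuous_at_imp_continuous_on)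
  then have "bounded (g ` K)"
    by (intro compact_imp_bounded compact_continuous_image 0)
  then obtain B where B: "B > 0" "\<And>x. x \<in> K \<Longrightarrow> norm (g x) \<le> B"
    by (auto simp: bounded_pos)
  show ?case
  proof (intro exI[of _ B] conjI allI impI)
    fix \<phi> x assume \<phi>: "test_fun \<phi> \<and> supp \<phi> \<subseteq> K"
    show "norm (nth_deriv 0 (\<lambda>t. g t * \<phi> t) x) \<le> B * (\<Sum>i\<le>0. SUP x. norm (nth_deriv i \<phi> x))"
    proof (cases "x \<in> K")
      case True
      then show ?thesis
        using B test_fun_norm_le_SUP[of \<phi> 0 x] \<phi> by (auto simp: norm_mult intro!: mult_mono)
    next
      case False
      then have "\<phi> x = 0" using \<phi> vanish_outside_supp_subset by blast
      then show ?thesis using B SUP_norm_nonneg[of \<phi> 0] \<phi> by auto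
    qed
  qed (use B in auto)
next
  case (Suc j)
  let ?g' = "\<lambda>x. vector_derivative g (at x)"
  obtain C where C: "C \<ge> 0" "\<forall>\<phi>. test_fun \<phi> \<and> supp \<phi> \<subseteq> K \<longrightarrow>
      (\<forall>x. norm (nth_deriv j (\<lambda>t. g t * \<phi> t) x) \<le> C * (\<Sum>i\<le>j. SUP x. norm (nth_deriv i \<phi> x)))"
    using Suc.IH[OF Suc.prems] by (elim exE conjE)
  obtain C' where C': "C' \<ge> 0" "\<forall>\<phi>. test_fun \<phi> \<and> supp \<phi> \<subseteq> K \<longrightarrow>
      (\<forall>x. norm (nth_deriv j (\<lambda>t. ?g' t * \<phi> t) x) \<le> C' * (\<Sum>i\<le>j. SUP x. norm (nth_deriv i \<phi> x)))"
    using Suc.IH[OF smooth_on_vector_derivative[OF Suc.prems(1)] Suc.prems(2,3)] by (elim exE conjE)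
  show ?case
  proof (intro exI[of _ "C + C'"] conjI allI impI)
    fix \<phi> x assume \<phi>: "test_fun \<phi> \<and> supp \<phi> \<subseteq> K"
    let ?\<phi>' = "\<lambda>x. vector_derivative \<phi> (at x)"
    let ?S = "\<lambda>j. \<Sum>i\<le>j. SUP x. norm (nth_deriv i \<phi> x)"
    have \<phi>': "test_fun ?\<phi>' \<and> supp ?\<phi>' \<subseteq> K"
      using \<phi> test_fun_vector_derivative supp_nth_deriv_subset[of 1 \<phi>] by (auto simp: nth_deriv_Suc)
    show "norm (nth_deriv (Suc j) (\<lambda>t. g t * \<phi> t) x) \<le> (C + C') * ?S (Suc j)"
    proof (cases "x > 0")
      case True
      have "nth_deriv (Suc j) (\<lambda>t. g t * \<phi> t) x = nth_deriv j (\<lambda>t. g t * ?\<phi>' t + ?g' t * \<phi> t) x"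
        unfolding nth_deriv_Suc'
      proof (rule nth_deriv_cong[of "{0<..}"])
        fix t :: real assume "t \<in> {0<..}"
        then show "vector_derivative (\<lambda>t. g t * \<phi> t) (at t) = g t * ?\<phi>' t + ?g' t * \<phi> t"
          by (intro vector_derivative_at has_vector_derivative_mult smooth_on_deriv1[OF Suc.prems(1)] test_fun_deriv1 conjunct1[OF \<phi>])
      qed (use True in auto)
      also have "\<dots> = nth_deriv j (\<lambda>t. g t * ?\<phi>' t) x + nth_deriv j (\<lambda>t. ?g' t * \<phi> t) x"
      proof (rule nth_deriv_eqI[where S = "{0<..}" and D = "\<lambda>j x. nth_deriv j (\<lambda>t. g t * ?\<phi>' t) x + nth_deriv j (\<lambda>t. ?g' t * \<phi> t) x"])
        fix i and t :: real assume t: "t \<in> {0<..}"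
        have 1: "smooth_on {0<..} (\<lambda>t. g t * ?\<phi>' t)"
          using smooth_on_mult[OF open_greaterThan Suc.prems(1) test_fun_smooth] \<phi>' by blast
        have 2: "smooth_on {0<..} (\<lambda>t. ?g' t * \<phi> t)"
          using smooth_on_mult[OF open_greaterThan smooth_on_vector_derivative[OF Suc.prems(1)] test_fun_smooth] \<phi> by blast
        show "((\<lambda>x. nth_deriv i (\<lambda>t. g t * ?\<phi>' t) x + nth_deriv i (\<lambda>t. ?g' t * \<phi> t) x) has_vector_derivative
           nth_deriv (Suc i) (\<lambda>t. g t * ?\<phi>' t) t + nth_deriv (Suc i) (\<lambda>t. ?g' t * \<phi> t) t) (at t)"
          by (rule has_vector_derivative_add[OF smooth_on_has_vector_derivative[OF 1 t] smooth_on_has_vector_derivative[OF 2 t]])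
      qed (use True in auto)
      also have "norm \<dots> \<le> C * (\<Sum>i\<le>j. SUP x. norm (nth_deriv i ?\<phi>' x)) + C' * ?S j"
        by (intro norm_triangle_mono C(2)[rule_format, OF \<phi>'] C'(2)[rule_format, OF \<phi>])
      also have "(\<Sum>i\<le>j. SUP x. norm (nth_deriv i ?\<phi>' x)) \<le> ?S (Suc j)"
        using SUP_norm_nonneg[of \<phi> 0] \<phi> by (subst sum.atMost_Suc_shift) (simp add: nth_deriv_Suc')
      also have "?S j \<le> ?S (Suc j)"
        using SUP_norm_nonneg[of \<phi> "Suc j"] \<phi> by simp
      finally show ?thesis
        using C(1) C'(1) by (simp add: mult_left_mono ring_distribs)
    next
      case False
      then have "x \<notin> K" using Suc.prems by auto
      then have "nth_deriv (Suc j) (\<lambda>t. g t * \<phi> t) x = 0"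
        using \<phi> vanish_outside_supp_subset[of \<phi> K] Suc.prems
        by (intro vector_derivative_eq_0_outside[of K]) (auto simp: compact_imp_closed)
      moreover have "?S (Suc j) \<ge> 0"
        using \<phi> by (intro sum_nonneg SUP_norm_nonneg) auto
      ultimately show ?thesis using C(1) C'(1) by simp
    qed
  qed (use C(1) C'(1) in auto)
qed

lemma dist_fun_mult_in_carrier:
  assumes "\<gamma> \<in> carrier conv_algebra" and g: "smooth_on {0<..} g"
  shows "dist_fun_mult g \<gamma> \<in> carrier conv_algebra"
proof -
  have supp': "supp (\<lambda>x. g x * \<phi> x) \<subseteq> supp \<phi>" for \<phi>
    unfolding supp_def by (rule closure_mono) auto
  have \<gamma>: "distribution \<gamma>" using assms by (simp add: conv_carrier_iff)
  note tg = test_fun_mult_smooth[OF _ g]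
  have "distribution (dist_fun_mult g \<gamma>)"
    unfolding distribution_def
  proof (intro conjI allI impI)
    fix K :: "real set" assume K: "compact K \<and> K \<subseteq> {0<..}"
    then obtain C N where CN: "\<And>\<phi>. test_fun \<phi> \<and> supp \<phi> \<subseteq> K \<Longrightarrow>
           norm (\<gamma> \<phi>) \<le> C * (\<Sum>j\<le>N. SUP x. norm (nth_deriv j \<phi> x))"
      using distribution_bound[OF \<gamma>] by metis
    have "\<forall>j. \<exists>C. C \<ge> 0 \<and> (\<forall>\<phi>. test_fun \<phi> \<and> supp \<phi> \<subseteq> K \<longrightarrow>
     (\<forall>x. norm (nth_deriv j (\<lambda>t. g t * \<phi> t) x) \<le> C * (\<Sum>i\<le>j. SUP x. norm (nth_deriv i \<phi> x))))"
      using Leibniz_bound[OF g conjunct1[OF K] conjunct2[OF K]] by (rule allI)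
    from choice[OF this] obtain B where B: "\<forall>j. B j \<ge> 0 \<and> (\<forall>\<phi>. test_fun \<phi> \<and> supp \<phi> \<subseteq> K \<longrightarrow>
     (\<forall>x. norm (nth_deriv j (\<lambda>t. g t * \<phi> t) x) \<le> B j * (\<Sum>i\<le>j. SUP x. norm (nth_deriv i \<phi> x))))"
      by (rule exE)
    note B1 = conjunct1[OF B[rule_format]] and B2 = conjunct2[OF B[rule_format], rule_format]
    have "norm (dist_fun_mult g \<gamma> \<phi>) \<le> (\<bar>C\<bar> * (\<Sum>j\<le>N. B j)) * (\<Sum>j\<le>N. SUP x. norm (nth_deriv j \<phi> x))"
      if \<phi>: "test_fun \<phi> \<and> supp \<phi> \<subseteq> K" for \<phi>
    proof -
      let ?S = "\<lambda>j. \<Sum>i\<le>j. SUP x. norm (nth_deriv i \<phi> x)"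
      have t: "test_fun (\<lambda>x. g x * \<phi> x)" using \<phi> tg by blast
      have "norm (dist_fun_mult g \<gamma> \<phi>) \<le> C * (\<Sum>j\<le>N. SUP x. norm (nth_deriv j (\<lambda>x. g x * \<phi> x) x))"
        using CN[of "\<lambda>x. g x * \<phi> x"] t order_trans[OF supp'[of \<phi>], of K] \<phi>
        by (simp add: dist_fun_mult_def)
      also have "\<dots> \<le> \<bar>C\<bar> * (\<Sum>j\<le>N. SUP x. norm (nth_deriv j (\<lambda>x. g x * \<phi> x) x))"
        using t by (intro mult_right_mono sum_nonneg SUP_norm_nonneg) auto
      also have "(\<Sum>j\<le>N. SUP x. norm (nth_deriv j (\<lambda>x. g x * \<phi> x) x)) \<le> (\<Sum>j\<le>N. B j * ?S N)"
      proof (rule sum_mono)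
        fix j assume j: "j \<in> {..N}"
        have "norm (nth_deriv j (\<lambda>x. g x * \<phi> x) x) \<le> B j * ?S N" for x
        proof -
          have "?S j \<le> ?S N"
            using j \<phi> by (intro sum_mono2 SUP_norm_nonneg) auto
          then show ?thesis using B2[OF \<phi>, of j x] mult_left_mono[OF _ B1[of j]] by (meson order_trans)
        qed
        then show "(SUP x. norm (nth_deriv j (\<lambda>x. g x * \<phi> x) x)) \<le> B j * ?S N"
          by (intro cSUP_least) auto
      qed
      finally show ?thesis by (simp add: sum_distrib_right mult.assoc mult_left_mono)
    qed
    then show "\<exists>C N. \<forall>\<phi>. test_fun \<phi> \<and> supp \<phi> \<subseteq> K \<longrightarrow>
           norm (dist_fun_mult g \<gamma> \<phi>) \<le> C * (\<Sum>j\<le>N. SUP x. norm (nth_deriv j \<phi> x))"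
      by (rule distribution_boundI)
  next
    fix \<phi> \<psi> assume "test_fun \<phi>" "test_fun \<psi>"
    then show "dist_fun_mult g \<gamma> (\<lambda>x. \<phi> x + \<psi> x) = dist_fun_mult g \<gamma> \<phi> + dist_fun_mult g \<gamma> \<psi>"
      by (simp add: dist_fun_mult_def test_fun_add distrib_left tg distribution_add[OF \<gamma>])
  next
    fix c \<phi> assume "test_fun \<phi>"
    then show "dist_fun_mult g \<gamma> (\<lambda>x. c * \<phi> x) = c * dist_fun_mult g \<gamma> \<phi>"
      by (simp add: dist_fun_mult_def test_fun_cmult mult.left_commute[of _ c] tg distribution_cmult[OF \<gamma>])
  qed (simp add: dist_fun_mult_def)
  moreover have "supported_on (dist_fun_mult g \<gamma>) {0<..1}"
    unfolding supported_on_def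
  proof (intro allI impI)
    fix \<phi> assume \<phi>: "test_fun \<phi> \<and> supp \<phi> \<inter> {0<..1} = {}"
    then have "supp (\<lambda>x. g x * \<phi> x) \<inter> {0<..1} = {}"
      using supp'[of \<phi>] by auto
    then show "dist_fun_mult g \<gamma> \<phi> = 0"
      using \<phi> assms tg
      by (simp add: dist_fun_mult_def conv_carrier_iff supported_on_def)
  qed
  ultimately show ?thesis by (simp add: conv_carrier_iff)
qed

lemma smooth_on_of_real: "smooth_on S complex_of_real"
proof (rule smooth_on_subset[OF _ subset_UNIV], rule smooth_on_coinduct[where P = "\<lambda>f. \<exists>c d. f = (\<lambda>x. c * complex_of_real x + d)"])
  fix f assume "\<exists>c d. f = (\<lambda>x. c * complex_of_real x + d)"
  then obtain c d where f: "f = (\<lambda>x. c * complex_of_real x + d)" by blast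
  have "(complex_of_real has_vector_derivative 1) (at x)" for x
    using has_vector_derivative_of_real[OF DERIV_ident] by simp
  then have "(f has_vector_derivative c) (at x)" for x
    unfolding f by (auto intro!: derivative_eq_intros)
  then show "\<exists>f'. (\<exists>c d. f' = (\<lambda>x. c * complex_of_real x + d)) \<and> (\<forall>x\<in>UNIV. (f has_vector_derivative f' x) (at x))"
    by (intro exI[of _ "\<lambda>_. c"] conjI exI[of _ 0] exI[of _ c]) simp_all
next
  show "\<exists>c d. complex_of_real = (\<lambda>x. c * complex_of_real x + d)"
    by (intro exI[of _ 1] exI[of _ 0]) simp
qed simp

section \<open>Pairing a distribution with dilated test functions\<close>

lemma dilation_has_vector_derivative:
  assumes "test_fun \<phi>"
  shows "((\<lambda>x. of_real x ^ i * nth_deriv i \<phi> (x * y)) has_vector_derivative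
     of_nat i * of_real x ^ (i - 1) * nth_deriv i \<phi> (x * y) + of_real x ^ i * (of_real y * nth_deriv (Suc i) \<phi> (x * y))) (at x)"
    (is ?A)
    and "((\<lambda>y. of_real x ^ i * nth_deriv i \<phi> (x * y)) has_vector_derivative
     of_real x ^ Suc i * nth_deriv (Suc i) \<phi> (x * y)) (at y)" (is ?B)
proof -
  have d: "((\<lambda>x. nth_deriv i \<phi> (x * y)) has_vector_derivative of_real y * nth_deriv (Suc i) \<phi> (x * y)) (at x)" for x y i
  proof -
    have "((\<lambda>x. x * y) has_vector_derivative y) (at x)"
      by (auto intro!: derivative_eq_intros)
    from vector_diff_chain_at[OF this smooth_on_has_vector_derivative[OF test_fun_smooth[OF assms, of UNIV]]]
    show ?thesis by (simp add: o_def scaleR_conv_of_real)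
  qed
  have p: "((\<lambda>x. complex_of_real (x ^ i)) has_vector_derivative complex_of_real (of_nat i * x ^ (i - 1))) (at x)"
    by (rule has_vector_derivative_of_real) (use DERIV_pow[of i x UNIV] in simp)
  show ?A
    using has_vector_derivative_mult[OF p d] by (simp add: add.commute)
  show ?B
    using has_vector_derivative_mult_right[OF d[of i x y], of "of_real x ^ i"] by (simp add: mult_ac)
qed

text \<open>Differentiation under the pairing. The seminorm estimate reduces it to showing that the
  first-order remainder in x is o(h) together with each of its y-derivatives, uniformly in y and
  with supports in one compact set.\<close>

lemma dist_pairing_has_vector_derivative:
  assumes \<delta>: "distribution \<delta>" and \<phi>: "test_fun \<phi>" and x0: "x0 > 0"
  shows "((\<lambda>x. \<delta> (\<lambda>y. \<phi> (x * y))) has_vector_derivative \<delta> (\<lambda>y. of_real y * nth_deriv 1 \<phi> (x0 * y))) (at x0)"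
proof -
  obtain a b where ab: "0 < a" "a \<le> b" "\<And>x. x \<notin> {a..b} \<Longrightarrow> \<phi> x = 0" using \<phi> by (rule test_funE) blast
  \<comment> \<open>For x in I the function y -> \<phi> (x y) lives on K: x \<ge> x0 / 2 gives y
    \<le> 2 b / x0, and x \<le> 3 x0 / 2 gives y \<ge> 2 a / (3 x0), which exceeds the chosen lower
    end.\<close>
  define I where "I = {x0 / 2..3 * x0 / 2}"
  define K where "K = {a / (2 * x0)..2 * b / x0}"
  have K: "compact K \<and> K \<subseteq> {0<..}"
    using ab x0 by (auto simp: K_def dest: order.strict_trans2[rotated] intro: order.strict_trans2[of _ "a / (2 * x0)"])
  have z: "nth_deriv i \<phi> (x * y) = 0" if "x \<in> I" "y \<notin> K" for i x y
  proof (rule vector_derivative_eq_0_outside[of "{a..b}"])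
    have x: "x > 0" "x \<le> 3 * x0 / 2" "x0 / 2 \<le> x" using that(1) x0 by (auto simp: I_def)
    show "x * y \<notin> {a..b}"
    proof (cases "y < a / (2 * x0)")
      case True
      have "x * y < a"
      proof (cases "y \<le> 0")
        case False
        then have "x * y \<le> 3 * x0 / 2 * y" using x by (intro mult_right_mono) auto
        also have "\<dots> < 3 * x0 / 2 * (a / (2 * x0))" using True x0 by (intro mult_strict_left_mono) auto
        also have "\<dots> < a" using x0 ab by simp
        finally show ?thesis .
      qed (use x ab mult_nonneg_nonpos[of x y] in auto)
      then show ?thesis by auto
    next
      case False
      then have y: "2 * b / x0 < y" using that(2) by (auto simp: K_def)
      have "0 \<le> 2 * b / x0" using ab x0 by simp
      then have y0: "0 < y" using y by linarith
      have "b = x0 / 2 * (2 * b / x0)" using x0 by simp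
      also have "\<dots> < x0 / 2 * y" using y x0 by (intro mult_strict_left_mono) auto
      also have "\<dots> \<le> x * y" using x y0 by (intro mult_right_mono) auto
      finally show ?thesis by auto
    qed
  qed (use ab in auto)
  \<comment> \<open>\<open>\<Phi> i\<close> is the i-th y-derivative of \<phi> (x y), and
    \<open>\<Psi> i\<close> is the x-derivative of \<open>\<Phi> i\<close>.\<close>
  define \<Phi> where "\<Phi> i x y = of_real x ^ i * nth_deriv i \<phi> (x * y)" for i x y
  define \<Psi> where "\<Psi> i x y = of_nat i * of_real x ^ (i - 1) * nth_deriv i \<phi> (x * y)
     + of_real x ^ i * (of_real y * nth_deriv (Suc i) \<phi> (x * y))" for i x y
  have dx: "((\<lambda>x. \<Phi> i x y) has_vector_derivative \<Psi> i x y) (at x)" for i x y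
    unfolding \<Phi>_def \<Psi>_def by (rule dilation_has_vector_derivative(1)[OF \<phi>])
  have dy: "((\<lambda>y. \<Phi> i x y) has_vector_derivative \<Phi> (Suc i) x y) (at y)" for i x y
    unfolding \<Phi>_def by (rule dilation_has_vector_derivative(2)[OF \<phi>])
  have \<Psi>_alt: "\<Psi> i x y = of_nat i * of_real x ^ (i - 1) * nth_deriv i \<phi> (x * y) + of_real y * (of_real x ^ i * nth_deriv (Suc i) \<phi> (x * y))" for i x y
    by (simp add: \<Psi>_def)
  have c: "isCont (nth_deriv i \<phi>) u" for i u
    using smooth_on_continuous[OF test_fun_smooth[OF \<phi>, of UNIV]] by simp
  have dy': "((\<lambda>y. \<Psi> i x y) has_vector_derivative \<Psi> (Suc i) x y) (at y)" for i x y
  proof -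
    have 1: "((\<lambda>y. nth_deriv j \<phi> (x * y)) has_vector_derivative of_real x * nth_deriv (Suc j) \<phi> (x * y)) (at y)" for j
    proof -
      have "((\<lambda>y. x * y) has_vector_derivative x) (at y)"
        by (auto intro!: derivative_eq_intros)
      from vector_diff_chain_at[OF this smooth_on_has_vector_derivative[OF test_fun_smooth[OF \<phi>, of UNIV]]]
      show ?thesis by (simp add: o_def scaleR_conv_of_real)
    qed
    have "((\<lambda>y. of_nat i * of_real x ^ (i - 1) * nth_deriv i \<phi> (x * y) + of_real y * (of_real x ^ i * nth_deriv (Suc i) \<phi> (x * y)))
      has_vector_derivative
      of_nat i * of_real x ^ (i - 1) * (of_real x * nth_deriv (Suc i) \<phi> (x * y)) +
      (of_real y * (of_real x ^ i * (of_real x * nth_deriv (Suc (Suc i)) \<phi> (x * y))) + of_real 1 * (of_real x ^ i * nth_deriv (Suc i) \<phi> (x * y)))) (at y)"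
      by (intro has_vector_derivative_add has_vector_derivative_mult_right 1 has_vector_derivative_mult
          has_vector_derivative_of_real DERIV_ident)
    also have "of_nat i * of_real x ^ (i - 1) * (of_real x * nth_deriv (Suc i) \<phi> (x * y)) +
      (of_real y * (of_real x ^ i * (of_real x * nth_deriv (Suc (Suc i)) \<phi> (x * y))) + of_real 1 * (of_real x ^ i * nth_deriv (Suc i) \<phi> (x * y)))
      = \<Psi> (Suc i) x y"
      by (cases i) (simp_all add: \<Psi>_alt algebra_simps)
    finally show ?thesis
      unfolding \<Psi>_alt .
  qed
  \<comment> \<open>The first-order Taylor remainder in x at x0; the next step expresses its
    y-derivatives through \<open>\<Phi>\<close> and \<open>\<Psi>\<close>.\<close>
  define r where "r h y = \<phi> ((x0 + h) * y) - \<phi> (x0 * y) - of_real h * (of_real y * nth_deriv 1 \<phi> (x0 * y))" for h y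
  have nr: "nth_deriv i (r h) y = \<Phi> i (x0 + h) y - \<Phi> i x0 y - of_real h * \<Psi> i x0 y" for i h y
  proof (rule nth_deriv_eqI[where S = UNIV])
    fix j t
    show "((\<lambda>y. \<Phi> j (x0 + h) y - \<Phi> j x0 y - of_real h * \<Psi> j x0 y) has_vector_derivative
       \<Phi> (Suc j) (x0 + h) t - \<Phi> (Suc j) x0 t - of_real h * \<Psi> (Suc j) x0 t) (at t)"
      by (intro has_vector_derivative_diff has_vector_derivative_mult_right dy dy')
  qed (auto simp: r_def \<Phi>_def \<Psi>_def)
  have ty: "test_fun (\<lambda>y. of_real y * nth_deriv 1 \<phi> (x0 * y))"
    by (rule test_fun_mult_smooth[OF test_fun_dilation[OF test_fun_nth_deriv[OF \<phi>] x0]]) (rule smooth_on_of_real)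
  have tr: "test_fun (r h)" if "\<bar>h\<bar> < x0 / 2" for h
    unfolding r_def[abs_def]
    by (intro test_fun_diff test_fun_cmult ty test_fun_dilation[OF \<phi>]) (use that x0 in auto)
  have I: "x0 + h \<in> I" if "\<bar>h\<bar> < x0 / 2" for h
    using that by (auto simp: I_def abs_less_iff)
  have x0I: "x0 \<in> I" using x0 by (auto simp: I_def)
  have nr0: "nth_deriv i (r h) y = 0" if "\<bar>h\<bar> < x0 / 2" "y \<notin> K" for i h y
    unfolding nr \<Phi>_def \<Psi>_def by (simp add: z[OF I[OF that(1)] that(2)] z[OF x0I that(2)])
  have sr: "supp (r h) \<subseteq> K" if "\<bar>h\<bar> < x0 / 2" for h
    by (rule supp_subset_closedI) (use K nr0[OF that, of _ 0] in \<open>auto simp: compact_imp_closed\<close>)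
  \<comment> \<open>Uniform continuity of \<open>\<Psi> i\<close> on the compact rectangle makes the
    mean value estimate for \<open>\<Phi> i\<close> uniform in y.\<close>
  have ev: "eventually (\<lambda>h. \<forall>y. norm (nth_deriv i (r h) y) \<le> e * \<bar>h\<bar>) (at 0)" if e: "e > 0" for i e
  proof -
    have cn: "continuous_on (I \<times> K) (\<lambda>p. nth_deriv j \<phi> (fst p * snd p))" for j
    proof (rule continuous_on_compose2[of UNIV "nth_deriv j \<phi>"])
      show "continuous_on UNIV (nth_deriv j \<phi>)"
        by (rule continuous_at_imp_continuous_on) (simp add: c)
      show "continuous_on (I \<times> K) (\<lambda>p. fst p * snd p)"
        by (intro continuous_on_mult continuous_on_fst continuous_on_snd continuous_on_id)
    qed simp
    have "continuous_on (I \<times> K) (\<lambda>p. \<Psi> i (fst p) (snd p))"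
      unfolding \<Psi>_def by (intro continuous_on_add continuous_on_mult continuous_on_power continuous_on_of_real
          continuous_on_fst continuous_on_snd continuous_on_const continuous_on_id cn)
    then have "uniformly_continuous_on (I \<times> K) (\<lambda>p. \<Psi> i (fst p) (snd p))"
      using K by (intro compact_uniformly_continuous compact_Times) (auto simp: I_def)
    then obtain d where d: "d > 0" "\<And>p q. p \<in> I \<times> K \<Longrightarrow> q \<in> I \<times> K \<Longrightarrow> dist q p < d \<Longrightarrow>
        dist (\<Psi> i (fst q) (snd q)) (\<Psi> i (fst p) (snd p)) < e"
      using e unfolding uniformly_continuous_on_def by blast
    have "norm (nth_deriv i (r h) y) \<le> e * \<bar>h\<bar>" if h: "\<bar>h\<bar> < min d (x0 / 2)" for h y
    proof (cases "y \<in> K")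
      case True
      have "norm (\<Phi> i (x0 + h) y - \<Phi> i x0 y - (x0 + h - x0) *\<^sub>R \<Psi> i x0 y) \<le> norm (x0 + h - x0) * e"
      proof (rule vector_differentiable_bound_linearization[where S = "closed_segment x0 (x0 + h)"
            and f = "\<lambda>x. \<Phi> i x y" and f' = "\<lambda>x. \<Psi> i x y"])
        fix x assume x: "x \<in> closed_segment x0 (x0 + h)"
        then have xd: "\<bar>x - x0\<bar> \<le> \<bar>h\<bar>"
          by (auto simp: closed_segment_eq_real_ivl split: if_splits)
        have "x \<in> I" using I[of "x - x0"] xd h by auto
        moreover have "dist (x, y) (x0, y) < d" using xd h by (simp add: dist_Pair_Pair dist_real_def)
        ultimately show "norm (\<Psi> i x y - \<Psi> i x0 y) \<le> e"
          using d(2)[of "(x0, y)" "(x, y)"] True x0I by (simp add: dist_norm)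
        show "((\<lambda>x. \<Phi> i x y) has_vector_derivative \<Psi> i x y) (at x within closed_segment x0 (x0 + h))"
          using dx by (rule has_vector_derivative_at_within)
      qed auto
      then show ?thesis by (simp add: nr scaleR_conv_of_real mult.commute)
    next
      case False
      then show ?thesis using nr0[of h y i] h e by simp
    qed
    then show ?thesis
      unfolding eventually_at using d(1) x0
      by (intro exI[of _ "min d (x0 / 2)"]) (auto simp: dist_real_def)
  qed
  obtain C N where CN: "\<And>\<phi>. test_fun \<phi> \<and> supp \<phi> \<subseteq> K \<Longrightarrow>
    norm (\<delta> \<phi>) \<le> C * (\<Sum>j\<le>N. SUP x. norm (nth_deriv j \<phi> x))"
    using distribution_bound[OF \<delta> K] by metis
  let ?L = "\<delta> (\<lambda>y. of_real y * nth_deriv 1 \<phi> (x0 * y))"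
  have \<delta>r: "\<delta> (r h) = \<delta> (\<lambda>y. \<phi> ((x0 + h) * y)) - \<delta> (\<lambda>y. \<phi> (x0 * y)) - of_real h * ?L" if h: "\<bar>h\<bar> < x0 / 2" for h
  proof -
    have t: "test_fun (\<lambda>y. \<phi> ((x0 + h) * y))" "test_fun (\<lambda>y. \<phi> (x0 * y))"
      using h x0 by (auto intro!: test_fun_dilation[OF \<phi>])
    show ?thesis
      unfolding r_def[abs_def] distribution_diff[OF \<delta> test_fun_diff[OF t] test_fun_cmult[OF ty]]
        distribution_diff[OF \<delta> t] distribution_cmult[OF \<delta> ty] ..
  qed
  have "((\<lambda>h. norm (\<delta> (\<lambda>y. \<phi> ((x0 + h) * y)) - \<delta> (\<lambda>y. \<phi> (x0 * y)) - h *\<^sub>R ?L) / norm h) \<longlongrightarrow> 0) (at 0)"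
  proof (rule tendstoI)
    fix e :: real assume e: "e > 0"
    \<comment> \<open>Bounds the constant of the estimate times the number of seminorms; the added 1
      keeps it positive. With \<open>e'\<close> the total comes to e/2 times the modulus of
      h.\<close>
    define D where "D = (\<bar>C\<bar> + 1) * real (Suc N)"
    have D: "D > 0" unfolding D_def by (intro mult_pos_pos) auto
    define e' where "e' = e / (2 * D)"
    have e': "e' > 0" and De': "D * e' = e / 2" using e D by (simp_all add: e'_def)
    have "eventually (\<lambda>h. \<forall>i\<in>{..N}. \<forall>y. norm (nth_deriv i (r h) y) \<le> e' * \<bar>h\<bar>) (at 0)"
      using ev[OF e'] by (intro eventually_ball_finite) auto
    moreover have "eventually (\<lambda>h. \<bar>h\<bar> < x0 / 2) (at 0)"
      using x0 unfolding eventually_at by (intro exI[of _ "x0 / 2"]) (auto simp: dist_real_def)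
    moreover have "eventually (\<lambda>h::real. h \<noteq> 0) (at 0)"
      by (simp add: eventually_at_filter)
    ultimately show "eventually (\<lambda>h. dist (norm (\<delta> (\<lambda>y. \<phi> ((x0 + h) * y)) - \<delta> (\<lambda>y. \<phi> (x0 * y)) - h *\<^sub>R ?L) / norm h) 0 < e) (at 0)"
    proof eventually_elim
      case (elim h)
      have "norm (\<delta> (r h)) \<le> C * (\<Sum>j\<le>N. SUP x. norm (nth_deriv j (r h) x))"
        using CN tr sr elim by blast
      also have "\<dots> \<le> (\<bar>C\<bar> + 1) * (\<Sum>j\<le>N. SUP x. norm (nth_deriv j (r h) x))"
        using tr elim by (intro mult_right_mono sum_nonneg SUP_norm_nonneg) auto
      also have "\<dots> \<le> (\<bar>C\<bar> + 1) * (\<Sum>j\<le>N. e' * \<bar>h\<bar>)"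
        using elim by (intro mult_left_mono sum_mono cSUP_least) auto
      also have "\<dots> = D * e' * \<bar>h\<bar>"
        by (simp only: sum_constant card_atMost mult.assoc D_def)
      also have "\<dots> = e / 2 * \<bar>h\<bar>"
        unfolding De' ..
      finally have "norm (\<delta> (r h)) / \<bar>h\<bar> \<le> e / 2"
        using elim by (simp add: field_simps)
      moreover have "\<delta> (\<lambda>y. \<phi> ((x0 + h) * y)) - \<delta> (\<lambda>y. \<phi> (x0 * y)) - h *\<^sub>R ?L = \<delta> (r h)"
        using \<delta>r[OF elim(2)] by (simp only: scaleR_conv_of_real)
      ultimately show ?case
        using e by (simp only: dist_real_def diff_0_right abs_divide abs_norm_cancel real_norm_def abs_idempotent)
    qed
  qed
  then show ?thesis
    unfolding has_vector_derivative_def has_derivative_at using bounded_linear_scaleR_left by blast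
qed

text \<open>The Euler derivative, which generates the dilations: unlike d/du it commutes with them,
  so it can pass through a multiplicative convolution.\<close>

definition theta :: "(real \<Rightarrow> complex) \<Rightarrow> real \<Rightarrow> complex" where
  "theta \<phi> = (\<lambda>u. of_real u * vector_derivative \<phi> (at u))"

lemma test_fun_theta: "test_fun \<phi> \<Longrightarrow> test_fun (theta \<phi>)"
  unfolding theta_def by (intro test_fun_mult_smooth test_fun_vector_derivative smooth_on_of_real)

lemma dist_pairing_deriv_theta:
  assumes \<delta>: "distribution \<delta>" and \<phi>: "test_fun \<phi>" and x: "x > 0"
  shows "((\<lambda>x. \<delta> (\<lambda>y. \<phi> (x * y))) has_vector_derivative of_real (1 / x) * \<delta> (\<lambda>y. theta \<phi> (x * y))) (at x)"
proof -
  have "\<delta> (\<lambda>y. of_real y * nth_deriv 1 \<phi> (x * y)) = \<delta> (\<lambda>y. of_real (1 / x) * theta \<phi> (x * y))"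
    using x by (simp add: theta_def nth_deriv_Suc)
  also have "\<dots> = of_real (1 / x) * \<delta> (\<lambda>y. theta \<phi> (x * y))"
    by (intro distribution_cmult \<delta> test_fun_dilation test_fun_theta \<phi> x)
  finally show ?thesis
    using dist_pairing_has_vector_derivative[OF assms] by simp
qed

text \<open>The class of functions x^(-j) \<delta>(\<phi>(x y)) is closed under differentiation: the
  derivative has exponent j + 1 and the test function \<open>theta \<phi>\<close> - j
  \<phi>.\<close>

lemma smooth_on_dist_pairing:
  assumes \<delta>: "distribution \<delta>" and \<phi>: "test_fun \<phi>"
  shows "smooth_on {0<..} (\<lambda>x. \<delta> (\<lambda>y. \<phi> (x * y)))"
proof (rule smooth_on_coinduct[where P = "\<lambda>f. \<exists>j \<phi>. test_fun \<phi> \<and> f = (\<lambda>x. of_real (inverse x ^ j) * \<delta> (\<lambda>y. \<phi> (x * y)))"])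
  show "\<exists>j \<phi>'. test_fun \<phi>' \<and> (\<lambda>x. \<delta> (\<lambda>y. \<phi> (x * y))) = (\<lambda>x. of_real (inverse x ^ j) * \<delta> (\<lambda>y. \<phi>' (x * y)))"
    by (rule exI[of _ 0], rule exI[of _ \<phi>]) (simp add: \<phi>)
next
  fix f assume "\<exists>j \<phi>. test_fun \<phi> \<and> f = (\<lambda>x. of_real (inverse x ^ j) * \<delta> (\<lambda>y. \<phi> (x * y)))"
  then obtain j \<phi> where \<phi>: "test_fun \<phi>" and f: "f = (\<lambda>x. of_real (inverse x ^ j) * \<delta> (\<lambda>y. \<phi> (x * y)))" by blast
  let ?\<phi>' = "\<lambda>u. theta \<phi> u - of_nat j * \<phi> u"
  have t: "test_fun ?\<phi>'" by (intro test_fun_diff test_fun_theta test_fun_cmult \<phi>)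
  have "(f has_vector_derivative of_real (inverse x ^ Suc j) * \<delta> (\<lambda>y. ?\<phi>' (x * y))) (at x)" if x: "x > 0" for x
  proof -
    have p: "((\<lambda>x. inverse x ^ j) has_real_derivative - of_nat j * inverse x ^ Suc j) (at x)"
      using DERIV_power[OF DERIV_inverse, of x j UNIV] x by (cases j) (simp_all add: algebra_simps)
    have e: "\<delta> (\<lambda>y. ?\<phi>' (x * y)) = \<delta> (\<lambda>y. theta \<phi> (x * y)) - of_nat j * \<delta> (\<lambda>y. \<phi> (x * y))"
      using distribution_diff[OF \<delta> test_fun_dilation[OF test_fun_theta[OF \<phi>] x] test_fun_cmult[OF test_fun_dilation[OF \<phi> x]]]
        distribution_cmult[OF \<delta> test_fun_dilation[OF \<phi> x]] by simp
    from has_vector_derivative_mult[OF has_vector_derivative_of_real[OF p] dist_pairing_deriv_theta[OF \<delta> \<phi> x]]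
    show ?thesis using x unfolding f e by (simp add: field_simps)
  qed
  then show "\<exists>h. (\<exists>j \<phi>. test_fun \<phi> \<and> h = (\<lambda>x. of_real (inverse x ^ j) * \<delta> (\<lambda>y. \<phi> (x * y)))) \<and>
     (\<forall>x\<in>{0<..}. (f has_vector_derivative h x) (at x))"
    using t by (intro exI[of _ "\<lambda>x. of_real (inverse x ^ Suc j) * \<delta> (\<lambda>y. ?\<phi>' (x * y))"]) blast
qed simp

text \<open>If \<phi> vanishes below a, then for x \<le> a/2 the dilated function vanishes on (0,2),
  and the pairing is 0 by the support of \<delta>. Hence the pairing extends from (0,2) to a test
  function, to which the outer distribution of \<open>dist_conv\<close> can be applied.\<close>

lemma dist_pairing_extension:
  assumes \<delta>: "\<delta> \<in> carrier conv_algebra" and \<phi>: "test_fun \<phi>"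
  obtains \<psi> where "test_fun \<psi>" "\<And>x. 0 < x \<Longrightarrow> x < 2 \<Longrightarrow> \<psi> x = \<delta> (\<lambda>y. \<phi> (x * y))"
proof -
  obtain a b where ab: "0 < a" "a \<le> b" "\<And>x. x \<notin> {a..b} \<Longrightarrow> \<phi> x = 0" using \<phi> by (rule test_funE) blast
  have "\<delta> (\<lambda>y. \<phi> (x * y)) = 0" if x: "0 < x" "x \<le> a / 2" for x
  proof (rule supported_on_eq_0[where S = "{0<..1}" and U = "{0<..<2}" and \<gamma> = \<delta>])
    fix y :: real assume "y \<in> {0<..<2}"
    then have "x * y < x * 2" using x by (intro mult_strict_left_mono) auto
    also have "\<dots> \<le> a" using x by simp
    finally show "\<phi> (x * y) = 0" using ab by auto
  qed (use \<delta> x in \<open>auto simp: conv_carrier_iff intro: test_fun_dilation[OF \<phi>]\<close>)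
  then have "\<exists>\<psi>. test_fun \<psi> \<and> (\<forall>x\<in>{0<..<2}. \<psi> x = \<delta> (\<lambda>y. \<phi> (x * y)))"
    using \<delta> ab by (intro test_fun_extension[where a = "a / 2"] smooth_on_dist_pairing \<phi>) (auto simp: conv_carrier_iff)
  then show ?thesis using that by auto
qed

section \<open>Convolution and two-sided inverses\<close>

lemma dist_conv_eq:
  assumes "\<gamma> \<in> carrier conv_algebra" "test_fun \<phi>" "test_fun \<psi>" "e > 0"
    "\<And>x. 0 < x \<Longrightarrow> x < 1 + e \<Longrightarrow> \<psi> x = \<delta> (\<lambda>y. \<phi> (x * y))"
  shows "dist_conv \<gamma> \<delta> \<phi> = \<gamma> \<psi>"
  unfolding dist_conv_def using assms(2) dist_apply_eq[OF assms(1,3-5)] by simp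

text \<open>Associativity of \<open>\<gamma> * (\<delta> * \<epsilon>)\<close> in the only instance that is needed.\<close>

lemma left_inverse_eq_right_inverse:
  assumes \<gamma>: "\<gamma> \<in> carrier conv_algebra" and \<delta>: "\<delta> \<in> carrier conv_algebra" and \<epsilon>: "\<epsilon> \<in> carrier conv_algebra"
    and l: "dist_conv \<gamma> \<delta> = delta_one" and r: "dist_conv \<delta> \<epsilon> = delta_one"
  shows "\<gamma> = \<epsilon>"
proof
  fix \<phi>
  show "\<gamma> \<phi> = \<epsilon> \<phi>"
  proof (cases "test_fun \<phi>")
    case False
    then show ?thesis
      using \<gamma> \<epsilon> distribution_not_test_fun[of \<gamma> \<phi>] distribution_not_test_fun[of \<epsilon> \<phi>] by (simp add: conv_carrier_iff)
  next
    case \<phi>: True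
    obtain \<psi> where \<psi>: "test_fun \<psi>" "\<And>x. 0 < x \<Longrightarrow> x < 2 \<Longrightarrow> \<psi> x = \<epsilon> (\<lambda>y. \<phi> (x * y))"
      by (rule dist_pairing_extension[OF \<epsilon> \<phi>]) blast
    \<comment> \<open>The two ranges 4/3 and 3/2 have product 2, the range in which
      \<open>\<psi>\<close> represents the pairing with \<open>\<epsilon>\<close>.\<close>
    have *: "\<phi> x = \<delta> (\<lambda>y. \<psi> (x * y))" if x: "0 < x" "x < 1 + 1/3" for x
    proof -
      have "dist_conv \<delta> \<epsilon> (\<lambda>y. \<phi> (x * y)) = \<delta> (\<lambda>y. \<psi> (x * y))"
      proof (rule dist_conv_eq[where e = "1/2"])
        fix y :: real assume y: "0 < y" "y < 1 + 1/2"
        have "x * y < (1 + 1/3) * (1 + 1/2)" using x y by (intro mult_strict_mono) auto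
        then have "\<psi> (x * y) = \<epsilon> (\<lambda>z. \<phi> (x * y * z))" using x y by (intro \<psi>(2)) auto
        then show "\<psi> (x * y) = \<epsilon> (\<lambda>z. \<phi> (x * (y * z)))" by (simp add: mult.assoc)
      qed (use \<delta> \<phi> \<psi>(1) x in \<open>auto intro: test_fun_dilation\<close>)
      then show ?thesis
        using test_fun_dilation[OF \<phi> x(1)] by (simp add: r delta_one_def)
    qed
    have "dist_conv \<gamma> \<delta> \<psi> = \<gamma> \<phi>"
      by (rule dist_conv_eq[where e = "1/3"]) (use \<gamma> \<psi>(1) \<phi> * in auto)
    moreover have "dist_conv \<gamma> \<delta> \<psi> = \<epsilon> \<phi>"
      using \<psi> by (simp add: l delta_one_def)
    ultimately show ?thesis by simp
  qed
qed

text \<open>The inverse is a definite description over the carrier, so its uniqueness has to be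
  supplied; the instance of associativity just obtained does this.\<close>

lemma Units_inv_conv_algebraI:
  assumes "\<gamma> \<in> carrier conv_algebra" "\<delta> \<in> carrier conv_algebra"
    and "dist_conv \<gamma> \<delta> = delta_one" "dist_conv \<delta> \<gamma> = delta_one"
  shows "\<gamma> \<in> Units conv_algebra" "inv\<^bsub>conv_algebra\<^esub> \<gamma> = \<delta>"
proof -
  have simps: "mult conv_algebra = dist_conv" "one conv_algebra = delta_one"
    by (simp_all add: conv_algebra_def)
  show "\<gamma> \<in> Units conv_algebra"
    unfolding Units_def simps using assms by blast
  show "inv\<^bsub>conv_algebra\<^esub> \<gamma> = \<delta>"
    unfolding m_inv_def simps
  proof (rule the_equality)
    show "\<delta> \<in> carrier conv_algebra \<and> dist_conv \<gamma> \<delta> = delta_one \<and> dist_conv \<delta> \<gamma> = delta_one"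
      using assms by blast
  next
    fix \<epsilon> assume "\<epsilon> \<in> carrier conv_algebra \<and> dist_conv \<gamma> \<epsilon> = delta_one \<and> dist_conv \<epsilon> \<gamma> = delta_one"
    then show "\<epsilon> = \<delta>"
      using left_inverse_eq_right_inverse[of \<epsilon> \<gamma> \<delta>] assms(1,2,3) by blast
  qed
qed

section \<open>Beta integrals and Mellin moments\<close>

text \<open>Dominated convergence for a continuous parameter, reduced to sequences. The domination
  is asked for only near the limit point and away from it, which fits difference quotients.\<close>

lemma tendsto_integral_dominated_at:
  fixes f :: "'b::metric_space \<Rightarrow> 'a \<Rightarrow> complex"
  assumes meas: "\<And>y. y \<in> S \<Longrightarrow> f y \<in> borel_measurable M" "g \<in> borel_measurable M" and w: "integrable M w"
    and lim: "\<And>t. t \<in> space M \<Longrightarrow> ((\<lambda>y. f y t) \<longlongrightarrow> g t) (at x within S)"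
    and d: "d > 0" and bound: "\<And>y. y \<in> S \<Longrightarrow> y \<noteq> x \<Longrightarrow> dist y x < d \<Longrightarrow> AE t in M. norm (f y t) \<le> w t"
  shows "((\<lambda>y. integral\<^sup>L M (f y)) \<longlongrightarrow> integral\<^sup>L M g) (at x within S)"
  unfolding tendsto_at_iff_sequentially
proof (intro allI impI)
  fix X :: "nat \<Rightarrow> 'b" assume X: "\<forall>i. X i \<in> S - {x}" "X \<longlonglongrightarrow> x"
  obtain N where N: "\<And>n. n \<ge> N \<Longrightarrow> dist (X n) x < d"
    using metric_LIMSEQ_D[OF X(2) d] by blast
  have "(\<lambda>n. integral\<^sup>L M (f (X (n + N)))) \<longlonglongrightarrow> integral\<^sup>L M g"
  proof (rule integral_dominated_convergence[where w = w])
    show "AE t in M. (\<lambda>n. f (X (n + N)) t) \<longlonglongrightarrow> g t"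
    proof (rule AE_I2)
      fix t assume t: "t \<in> space M"
      have "((\<lambda>y. f y t) \<circ> X) \<longlonglongrightarrow> g t"
        using lim[OF t] X unfolding tendsto_at_iff_sequentially by blast
      then show "(\<lambda>n. f (X (n + N)) t) \<longlonglongrightarrow> g t"
        using LIMSEQ_ignore_initial_segment[of "(\<lambda>y. f y t) \<circ> X" "g t" N] by (simp add: o_def)
    qed
    show "AE t in M. norm (f (X (n + N)) t) \<le> w t" for n
      using X(1) N[of "n + N"] by (intro bound) auto
  qed (use meas X(1) w in auto)
  then have "(\<lambda>n. integral\<^sup>L M (f (X n))) \<longlonglongrightarrow> integral\<^sup>L M g"
    by (rule LIMSEQ_offset)
  then show "((\<lambda>y. integral\<^sup>L M (f y)) \<circ> X) \<longlonglongrightarrow> integral\<^sup>L M g"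
    by (simp add: o_def)
qed

lemma norm_exp_minus_one_le:
  fixes z :: complex
  shows "norm (exp z - 1) \<le> norm z * exp (norm z)"
proof -
  have "norm (exp z - exp 0) \<le> exp (norm z) * norm (z - 0)"
  proof (rule field_differentiable_bound[where S = "cball 0 (norm z)" and f' = exp])
    fix u :: complex assume "u \<in> cball 0 (norm z)"
    then show "norm (exp u) \<le> exp (norm z)"
      using complex_Re_le_cmod[of u] by (auto simp: norm_exp_eq_Re intro: order_trans)
  qed (auto intro!: derivative_eq_intros)
  then show ?thesis by (simp add: mult.commute)
qed

text \<open>A logarithm costs only an arbitrarily small power of t, which the open range of
  exponents absorbs.\<close>

lemma ln_abs_le_powr:
  fixes t \<delta> :: real
  assumes "0 < t" "t < 1" "\<delta> > 0"
  shows "\<bar>ln t\<bar> \<le> t powr (- \<delta>) / \<delta>"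
proof -
  have "\<delta> * (- ln t) \<le> exp (\<delta> * (- ln t))"
    using exp_ge_add_one_self[of "\<delta> * (- ln t)"] by linarith
  also have "\<dots> = t powr (- \<delta>)"
    using assms by (simp add: powr_def)
  finally show ?thesis
    using assms by (simp add: field_simps)
qed

lemma norm_of_real_powr: "t > 0 \<Longrightarrow> norm (complex_of_real t powr s) = t powr Re s"
  by (simp add: norm_powr_real_powr)

lemma measurable_of_real_powr [measurable]:
  "(\<lambda>t. complex_of_real t powr s) \<in> borel_measurable borel"
  unfolding powr_def by measurable

text \<open>The imaginary part of the exponent contributes a factor of modulus 1.\<close>

lemma set_integrable_Mellin_density:
  fixes w :: "real \<Rightarrow> complex"
  assumes "set_integrable lborel {0<..<1} (\<lambda>t. w t * of_real (t powr Re z))"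
  shows "set_integrable lborel {0<..<1} (\<lambda>t. w t * of_real t powr z)"
proof -
  let ?g = "\<lambda>t. indicator {0<..<1} t *\<^sub>R (w t * of_real (t powr Re z))"
  have g: "integrable lborel ?g" using assms by (simp add: set_integrable_def)
  have eq: "indicator {0<..<1} t *\<^sub>R (w t * of_real t powr z) = ?g t * of_real t powr (\<i> * of_real (Im z))" for t :: real
  proof (cases "t \<in> {0<..<1}")
    case True
    then have "of_real t powr z = of_real (t powr Re z) * of_real t powr (\<i> * of_real (Im z))"
      by (subst complex_eq[of z]) (simp add: powr_add powr_of_real)
    then show ?thesis using True by simp
  qed auto
  have n: "norm (?g t * of_real t powr (\<i> * of_real (Im z))) \<le> norm (?g t)" for t :: real
    by (cases "t \<in> {0<..<1}") (auto simp: norm_mult norm_of_real_powr)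
  show ?thesis
    unfolding set_integrable_def eq
  proof (rule Bochner_Integration.integrable_bound[OF g])
    show "(\<lambda>t. ?g t * of_real t powr (\<i> * of_real (Im z))) \<in> borel_measurable lborel"
      by (intro borel_measurable_times borel_measurable_integrable[OF g]) simp
  qed (rule AE_I2, rule n)
qed

text \<open>Differentiation under the integral sign gives holomorphy of the Mellin transform of a
  density, the input of the analytic continuation for the Beta integrals.\<close>

lemma Mellin_density_has_field_derivative:
  fixes w :: "real \<Rightarrow> complex"
  assumes w: "\<And>\<sigma>. \<sigma> > \<sigma>0 \<Longrightarrow> set_integrable lborel {0<..<1} (\<lambda>t. w t * of_real (t powr \<sigma>))"
    and s: "Re s > \<sigma>0"
  shows "((\<lambda>s. LBINT t:{0<..<1}. w t * of_real t powr s) has_field_derivative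
     (LBINT t:{0<..<1}. w t * of_real t powr s * of_real (ln t))) (at s)"
proof -
  \<comment> \<open>A third of the distance to the abscissa: one part bounds the modulus of h and so
    the growth of t^h, one absorbs the logarithm, and the exponent Re s - 2 \<delta> still exceeds
    \<open>\<sigma>0\<close>.\<close>
  define \<delta> where "\<delta> = (Re s - \<sigma>0) / 3"
  have \<delta>: "\<delta> > 0" using s by (simp add: \<delta>_def)
  let ?I = "indicator {0<..<1::real} :: real \<Rightarrow> real"
  have meas_w: "(\<lambda>t. ?I t *\<^sub>R (w t * of_real (t powr \<sigma>))) \<in> borel_measurable lborel" if "\<sigma> > \<sigma>0" for \<sigma>
    using w[OF that] unfolding set_integrable_def by (rule borel_measurable_integrable)
  \<comment> \<open>Measurability is known only for w times a power of t; multiplying by the inverse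
    power recovers it for any other factor.\<close>
  have meas: "(\<lambda>t. ?I t *\<^sub>R (w t * g t)) \<in> borel_measurable lborel" if [measurable]: "g \<in> borel_measurable lborel" for g
  proof -
    have "(\<lambda>t. ?I t *\<^sub>R (w t * of_real (t powr (\<sigma>0 + 1))) * (g t * of_real (t powr (- (\<sigma>0 + 1))))) \<in> borel_measurable lborel"
      by (intro borel_measurable_times meas_w) (use that in \<open>auto\<close>)
    also have "(\<lambda>t. ?I t *\<^sub>R (w t * of_real (t powr (\<sigma>0 + 1))) * (g t * of_real (t powr (- (\<sigma>0 + 1))))) = (\<lambda>t. ?I t *\<^sub>R (w t * g t))"
    proof
      fix t :: real
      show "?I t *\<^sub>R (w t * of_real (t powr (\<sigma>0 + 1))) * (g t * of_real (t powr (- (\<sigma>0 + 1)))) = ?I t *\<^sub>R (w t * g t)"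
      proof (cases "t \<in> {0<..<1}")
        case True
        then have "t powr (\<sigma>0 + 1) * t powr (- (\<sigma>0 + 1)) = 1"
          by (simp add: powr_add[symmetric])
        then have "complex_of_real (t powr (\<sigma>0 + 1)) * of_real (t powr (- (\<sigma>0 + 1))) = 1"
          by (metis of_real_1 of_real_mult)
        then show ?thesis using True by (simp add: mult_ac)
      qed auto
    qed
    finally show ?thesis .
  qed
  have gt: "Re s - 2 * \<delta> > \<sigma>0"
    using s by (simp add: \<delta>_def field_simps)
  have dom: "integrable lborel (\<lambda>t. norm (?I t *\<^sub>R (w t * of_real (t powr (Re s - 2 * \<delta>)))) * (1 / \<delta>))"
    by (intro integrable_mult_left integrable_norm w[OF gt, unfolded set_integrable_def])
  have int: "integrable lborel (\<lambda>t. ?I t *\<^sub>R (w t * of_real t powr z))" if z: "Re z > \<sigma>0" for z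
    using set_integrable_Mellin_density[OF w[OF z]] by (simp add: set_integrable_def)
  have quot: "(of_real t powr (s + h) - of_real t powr s) / h = of_real t powr s * ((exp (h * of_real (ln t)) - 1) / h)"
    if "t > 0" for t :: real and h :: complex
    using that by (simp add: powr_def Ln_of_real[symmetric] ring_distribs exp_add diff_divide_distrib)
  have "((\<lambda>h. integral\<^sup>L lborel (\<lambda>t. ?I t *\<^sub>R (w t * ((of_real t powr (s + h) - of_real t powr s) / h)))) \<longlongrightarrow>
     integral\<^sup>L lborel (\<lambda>t. ?I t *\<^sub>R (w t * (of_real t powr s * of_real (ln t))))) (at 0)"
  proof (rule tendsto_integral_dominated_at[OF _ _ dom _ \<delta>])
    fix t :: real
    show "((\<lambda>h. ?I t *\<^sub>R (w t * ((of_real t powr (s + h) - of_real t powr s) / h))) \<longlongrightarrow>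
       ?I t *\<^sub>R (w t * (of_real t powr s * of_real (ln t)))) (at 0)"
    proof (cases "t \<in> {0<..<1}")
      case True
      have "((\<lambda>h. exp (h * of_real (ln t))) has_field_derivative of_real (ln t)) (at (0::complex))"
        by (auto intro!: derivative_eq_intros)
      then have "((\<lambda>h. (exp (h * complex_of_real (ln t)) - 1) / h) \<longlongrightarrow> of_real (ln t)) (at 0)"
        by (simp add: has_field_derivative_iff)
      then have "((\<lambda>h. w t * (of_real t powr s * ((exp (h * complex_of_real (ln t)) - 1) / h))) \<longlongrightarrow>
          w t * (of_real t powr s * of_real (ln t))) (at 0)"
        by (intro tendsto_mult_left)
      then show ?thesis
        using True by (simp add: quot)
    qed auto
  next
    fix h :: complex
    assume h: "h \<noteq> 0" "dist h 0 < \<delta>"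
    have "norm (?I t *\<^sub>R (w t * ((of_real t powr (s + h) - of_real t powr s) / h)))
       \<le> norm (?I t *\<^sub>R (w t * of_real (t powr (Re s - 2 * \<delta>)))) * (1 / \<delta>)" for t :: real
    proof (cases "t \<in> {0<..<1}")
      case True
      then have t: "0 < t" "t < 1" by auto
      have "norm (exp (h * of_real (ln t)) - 1) \<le> norm (h * complex_of_real (ln t)) * exp (norm (h * complex_of_real (ln t)))"
        by (rule norm_exp_minus_one_le)
      also have "norm (h * complex_of_real (ln t)) = norm h * \<bar>ln t\<bar>"
        by (simp add: norm_mult)
      also have "norm h * \<bar>ln t\<bar> * exp (norm h * \<bar>ln t\<bar>) \<le> norm h * \<bar>ln t\<bar> * t powr (- \<delta>)"
      proof (rule mult_left_mono)
        have "exp (norm h * \<bar>ln t\<bar>) \<le> exp (\<delta> * \<bar>ln t\<bar>)"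
          using h by (simp add: mult_right_mono)
        also have "\<dots> = t powr (- \<delta>)"
          using t by (simp add: powr_def)
        finally show "exp (norm h * \<bar>ln t\<bar>) \<le> t powr (- \<delta>)" .
      qed simp
      finally have "norm ((exp (h * of_real (ln t)) - 1) / h) \<le> \<bar>ln t\<bar> * t powr (- \<delta>)"
        using h by (simp add: norm_divide field_simps)
      also have "\<dots> \<le> t powr (- \<delta>) / \<delta> * t powr (- \<delta>)"
        by (intro mult_right_mono ln_abs_le_powr t \<delta>) auto
      finally have "t powr Re s * norm ((exp (h * of_real (ln t)) - 1) / h) \<le> t powr Re s * (t powr (- \<delta>) / \<delta> * t powr (- \<delta>))"
        by (intro mult_left_mono) auto
      also have "\<dots> = t powr (Re s - 2 * \<delta>) * (1 / \<delta>)"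
        by (simp add: powr_add[symmetric])
      finally have "norm (w t) * (t powr Re s * norm ((exp (h * of_real (ln t)) - 1) / h)) \<le> norm (w t) * (t powr (Re s - 2 * \<delta>) * (1 / \<delta>))"
        by (intro mult_left_mono) auto
      then show ?thesis
        unfolding quot[OF t(1)] using True t by (simp add: norm_mult norm_divide norm_of_real_powr mult.assoc)
    qed auto
    then show "AE t in lborel. norm (?I t *\<^sub>R (w t * ((of_real t powr (s + h) - of_real t powr s) / h)))
       \<le> norm (?I t *\<^sub>R (w t * of_real (t powr (Re s - 2 * \<delta>)))) * (1 / \<delta>)"
      by (rule AE_I2)
  next
    fix h :: complex
    show "(\<lambda>t. ?I t *\<^sub>R (w t * ((of_real t powr (s + h) - of_real t powr s) / h))) \<in> borel_measurable lborel"
      by (rule meas) measurable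
  next
    show "(\<lambda>t. ?I t *\<^sub>R (w t * (of_real t powr s * of_real (ln t)))) \<in> borel_measurable lborel"
      by (rule meas) measurable
  qed
  moreover have "eventually (\<lambda>h. integral\<^sup>L lborel (\<lambda>t. ?I t *\<^sub>R (w t * ((of_real t powr (s + h) - of_real t powr s) / h))) =
      ((LBINT t:{0<..<1}. w t * of_real t powr (s + h)) - (LBINT t:{0<..<1}. w t * of_real t powr s)) / h) (at 0)"
  proof -
    have "eventually (\<lambda>h. dist h 0 < \<delta>) (at (0::complex))"
      using \<delta> by (auto simp: eventually_at)
    then show ?thesis
    proof eventually_elim
      case (elim h)
      have "Re (s + h) > \<sigma>0"
        using elim abs_Re_le_cmod[of h] s \<delta>_def by auto
      have "integral\<^sup>L lborel (\<lambda>t. ?I t *\<^sub>R (w t * ((of_real t powr (s + h) - of_real t powr s) / h))) =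
         integral\<^sup>L lborel (\<lambda>t. (?I t *\<^sub>R (w t * of_real t powr (s + h)) - ?I t *\<^sub>R (w t * of_real t powr s)) / h)"
        by (rule Bochner_Integration.integral_cong) (auto simp: algebra_simps diff_divide_distrib indicator_def)
      also have "\<dots> = (integral\<^sup>L lborel (\<lambda>t. ?I t *\<^sub>R (w t * of_real t powr (s + h))) - integral\<^sup>L lborel (\<lambda>t. ?I t *\<^sub>R (w t * of_real t powr s))) / h"
        unfolding integral_divide_zero
        by (subst Bochner_Integration.integral_diff[OF int[OF \<open>Re (s + h) > \<sigma>0\<close>] int[OF s]]) simp
      finally show ?case
        unfolding set_lebesgue_integral_def .
    qed
  qed
  ultimately have "((\<lambda>h. ((LBINT t:{0<..<1}. w t * of_real t powr (s + h)) - (LBINT t:{0<..<1}. w t * of_real t powr s)) / h) \<longlongrightarrow>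
     integral\<^sup>L lborel (\<lambda>t. ?I t *\<^sub>R (w t * (of_real t powr s * of_real (ln t))))) (at 0)"
    by (rule Lim_transform_eventually)
  then show ?thesis
    by (simp add: DERIV_def set_lebesgue_integral_def mult.assoc)
qed

lemma Beta_integral_real:
  fixes x l :: real
  assumes "x > -1" "l > -1"
  shows "set_integrable lborel {0<..<1} (\<lambda>t. t powr x * (1 - t\<^sup>2) powr l)"
    and "(LBINT t:{0<..<1}. t powr x * (1 - t\<^sup>2) powr l) = Beta ((x + 1) / 2) (l + 1) / 2"
proof -
  define a b where "a = (x + 1) / 2" and "b = l + 1"
  have ab: "a > 0" "b > 0" using assms by (auto simp: a_def b_def)
  let ?f = "\<lambda>t. t powr (a - 1) * (1 - t) powr (b - 1)"
  have f: "set_integrable lborel {0\<^sup>2..1\<^sup>2} ?f"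
    using integrable_Beta[OF ab] by simp
  have d: "((\<lambda>t. t\<^sup>2) has_real_derivative 2 * t) (at t)" for t :: real
    by (auto intro!: derivative_eq_intros)
  note sub = integral_substitution[of "\<lambda>t. t\<^sup>2" 0 1 ?f "\<lambda>t. 2 * t", OF f d]
  \<comment> \<open>Substituting t^2 turns the Beta weight with a = (x + 1)/2 into the power t^x.
    The end points contribute nothing, because \<open>0 powr z\<close> is 0.\<close>
  have eq: "indicator {0..1} t *\<^sub>R (?f (t\<^sup>2) * (2 * t)) = 2 * (indicator {0<..<1} t *\<^sub>R (t powr x * (1 - t\<^sup>2) powr l))" for t :: real
  proof (cases "t \<in> {0<..<1}")
    case True
    then have "(t\<^sup>2) powr (a - 1) * t = t powr (2 * (a - 1)) * t powr 1"
      by (simp add: powr_powr flip: powr_numeral)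
    also have "\<dots> = t powr x" unfolding powr_add[symmetric] a_def by (simp add: field_simps)
    finally show ?thesis using True by (simp add: b_def mult_ac)
  qed (auto simp: indicator_def)
  have 1: "set_integrable lborel {0..1} (\<lambda>t. ?f (t\<^sup>2) * (2 * t))"
    by (rule sub) (auto intro!: continuous_intros)
  show "set_integrable lborel {0<..<1} (\<lambda>t. t powr x * (1 - t\<^sup>2) powr l)"
    using 1 unfolding set_integrable_def eq by simp
  have "(LBINT t. ?f t * indicator {0\<^sup>2..1\<^sup>2} t) = (LBINT t. ?f (t\<^sup>2) * (2 * t) * indicator {0..1} t)"
    by (rule sub) (auto intro!: continuous_intros)
  also have "\<dots> = (LBINT t. indicator {0..1} t *\<^sub>R (?f (t\<^sup>2) * (2 * t)))"
    by (simp add: mult.commute)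
  also have "\<dots> = 2 * (LBINT t:{0<..<1}. t powr x * (1 - t\<^sup>2) powr l)"
    unfolding eq set_lebesgue_integral_def by simp
  also have "(LBINT t. ?f t * indicator {0\<^sup>2..1\<^sup>2} t) = (LBINT t:{0..1}. ?f t)"
    by (simp add: set_lebesgue_integral_def mult.commute)
  also have "\<dots> = integral {0..1} ?f"
    by (rule set_borel_integral_eq_integral(2)[OF integrable_Beta[OF ab]])
  also have "\<dots> = Beta a b"
    using has_integral_Beta_real[OF ab] by (rule integral_unique)
  finally show "(LBINT t:{0<..<1}. t powr x * (1 - t\<^sup>2) powr l) = Beta ((x + 1) / 2) (l + 1) / 2"
    by (simp add: a_def b_def)
qed

text \<open>Both sides are holomorphic in the half-plane and agree at real points, so the identity
  theorem extends the real Beta integral.\<close>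

lemma Beta_integral_complex:
  fixes l :: real and z :: complex
  assumes l: "l > -1" and z: "Re z > -1"
  shows "set_integrable lborel {0<..<1} (\<lambda>t. of_real ((1 - t\<^sup>2) powr l) * of_real t powr z)"
    and "(LBINT t:{0<..<1}. of_real ((1 - t\<^sup>2) powr l) * of_real t powr z) =
      Gamma ((z + 1) / 2) * Gamma (of_real (l + 1)) * rGamma ((z + 1) / 2 + of_real (l + 1)) / 2"
proof -
  have w: "set_integrable lborel {0<..<1} (\<lambda>t. complex_of_real ((1 - t\<^sup>2) powr l) * of_real (t powr \<sigma>))"
    if "\<sigma> > -1" for \<sigma>
  proof -
    have eq: "indicator {0<..<1} t *\<^sub>R (complex_of_real ((1 - t\<^sup>2) powr l) * of_real (t powr \<sigma>)) =
        of_real (indicator {0<..<1} t *\<^sub>R (t powr \<sigma> * (1 - t\<^sup>2) powr l))" for t :: real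
      by (simp add: scaleR_conv_of_real)
    show ?thesis
      using Beta_integral_real(1)[OF that l] unfolding set_integrable_def eq by (rule integrable_of_real)
  qed
  show "set_integrable lborel {0<..<1} (\<lambda>t. of_real ((1 - t\<^sup>2) powr l) * of_real t powr z)"
    by (rule set_integrable_Mellin_density[OF w[OF z]])
  let ?\<Phi> = "\<lambda>z. LBINT t:{0<..<1}. complex_of_real ((1 - t\<^sup>2) powr l) * of_real t powr z"
  let ?B = "\<lambda>z. Gamma ((z + 1) / 2) * Gamma (of_real (l + 1)) * rGamma ((z + 1) / 2 + of_real (l + 1)) / 2"
  let ?S = "{z. Re z > -1}"
  have S: "open ?S" "connected ?S"
    by (auto simp: open_halfspace_Re_gt intro!: convex_connected convex_halfspace_Re_gt)
  have hol1: "?\<Phi> holomorphic_on ?S"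
    using Mellin_density_has_field_derivative[OF w] S(1)
    by (auto simp: holomorphic_on_open field_differentiable_def)
  have nonpos: "(z + 1) / 2 \<notin> \<int>\<^sub>\<le>\<^sub>0" if "z \<in> ?S" for z
    using that by (auto elim!: nonpos_Ints_cases simp: complex_eq_iff)
  have hol2: "?B holomorphic_on ?S"
    using nonpos by (intro holomorphic_intros) auto
  have real: "?\<Phi> (of_real x) = ?B (of_real x)" if x: "x > -1" for x
  proof -
    have "?\<Phi> (of_real x) = (LBINT t:{0<..<1}. complex_of_real (t powr x * (1 - t\<^sup>2) powr l))"
      by (rule set_lebesgue_integral_cong) (auto simp: powr_of_real)
    also have "\<dots> = of_real (LBINT t:{0<..<1}. t powr x * (1 - t\<^sup>2) powr l)"
    proof -
      have eq: "indicator {0<..<1} t *\<^sub>R complex_of_real (t powr x * (1 - t\<^sup>2) powr l) =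
          of_real (indicator {0<..<1} t *\<^sub>R (t powr x * (1 - t\<^sup>2) powr l))" for t :: real
        by (simp add: scaleR_conv_of_real)
      show ?thesis
        unfolding set_lebesgue_integral_def eq by (rule integral_complex_of_real)
    qed
    also have "\<dots> = complex_of_real (Beta ((x + 1) / 2) (l + 1)) / 2"
      by (simp add: Beta_integral_real(2)[OF x l])
    also have "complex_of_real (Beta ((x + 1) / 2) (l + 1)) = Beta (of_real ((x + 1) / 2)) (of_real (l + 1))"
      by (rule Beta_complex_of_real[symmetric])
    finally show ?thesis
      by (simp add: Beta_altdef)
  qed
  have "?\<Phi> z - ?B z = 0"
  proof (rule analytic_continuation[where f = "\<lambda>z. ?\<Phi> z - ?B z" and S = ?S and U = "complex_of_real ` {0<..}" and \<xi> = 1])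
    show "(\<lambda>z. ?\<Phi> z - ?B z) holomorphic_on ?S"
      by (intro holomorphic_on_diff hol1 hol2)
    show "1 islimpt complex_of_real ` {0<..}"
      unfolding islimpt_sequential
    proof (intro exI[of _ "\<lambda>n. complex_of_real (1 + 1 / real (Suc n))"] conjI allI)
      show "complex_of_real (1 + 1 / real (Suc n)) \<in> complex_of_real ` {0<..} - {1}" for n
        by (auto intro!: imageI add_pos_nonneg simp: complex_eq_iff)
      have "(\<lambda>n. complex_of_real (1 + 1 / real (Suc n))) \<longlonglongrightarrow> of_real (1 + 0)"
        by (intro tendsto_intros LIMSEQ_Suc[OF lim_1_over_n])
      then show "(\<lambda>n. complex_of_real (1 + 1 / real (Suc n))) \<longlonglongrightarrow> 1" by simp
    qed
  qed (use S z real in auto)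
  then show "?\<Phi> z = ?B z" by simp
qed

section \<open>Moments of the Gegenbauer weight\<close>

definition gegenbauer_sum_coeff :: "nat \<Rightarrow> nat \<Rightarrow> real" where
  "gegenbauer_sum_coeff k j = (if 2 * j \<le> k then (-1/4) ^ j * fact k / (fact (k - 2 * j) * fact j) else 0)"

text \<open>The numbers \<open>gegenbauer_sum_coeff k j\<close> are the coefficients of x^(k - 2 j)
  in the monic Hermite polynomial h_k, and this is its three-term recurrence h_(k+2) = x h_(k+1) -
  (k+1)/2 h_k. The cases separate where terms drop out of range.\<close>

lemma gegenbauer_sum_coeff_rec:
  "gegenbauer_sum_coeff (k + 2) (Suc i) =
     gegenbauer_sum_coeff (k + 1) (Suc i) - (real k + 1) / 2 * gegenbauer_sum_coeff k i"
proof -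
  consider "2 * i + 1 \<le> k" | "k = 2 * i" | "k < 2 * i" by linarith
  then show ?thesis
  proof cases
    case 1
    then obtain m where m: "k = 2 * i + 1 + m" using le_Suc_ex by blast
    have e: "k + 2 - 2 * Suc i = Suc m" "k + 1 - 2 * Suc i = m" "k - 2 * i = Suc m" using m by auto
    have f: "fact (k + 2) = (real k + 2) * ((real k + 1) * fact k)" "fact (k + 1) = (real k + 1) * fact k"
      by (simp_all add: algebra_simps)
    have k: "real k = 2 * real i + 1 + real m" using m by simp
    show ?thesis
      unfolding gegenbauer_sum_coeff_def e f using 1
      by (simp add: divide_simps) (simp add: k algebra_simps)
  next
    case 2
    have f: "fact (k + 2) = (real k + 2) * ((real k + 1) * fact k)"
      by (simp_all add: algebra_simps)
    show ?thesis
      unfolding gegenbauer_sum_coeff_def f using 2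
      by (simp add: divide_simps)
  qed (auto simp: gegenbauer_sum_coeff_def)
qed

lemma not_nonpos_IntI: "Re z > 0 \<Longrightarrow> z \<notin> \<int>\<^sub>\<le>\<^sub>0"
  by (auto elim!: nonpos_Ints_cases)

lemma Gamma_duplication_powr:
  assumes "Re z > 0"
  shows "Gamma z * Gamma (z + 1/2) = of_real (sqrt pi) * 2 powr (1 - 2 * z) * Gamma (2 * z)"
proof -
  have n: "z \<notin> \<int>\<^sub>\<le>\<^sub>0" "z + 1/2 \<notin> \<int>\<^sub>\<le>\<^sub>0" using assms by (auto intro!: not_nonpos_IntI)
  have p: "exp ((1 - 2*z) * of_real (ln 2)) = 2 powr (1 - 2 * z)"
    by (simp add: powr_def Ln_of_real[of 2, simplified])
  show ?thesis
    unfolding Gamma_legendre_duplication[OF n] p by simp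
qed

lemma Gamma_times_rGamma: "Re z > 0 \<Longrightarrow> Gamma z * rGamma z = (1::complex)"
  using not_nonpos_IntI[of z] by (simp add: rGamma_inverse_Gamma Gamma_eq_zero_iff)

text \<open>Both sides satisfy the recurrence in k inherited from the Hermite coefficients, in which
  the shift of the index j becomes a shift of z by 1. The two starting cases are Legendre's
  duplication formula at z and at z - 1/2.\<close>

lemma gegenbauer_sum_Gamma:
  assumes "Re z > real k / 2"
  shows "(\<Sum>j\<le>k. of_real (gegenbauer_sum_coeff k j) * Gamma (z - of_nat j)) =
     of_real (sqrt pi) * 2 powr (of_nat k + 1 - 2 * z) * Gamma (2 * z - of_nat k) * rGamma (z - of_nat k + 1/2)"
  using assms
proof (induction k arbitrary: z rule: induct_nat_012)
  case 0
  then have "Gamma z = Gamma z * Gamma (z + 1/2) * rGamma (z + 1/2)"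
    by (simp add: mult.assoc Gamma_times_rGamma)
  then show ?case
    using Gamma_duplication_powr[of z] 0 by (simp add: gegenbauer_sum_coeff_def)
next
  case 1
  then have "Gamma z = Gamma (z - 1/2) * Gamma (z - 1/2 + 1/2) * rGamma (z - 1/2)"
    using Gamma_times_rGamma[of "z - 1/2"] by simp
  also have "\<dots> = of_real (sqrt pi) * 2 powr (1 - 2 * (z - 1/2)) * Gamma (2 * (z - 1/2)) * rGamma (z - 1/2)"
    using 1 by (subst Gamma_duplication_powr) auto
  finally have "Gamma z = of_real (sqrt pi) * 2 powr (1 - 2 * (z - 1/2)) * Gamma (2 * (z - 1/2)) * rGamma (z - 1/2)" .
  moreover have "1 - 2 * (z - 1/2) = 2 - 2 * z" "2 * (z - 1/2) = 2 * z - 1"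
    by simp_all
  ultimately show ?case
    by (simp add: gegenbauer_sum_coeff_def)
next
  case (ge2 k)
  let ?h = "\<lambda>k j. complex_of_real (gegenbauer_sum_coeff k j)"
  let ?S = "\<lambda>k z. \<Sum>j\<le>k. ?h k j * Gamma (z - of_nat j)"
  have h0: "?h k 0 = 1" for k by (simp add: gegenbauer_sum_coeff_def)
  have hz: "?h k j = 0" if "k < 2 * j" for k j using that by (simp add: gegenbauer_sum_coeff_def)
  have "?S (Suc (Suc k)) z = Gamma z + (\<Sum>i\<le>Suc k. ?h (k + 2) (Suc i) * Gamma (z - of_nat (Suc i)))"
    by (subst sum.atMost_Suc_shift) (simp add: h0)
  also have "(\<Sum>i\<le>Suc k. ?h (k + 2) (Suc i) * Gamma (z - of_nat (Suc i))) =
     (\<Sum>i\<le>Suc k. ?h (k + 1) (Suc i) * Gamma (z - of_nat (Suc i))) - (of_nat k + 1) / 2 * (\<Sum>i\<le>Suc k. ?h k i * Gamma (z - 1 - of_nat i))"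
    unfolding gegenbauer_sum_coeff_rec sum_distrib_left sum_subtractf[symmetric]
    by (intro sum.cong refl) (simp add: algebra_simps)
  also have "(\<Sum>i\<le>Suc k. ?h k i * Gamma (z - 1 - of_nat i)) = ?S k (z - 1)"
    by (simp add: hz)
  \<comment> \<open>Regrouping only: the two copies of the left-hand sum cancel, and Gamma z is
    recognised as the term of index 0.\<close>
  also have "Gamma z + ((\<Sum>i\<le>Suc k. ?h (k + 1) (Suc i) * Gamma (z - of_nat (Suc i))) - (of_nat k + 1) / 2 * ?S k (z - 1))
     = ?S (Suc (Suc k)) z - ?S (Suc (Suc k)) z + (?h (k + 1) 0 * Gamma (z - of_nat 0) + (\<Sum>i\<le>Suc k. ?h (k + 1) (Suc i) * Gamma (z - of_nat (Suc i)))) - (of_nat k + 1) / 2 * ?S k (z - 1)"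
    by (simp add: h0)
  also have "?h (k + 1) 0 * Gamma (z - of_nat 0) + (\<Sum>i\<le>Suc k. ?h (k + 1) (Suc i) * Gamma (z - of_nat (Suc i))) = (\<Sum>j\<le>Suc (Suc k). ?h (k + 1) j * Gamma (z - of_nat j))"
    by (subst sum.atMost_Suc_shift) simp
  also have "(\<Sum>j\<le>Suc (Suc k). ?h (k + 1) j * Gamma (z - of_nat j)) = ?S (Suc k) z"
    by (subst sum.atMost_Suc) (simp add: hz)
  finally have S: "?S (Suc (Suc k)) z = ?S (Suc k) z - (of_nat k + 1) / 2 * ?S k (z - 1)"
    by simp
  \<comment> \<open>Common factors of the three values in the recurrence; once they are pulled out,
    what remains is (2 z - k - 2) - (k + 1) = 2 (z - k - 3/2).\<close>
  define G where "G = Gamma (2 * z - of_nat k - 2)"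
  define R where "R = rGamma (z - of_nat k - 1/2)"
  define P where "P = (2::complex) powr (of_nat k + 2 - 2 * z)"
  have pos: "Re (2 * z - of_nat k - 2) > 0" using ge2.prems by simp
  have 1: "?S (Suc k) z = of_real (sqrt pi) * P * ((2 * z - of_nat k - 2) * G) * R"
  proof -
    have "Gamma (2 * z - of_nat (Suc k)) = (2 * z - of_nat k - 2) * G"
      using Gamma_plus1[of "2 * z - of_nat k - 2"] not_nonpos_IntI[OF pos] by (simp add: G_def algebra_simps)
    moreover have "real (Suc k) / 2 < Re z" using ge2.prems by simp
    moreover have "of_nat (Suc k) + 1 - 2 * z = of_nat k + 2 - 2 * z" "z - of_nat (Suc k) + 1/2 = z - of_nat k - 1/2"
      by (simp_all add: field_simps)
    ultimately show ?thesis
      using ge2.IH(2)[of z] unfolding P_def R_def by (simp only:)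
  qed
  have 2: "?S k (z - 1) = of_real (sqrt pi) * (2 * P) * G * R"
  proof -
    have "(2::complex) powr (of_nat k + 1 - 2 * (z - 1)) = 2 powr (of_nat k + 2 - 2 * z + 1)"
      by (simp add: algebra_simps)
    also have "\<dots> = P * 2" unfolding P_def powr_add by simp
    finally have p: "(2::complex) powr (of_nat k + 1 - 2 * (z - 1)) = 2 * P" by simp
    have "real k / 2 < Re (z - 1)" using ge2.prems by simp
    from ge2.IH(1)[OF this] show ?thesis
      unfolding p G_def R_def by (simp add: algebra_simps)
  qed
  have 3: "rGamma (z - of_nat (Suc (Suc k)) + 1/2) = (z - of_nat k - 3/2) * R"
    using rGamma_plus1[of "z - of_nat k - 3/2"] by (simp add: R_def algebra_simps)
  have 4: "(2::complex) powr (of_nat (Suc (Suc k)) + 1 - 2 * z) = 2 * P"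
  proof -
    have "(2::complex) powr (of_nat (Suc (Suc k)) + 1 - 2 * z) = 2 powr (of_nat k + 2 - 2 * z + 1)"
      by (simp add: algebra_simps)
    also have "\<dots> = P * 2" unfolding P_def powr_add by simp
    finally show ?thesis by simp
  qed
  have 5: "Gamma (2 * z - of_nat (Suc (Suc k))) = G" by (simp add: G_def algebra_simps)
  show ?case
    unfolding S 1 2 3 4 5 by (simp add: algebra_simps)
qed

text \<open>The Gegenbauer polynomial of parameter (n-2)/2, normalised to 1 at t = 1: Chebyshev for
  n = 2, Legendre for n = 3. This expansion in t and 1 - t^2 is the one that averaging over a sphere
  of latitude produces.\<close>

definition gegenbauer_poly :: "nat \<Rightarrow> nat \<Rightarrow> real \<Rightarrow> real" where
  "gegenbauer_poly n k t = (\<Sum>j\<le>k. gegenbauer_sum_coeff k j / pochhammer ((real n - 1) / 2) j * t ^ (k - 2 * j) * (1 - t\<^sup>2) ^ j)"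

text \<open>Each term is a Beta integral. Its Pochhammer denominator cancels against Gamma (b + j),
  and the second Gamma argument (s + n + k)/2 is the same for all j, so only the sum evaluated
  before remains.\<close>

lemma gegenbauer_moment:
  assumes n: "n \<ge> 2" and s: "Re s > -1"
  shows "set_integrable lborel {0<..<1} (\<lambda>t. of_real (gegenbauer_poly n k t * (1 - t\<^sup>2) powr ((real n - 3) / 2)) * of_real t powr s)" (is ?I)
    and "(LBINT t:{0<..<1}. of_real (gegenbauer_poly n k t * (1 - t\<^sup>2) powr ((real n - 3) / 2)) * of_real t powr s) =
      of_real (sqrt pi * Gamma ((real n - 1) / 2) / 2) * 2 powr (- s) * Gamma (s + 1) *
      rGamma ((s - of_nat k) / 2 + 1) * rGamma ((s + of_nat n + of_nat k) / 2)" (is ?E)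
proof -
  define b where "b = (real n - 1) / 2"
  have b: "b > 0" using n by (simp add: b_def)
  let ?c = "\<lambda>j. complex_of_real (gegenbauer_sum_coeff k j / pochhammer b j)"
  let ?f = "\<lambda>j t. ?c j * (of_real ((1 - t\<^sup>2) powr (b - 1 + real j)) * of_real t powr (s + (of_nat k - 2 * of_nat j)))"
  let ?F = "\<lambda>t. complex_of_real (gegenbauer_poly n k t * (1 - t\<^sup>2) powr ((real n - 3) / 2)) * of_real t powr s"
  have F: "?F t = (\<Sum>j\<le>k. ?f j t)" if t: "t \<in> {0<..<1}" for t
  proof -
    have "t\<^sup>2 < 1" using t by (simp add: power_less_one_iff)
    then have u: "1 - t\<^sup>2 > 0" by simp
    have "complex_of_real (gegenbauer_sum_coeff k j / pochhammer b j * t ^ (k - 2 * j) * (1 - t\<^sup>2) ^ j * (1 - t\<^sup>2) powr ((real n - 3) / 2)) * of_real t powr s = ?f j t" for j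
    proof (cases "2 * j \<le> k")
      case True
      have "(1 - t\<^sup>2) ^ j * (1 - t\<^sup>2) powr ((real n - 3) / 2) = (1 - t\<^sup>2) powr (b - 1 + real j)"
        using u by (simp add: powr_realpow[symmetric] powr_add[symmetric] b_def field_simps)
      then have 1: "complex_of_real ((1 - t\<^sup>2) ^ j) * of_real ((1 - t\<^sup>2) powr ((real n - 3) / 2)) = of_real ((1 - t\<^sup>2) powr (b - 1 + real j))"
        by (simp only: of_real_mult[symmetric])
      have "complex_of_real (t ^ (k - 2 * j)) = of_real t powr of_nat (k - 2 * j)"
        using t by (subst powr_nat) auto
      then have 2: "complex_of_real (t ^ (k - 2 * j)) * of_real t powr s = of_real t powr (s + (of_nat k - 2 * of_nat j))"
        using True by (simp add: powr_add[symmetric] of_nat_diff add.commute)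
      show ?thesis
        unfolding 1[symmetric] 2[symmetric] of_real_mult by (simp only: mult_ac)
    qed (simp add: gegenbauer_sum_coeff_def)
    then show ?thesis
      unfolding gegenbauer_poly_def b_def[symmetric] sum_distrib_right of_real_sum by (intro sum.cong refl)
  qed
  have B: "set_integrable lborel {0<..<1} (?f j) \<and> (LBINT t:{0<..<1}. ?f j t) =
     of_real (Gamma b / 2) * rGamma ((s + of_nat n + of_nat k) / 2) * (of_real (gegenbauer_sum_coeff k j) * Gamma ((s + of_nat k + 1) / 2 - of_nat j))" for j
  proof (cases "2 * j \<le> k")
    case True
    have l: "b - 1 + real j > -1" using b by simp
    have z: "Re (s + (of_nat k - 2 * of_nat j)) > -1" using s True by simp
    have e1: "(s + (of_nat k - 2 * of_nat j) + 1) / 2 = (s + of_nat k + 1) / 2 - of_nat j"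
      by (simp add: field_simps)
    have e2: "(s + of_nat k + 1) / 2 - of_nat j + complex_of_real (b - 1 + real j + 1) = (s + of_nat n + of_nat k) / 2"
      by (simp add: field_simps b_def)
    have p: "pochhammer b j \<noteq> 0" using b pochhammer_pos[of b j] by simp
    have "b \<notin> \<int>\<^sub>\<le>\<^sub>0" using b by (auto elim!: nonpos_Ints_cases)
    then have "Gamma (b + real j) = pochhammer b j * Gamma b"
      using pochhammer_Gamma[of b j] by (simp add: Gamma_eq_zero_iff field_simps)
    then have g: "Gamma (complex_of_real (b - 1 + real j + 1)) = of_real (pochhammer b j) * of_real (Gamma b)"
      by (simp only: Gamma_complex_of_real of_real_mult[symmetric]) (simp add: add.commute)
    have "(LBINT t:{0<..<1}. ?f j t) = ?c j * (Gamma ((s + of_nat k + 1) / 2 - of_nat j) * (of_real (pochhammer b j) * of_real (Gamma b)) * rGamma ((s + of_nat n + of_nat k) / 2) / 2)"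
      unfolding set_integral_mult_right Beta_integral_complex(2)[OF l z] e1 e2 g ..
    then show ?thesis
      using Beta_integral_complex(1)[OF l z] p by (simp add: field_simps)
  qed (simp add: gegenbauer_sum_coeff_def set_integrable_def)
  have I: "set_integrable lborel {0<..<1} (\<lambda>t. \<Sum>j\<le>k. ?f j t)"
    using B unfolding set_integrable_def scaleR_sum_right by (intro Bochner_Integration.integrable_sum) auto
  show ?I
    using I F by (subst set_integrable_cong[OF refl refl F]) auto
  have "(LBINT t:{0<..<1}. ?F t) = (LBINT t:{0<..<1}. \<Sum>j\<le>k. ?f j t)"
    by (rule set_lebesgue_integral_cong) (use F in auto)
  also have "\<dots> = (\<Sum>j\<le>k. LBINT t:{0<..<1}. ?f j t)"
    using B unfolding set_lebesgue_integral_def set_integrable_def scaleR_sum_right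
    by (intro Bochner_Integration.integral_sum) auto
  also have "\<dots> = of_real (Gamma b / 2) * rGamma ((s + of_nat n + of_nat k) / 2) *
     (\<Sum>j\<le>k. of_real (gegenbauer_sum_coeff k j) * Gamma ((s + of_nat k + 1) / 2 - of_nat j))"
    unfolding sum_distrib_left by (intro sum.cong refl conjunct2[OF B])
  also have "(\<Sum>j\<le>k. of_real (gegenbauer_sum_coeff k j) * Gamma ((s + of_nat k + 1) / 2 - of_nat j)) =
     of_real (sqrt pi) * 2 powr (- s) * Gamma (s + 1) * rGamma ((s - of_nat k) / 2 + 1)"
  proof -
    have "of_nat k + 1 - 2 * ((s + of_nat k + 1) / 2) = - s" "2 * ((s + of_nat k + 1) / 2) - of_nat k = s + 1"
      "(s + of_nat k + 1) / 2 - of_nat k + 1/2 = (s - of_nat k) / 2 + 1"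
      by (simp_all add: field_simps)
    then show ?thesis
      using gegenbauer_sum_Gamma[of k "(s + of_nat k + 1) / 2"] s by simp
  qed
  finally show ?E
    by (simp add: b_def mult_ac)
qed

section \<open>The averaging operator on harmonic polynomials\<close>

lemma real_polynomial_function_has_derivative:
  assumes "real_polynomial_function f"
  shows "\<exists>D. (\<forall>x. (f has_derivative D x) (at x)) \<and> (\<forall>v. real_polynomial_function (\<lambda>x. D x v))"
  using assms
proof induction
  case (linear f)
  then show ?case
    by (intro exI[of _ "\<lambda>x. f"]) (auto intro: bounded_linear_imp_has_derivative)
next
  case (const c)
  show ?case by (intro exI[of _ "\<lambda>x v. 0"]) auto
next
  case (add f g)
  then obtain Df Dg where "\<And>x. (f has_derivative Df x) (at x)" "\<And>x. (g has_derivative Dg x) (at x)"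
    "\<And>v. real_polynomial_function (\<lambda>x. Df x v)" "\<And>v. real_polynomial_function (\<lambda>x. Dg x v)" by blast
  then show ?case
    by (intro exI[of _ "\<lambda>x v. Df x v + Dg x v"]) (auto intro!: has_derivative_add)
next
  case (mult f g)
  then obtain Df Dg where "\<And>x. (f has_derivative Df x) (at x)" "\<And>x. (g has_derivative Dg x) (at x)"
    "\<And>v. real_polynomial_function (\<lambda>x. Df x v)" "\<And>v. real_polynomial_function (\<lambda>x. Dg x v)" by blast
  then show ?case
    using mult.hyps by (intro exI[of _ "\<lambda>x v. f x * Dg x v + Df x v * g x"]) (auto intro!: has_derivative_mult real_polynomial_function.intros(3,4))
qed

lemma polynomial_function_complexI:
  "real_polynomial_function f \<Longrightarrow> real_polynomial_function g \<Longrightarrow> polynomial_function (\<lambda>x. complex_of_real (f x) + \<i> * complex_of_real (g x))"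
  using polynomial_function_add[OF polynomial_function_mult[OF _ polynomial_function_const[of 1]]
      polynomial_function_mult[OF _ polynomial_function_const[of \<i>]], of f g]
  by (simp add: real_polynomial_function_eq scaleR_conv_of_real mult.commute)

lemma polynomial_function_Re_Im:
  fixes p :: "'a::real_normed_vector \<Rightarrow> complex"
  assumes "polynomial_function p"
  shows "real_polynomial_function (\<lambda>x. Re (p x))" "real_polynomial_function (\<lambda>x. Im (p x))"
  using assms bounded_linear_Re bounded_linear_Im unfolding polynomial_function_def o_def by blast+

lemma polynomial_function_mult_complex:
  fixes p q :: "'a::real_normed_vector \<Rightarrow> complex"
  assumes "polynomial_function p" "polynomial_function q"
  shows "polynomial_function (\<lambda>x. p x * q x)"
proof -
  note pq = polynomial_function_Re_Im[OF assms(1)] polynomial_function_Re_Im[OF assms(2)]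
  have "polynomial_function (\<lambda>x. complex_of_real (Re (p x) * Re (q x) - Im (p x) * Im (q x)) + \<i> * complex_of_real (Re (p x) * Im (q x) + Im (p x) * Re (q x)))"
    using pq by (intro polynomial_function_complexI) auto
  also have "(\<lambda>x. complex_of_real (Re (p x) * Re (q x) - Im (p x) * Im (q x)) + \<i> * complex_of_real (Re (p x) * Im (q x) + Im (p x) * Re (q x))) = (\<lambda>x. p x * q x)"
    by (auto simp: complex_eq_iff)
  finally show ?thesis .
qed

text \<open>The direction comes before the point, so that \<open>dird p v\<close> can be
  differentiated again. The direction may be any vector, in particular the base point itself or the
  variable of integration.\<close>

definition dird :: "('a::real_normed_vector \<Rightarrow> complex) \<Rightarrow> 'a \<Rightarrow> 'a \<Rightarrow> complex" where
  "dird p v x = frechet_derivative p (at x) v"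

lemma polynomial_function_derivative:
  fixes p :: "'a::real_normed_vector \<Rightarrow> complex"
  assumes "polynomial_function p"
  shows "(p has_derivative (\<lambda>v. dird p v x)) (at x)" and "polynomial_function (dird p v)"
proof -
  obtain Dr where Dr: "\<And>x. ((\<lambda>x. Re (p x)) has_derivative Dr x) (at x)" "\<And>v. real_polynomial_function (\<lambda>x. Dr x v)"
    using real_polynomial_function_has_derivative[OF polynomial_function_Re_Im(1)[OF assms]] by blast
  obtain Di where Di: "\<And>x. ((\<lambda>x. Im (p x)) has_derivative Di x) (at x)" "\<And>v. real_polynomial_function (\<lambda>x. Di x v)"
    using real_polynomial_function_has_derivative[OF polynomial_function_Re_Im(2)[OF assms]] by blast
  have "((\<lambda>x. complex_of_real (Re (p x)) + \<i> * complex_of_real (Im (p x))) has_derivative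
     (\<lambda>v. complex_of_real (Dr x v) + \<i> * complex_of_real (Di x v))) (at x)" for x
    by (intro has_derivative_add has_derivative_of_real has_derivative_mult_right Dr Di)
  then have D: "(p has_derivative (\<lambda>v. complex_of_real (Dr x v) + \<i> * complex_of_real (Di x v))) (at x)" for x
    by (simp add: complex_eq[symmetric])
  have eq: "dird p v x = complex_of_real (Dr x v) + \<i> * complex_of_real (Di x v)" for v x
    unfolding dird_def frechet_derivative_at[OF D[of x], symmetric] ..
  show "(p has_derivative (\<lambda>v. dird p v x)) (at x)"
    using D by (simp add: eq)
  show "polynomial_function (dird p v)"
    unfolding eq[abs_def] by (intro polynomial_function_complexI Dr Di)
qed

lemma linear_dird: "polynomial_function p \<Longrightarrow> linear (\<lambda>v. dird p v x)"
  using polynomial_function_derivative(1) has_derivative_linear by blast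

lemma dird_sum: "polynomial_function p \<Longrightarrow> dird p (\<Sum>b\<in>B. c b *\<^sub>R b) x = (\<Sum>b\<in>B. c b *\<^sub>R dird p b x)"
  unfolding linear_sum[OF linear_dird] linear_scale[OF linear_dird] ..

lemma dird_eqI:
  assumes "(p has_derivative D) (at x)"
  shows "dird p v x = D v"
  unfolding dird_def frechet_derivative_at[OF assms, symmetric] ..

lemma dird_add:
  "polynomial_function p \<Longrightarrow> polynomial_function q \<Longrightarrow> dird (\<lambda>x. p x + q x) v x = dird p v x + dird q v x"
  by (intro dird_eqI[where D = "\<lambda>v. dird p v x + dird q v x"] has_derivative_add polynomial_function_derivative)

lemma dird_diff:
  "polynomial_function p \<Longrightarrow> polynomial_function q \<Longrightarrow> dird (\<lambda>x. p x - q x) v x = dird p v x - dird q v x"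
  by (intro dird_eqI[where D = "\<lambda>v. dird p v x - dird q v x"] has_derivative_diff polynomial_function_derivative)

lemma dird_scaleR: "polynomial_function p \<Longrightarrow> dird (\<lambda>x. c *\<^sub>R p x) v x = c *\<^sub>R dird p v x"
  by (intro dird_eqI[where D = "\<lambda>v. c *\<^sub>R dird p v x"] has_derivative_scaleR_right polynomial_function_derivative)

lemma dird_inner_times:
  fixes b :: "'a::euclidean_space"
  assumes "polynomial_function p"
  shows "dird (\<lambda>x. (b \<bullet> x) *\<^sub>R p x) v x = (b \<bullet> x) *\<^sub>R dird p v x + (b \<bullet> v) *\<^sub>R p x"
  by (intro dird_eqI[where D = "\<lambda>v. (b \<bullet> x) *\<^sub>R dird p v x + (b \<bullet> v) *\<^sub>R p x"] has_derivative_scaleR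
      has_derivative_inner_right polynomial_function_derivative assms has_derivative_ident)

lemma polynomial_function_inner_times:
  fixes b :: "'a::euclidean_space" and p :: "'a \<Rightarrow> complex"
  assumes "polynomial_function p"
  shows "polynomial_function (\<lambda>x. (b \<bullet> x) *\<^sub>R p x)"
proof -
  have "polynomial_function (\<lambda>x. b \<bullet> x)"
    using real_polynomial_function.intros(1)[OF bounded_linear_inner_right[of b]] by (simp add: real_polynomial_function_eq)
  then show ?thesis using assms by (rule polynomial_function_mult)
qed

lemma linear_dird2:
  assumes "polynomial_function p"
  shows "linear (\<lambda>v. dird (dird p v) w x)"
proof
  fix u v c
  note lin = linear_dird[OF assms]
  show "dird (dird p (u + v)) w x = dird (dird p u) w x + dird (dird p v) w x"
    unfolding linear_add[OF lin] dird_add[OF polynomial_function_derivative(2)[OF assms] polynomial_function_derivative(2)[OF assms], symmetric]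
    by (rule arg_cong[of _ _ "\<lambda>q. dird q w x"]) (simp add: fun_eq_iff linear_add[OF lin])
  show "dird (dird p (c *\<^sub>R v)) w x = c *\<^sub>R dird (dird p v) w x"
    unfolding dird_scaleR[OF polynomial_function_derivative(2)[OF assms], symmetric]
    by (rule arg_cong[of _ _ "\<lambda>q. dird q w x"]) (simp add: fun_eq_iff linear_scale[OF lin])
qed

lemma dird2_sum_left:
  "polynomial_function p \<Longrightarrow> dird (dird p (\<Sum>b\<in>B. c b *\<^sub>R b)) w x = (\<Sum>b\<in>B. c b *\<^sub>R dird (dird p b) w x)"
  unfolding linear_sum[OF linear_dird2] linear_scale[OF linear_dird2] ..

lemma dird_line_has_vector_derivative:
  assumes "polynomial_function p"
  shows "((\<lambda>r. p (x + r *\<^sub>R v)) has_vector_derivative dird p v (x + r *\<^sub>R v)) (at r)"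
proof -
  have "((\<lambda>r. x + r *\<^sub>R v) has_vector_derivative v) (at r)"
    by (auto intro!: derivative_eq_intros)
  then have "((\<lambda>r. p (x + r *\<^sub>R v)) has_derivative (\<lambda>h. dird p (h *\<^sub>R v) (x + r *\<^sub>R v))) (at r)"
    unfolding has_vector_derivative_def
    by (rule has_derivative_compose) (rule polynomial_function_derivative(1)[OF assms])
  then show ?thesis
    unfolding has_vector_derivative_def linear_scale[OF linear_dird[OF assms]] .
qed

lemma laplacian_polynomial:
  fixes p :: "real ^ 'n \<Rightarrow> complex"
  assumes "polynomial_function p"
  shows "laplacian p x = (\<Sum>b\<in>Basis. dird (dird p b) b x)"
  unfolding laplacian_def
proof (intro sum.cong refl)
  fix b :: "real ^ 'n"
  have 1: "vector_derivative (\<lambda>r. p (x + r *\<^sub>R b)) (at s) = dird p b (x + s *\<^sub>R b)" for s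
    by (rule vector_derivative_at[OF dird_line_has_vector_derivative[OF assms]])
  show "vector_derivative (\<lambda>s. vector_derivative (\<lambda>r. p (x + r *\<^sub>R b)) (at s)) (at 0) = dird (dird p b) b x"
    unfolding 1
    using vector_derivative_at[OF dird_line_has_vector_derivative[OF polynomial_function_derivative(2)[OF assms, of b], of x b 0]] by simp
qed

lemma Euler_identity:
  assumes p: "polynomial_function p" and hom: "\<And>c x. p (c *\<^sub>R x) = of_real (c ^ k) * p x"
  shows "dird p x x = of_nat k * p x"
proof -
  have "((\<lambda>c. p (0 + c *\<^sub>R x)) has_vector_derivative dird p x x) (at 1)"
    using dird_line_has_vector_derivative[OF p, of 0 x 1] by simp
  moreover have "((\<lambda>c. of_real (c ^ k) * p x) has_vector_derivative of_real (real k * 1 ^ (k - 1)) * p x) (at 1)"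
    by (intro has_vector_derivative_mult_left has_vector_derivative_of_real) (use DERIV_pow[of k 1 UNIV] in simp)
  ultimately show ?thesis
    using vector_derivative_unique_at by (fastforce simp: hom)
qed

text \<open>The derivative of p along a fixed v is homogeneous of degree k - 1, and this is Euler's
  identity for it.\<close>

lemma Euler_identity_dird_right:
  assumes p: "polynomial_function p" and hom: "\<And>c x. p (c *\<^sub>R x) = of_real (c ^ k) * p x"
  shows "dird (dird p v) x x = (of_nat k - 1) * dird p v x"
proof -
  note pv = polynomial_function_derivative(2)[OF p, of v]
  \<comment> \<open>Written as a quotient because k may be 0; excluding c = 0 is harmless, as the
    derivative is taken at c = 1.\<close>
  have h: "dird p v (c *\<^sub>R x) = of_real (c ^ k / c) * dird p v x" if "c \<noteq> 0" for c
  proof -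
    have "((\<lambda>r. p (c *\<^sub>R x + r *\<^sub>R (c *\<^sub>R v))) has_vector_derivative dird p (c *\<^sub>R v) (c *\<^sub>R x)) (at 0)"
      using dird_line_has_vector_derivative[OF p, of "c *\<^sub>R x" "c *\<^sub>R v" 0] by simp
    moreover have "((\<lambda>r. of_real (c ^ k) * p (x + r *\<^sub>R v)) has_vector_derivative of_real (c ^ k) * dird p v x) (at 0)"
      using has_vector_derivative_mult_right[OF dird_line_has_vector_derivative[OF p, of x v 0]] by simp
    moreover have "p (c *\<^sub>R x + r *\<^sub>R (c *\<^sub>R v)) = of_real (c ^ k) * p (x + r *\<^sub>R v)" for r
      using hom[of c "x + r *\<^sub>R v"] by (simp add: scaleR_add_right mult.commute)
    ultimately have "dird p (c *\<^sub>R v) (c *\<^sub>R x) = of_real (c ^ k) * dird p v x"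
      using vector_derivative_unique_at by fastforce
    then have "c *\<^sub>R dird p v (c *\<^sub>R x) = of_real (c ^ k) * dird p v x"
      by (simp add: linear_scale[OF linear_dird[OF p]])
    then show ?thesis using that by (simp add: scaleR_conv_of_real field_simps)
  qed
  have "((\<lambda>c. dird p v (0 + c *\<^sub>R x)) has_vector_derivative dird (dird p v) x x) (at 1)"
    using dird_line_has_vector_derivative[OF pv, of 0 x 1] by simp
  then have 1: "((\<lambda>c. of_real (c ^ k / c) * dird p v x) has_vector_derivative dird (dird p v) x x) (at 1)"
    by (rule has_vector_derivative_transform_within_open[where S = "{0<..}"]) (auto simp: h)
  have "((\<lambda>c::real. c ^ k / c) has_real_derivative real k - 1) (at 1)"
    by (auto intro!: derivative_eq_intros)
  then have 2: "((\<lambda>c. of_real (c ^ k / c) * dird p v x) has_vector_derivative of_real (real k - 1) * dird p v x) (at 1)"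
    by (intro has_vector_derivative_mult_left has_vector_derivative_of_real)
  show ?thesis
    using vector_derivative_unique_at[OF 1 2] by simp
qed

lemma Euler_identity_dird_left:
  fixes p :: "'a::euclidean_space \<Rightarrow> complex"
  assumes p: "polynomial_function p" and hom: "\<And>c x. p (c *\<^sub>R x) = of_real (c ^ k) * p x"
  shows "dird (dird p x) w x = (of_nat k - 1) * dird p w x"
proof -
  have exp: "y = (\<Sum>b\<in>Basis. (y \<bullet> b) *\<^sub>R b)" for y :: 'a by (simp add: euclidean_representation)
  have q: "(\<Sum>b\<in>Basis. (y \<bullet> b) *\<^sub>R dird p b y) = of_nat k * p y" for y
    using Euler_identity[OF p hom, of y] dird_sum[OF p, of "\<lambda>b. y \<bullet> b" Basis y] by (simp flip: exp)
  have "((\<lambda>y. \<Sum>b\<in>Basis. (y \<bullet> b) *\<^sub>R dird p b y) has_derivative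
    (\<lambda>w. \<Sum>b\<in>Basis. (x \<bullet> b) *\<^sub>R dird (dird p b) w x + (w \<bullet> b) *\<^sub>R dird p b x)) (at x)"
    by (intro has_derivative_sum has_derivative_scaleR has_derivative_inner_left has_derivative_ident
        polynomial_function_derivative(1)[OF polynomial_function_derivative(2)[OF p]])
  moreover have "((\<lambda>y. of_nat k * p y) has_derivative (\<lambda>w. of_nat k * dird p w x)) (at x)"
    by (intro has_derivative_mult_right polynomial_function_derivative(1)[OF p])
  ultimately have "(\<Sum>b\<in>Basis. (x \<bullet> b) *\<^sub>R dird (dird p b) w x + (w \<bullet> b) *\<^sub>R dird p b x) = of_nat k * dird p w x"
    unfolding q using has_derivative_unique by (metis (no_types, lifting))
  moreover have "(\<Sum>b\<in>Basis. (x \<bullet> b) *\<^sub>R dird (dird p b) w x) = dird (dird p x) w x"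
    using dird2_sum_left[OF p, of "\<lambda>b. x \<bullet> b" Basis w x] by (simp flip: exp)
  moreover have "(\<Sum>b\<in>Basis. (w \<bullet> b) *\<^sub>R dird p b x) = dird p w x"
    using dird_sum[OF p, of "\<lambda>b. w \<bullet> b" Basis x] by (simp flip: exp)
  ultimately show ?thesis
    by (simp add: sum.distrib algebra_simps)
qed

text \<open>The Laplacian is the trace of the Hessian, the same in every orthonormal basis. This
  allows the direction x to be separated from the hyperplane orthogonal to it.\<close>

lemma sum_dird2_orthonormal:
  fixes p :: "'a::euclidean_space \<Rightarrow> complex"
  assumes p: "polynomial_function p" and B: "finite B" "\<And>y. (\<Sum>b\<in>B. (y \<bullet> b) *\<^sub>R b) = y"
  shows "(\<Sum>b\<in>B. dird (dird p b) b x) = (\<Sum>e\<in>Basis. dird (dird p e) e x)"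
proof -
  have exp: "y = (\<Sum>b\<in>Basis. (y \<bullet> b) *\<^sub>R b)" for y :: 'a by (simp add: euclidean_representation)
  have 1: "dird (dird p b) b x = (\<Sum>e\<in>Basis. (b \<bullet> e) *\<^sub>R dird (dird p e) b x)" for b
    using dird2_sum_left[OF p, of "\<lambda>e. b \<bullet> e" Basis b x] by (simp flip: exp)
  have 2: "(\<Sum>b\<in>B. (b \<bullet> e) *\<^sub>R dird (dird p e) b x) = dird (dird p e) e x" for e
    using dird_sum[OF polynomial_function_derivative(2)[OF p], of e "\<lambda>b. e \<bullet> b" B x] unfolding B(2) by (simp add: inner_commute)
  have "(\<Sum>b\<in>B. dird (dird p b) b x) = (\<Sum>b\<in>B. \<Sum>e\<in>Basis. (b \<bullet> e) *\<^sub>R dird (dird p e) b x)"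
    by (intro sum.cong refl 1)
  also have "\<dots> = (\<Sum>e\<in>Basis. \<Sum>b\<in>B. (b \<bullet> e) *\<^sub>R dird (dird p e) b x)"
    by (rule sum.swap)
  finally show ?thesis
    by (simp only: 2)
qed

section \<open>Lebesgue measure under orthogonal maps and the equator measure\<close>

lemma nn_integral_lborel_shift:
  fixes f :: "'a::euclidean_space \<Rightarrow> ennreal"
  assumes [measurable]: "f \<in> borel_measurable borel"
  shows "(\<integral>\<^sup>+x. f (t + x) \<partial>lborel) = (\<integral>\<^sup>+x. f x \<partial>lborel)"
    and "(\<integral>\<^sup>+x. f (t - x) \<partial>lborel) = (\<integral>\<^sup>+x. f x \<partial>lborel)"
proof -
  show "(\<integral>\<^sup>+x. f (t + x) \<partial>lborel) = (\<integral>\<^sup>+x. f x \<partial>lborel)"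
    by (subst (2) lborel_affine[of 1 t]) (simp_all add: nn_integral_density nn_integral_distr)
  show "(\<integral>\<^sup>+x. f (t - x) \<partial>lborel) = (\<integral>\<^sup>+x. f x \<partial>lborel)"
    by (subst (2) lborel_affine[of "-1" t]) (simp_all add: nn_integral_density nn_integral_distr)
qed

text \<open>Uniqueness of Haar measure: \<open>lborel\<close> and its image under \<open>T\<close> are both translation invariant, so
  Fubini shows that they are proportional, and they agree on the unit ball.\<close>

lemma lborel_distr_orthogonal:
  fixes T :: "'a::euclidean_space \<Rightarrow> 'a"
  assumes T: "orthogonal_transformation T"
  shows "distr lborel borel T = lborel"
proof (rule measure_eqI)
  fix A assume "A \<in> sets (distr lborel borel T)"
  then have [measurable]: "A \<in> sets borel" by simp
  have lin: "linear T" using T orthogonal_transformation by blast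
  have [measurable]: "T \<in> borel_measurable borel"
    by (rule borel_measurable_continuous_onI[OF linear_continuous_on[OF linear_conv_bounded_linear[THEN iffD1, OF lin]]])
  let ?S = "inv_into UNIV T"
  have TS: "T (?S y) = y" for y using orthogonal_transformation_surj[OF T] by (simp add: surj_f_inv_f)
  let ?B = "ball 0 1 :: 'a set"
  have [measurable]: "?B \<in> sets borel" by simp
  have TB: "T x \<in> ?B \<longleftrightarrow> x \<in> ?B" for x
    using T by (simp add: orthogonal_transformation)
  let ?\<nu> = "\<lambda>A. \<integral>\<^sup>+x. indicator A (T x) \<partial>lborel"
  have "?\<nu> A * emeasure lborel ?B = (\<integral>\<^sup>+x. (\<integral>\<^sup>+y. indicator A (T x) * indicator ?B y \<partial>lborel) \<partial>lborel)"
  proof -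
    have "(\<integral>\<^sup>+y. indicator A (T x) * indicator ?B y \<partial>lborel) = indicator A (T x) * emeasure lborel ?B" for x
      by (rule nn_integral_cmult_indicator) simp
    then show ?thesis by (subst nn_integral_multc[symmetric]) simp_all
  qed
  also have "\<dots> = (\<integral>\<^sup>+x. (\<integral>\<^sup>+y. indicator A (T x) * indicator ?B (T x + y) \<partial>lborel) \<partial>lborel)"
    by (rule nn_integral_cong, rule nn_integral_lborel_shift(1)[symmetric]) measurable
  also have "\<dots> = (\<integral>\<^sup>+y. (\<integral>\<^sup>+x. indicator A (T x) * indicator ?B (T x + y) \<partial>lborel) \<partial>lborel)"
    by (rule lborel_pair.Fubini') measurable
  \<comment> \<open>Translating x by minus the preimage of y turns T x into T x - y.\<close>
  also have "\<dots> = (\<integral>\<^sup>+y. (\<integral>\<^sup>+x. indicator A (T (- ?S y + x)) * indicator ?B (T (- ?S y + x) + y) \<partial>lborel) \<partial>lborel)"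
    by (rule nn_integral_cong, rule nn_integral_lborel_shift(1)[symmetric]) measurable
  also have "\<dots> = (\<integral>\<^sup>+y. (\<integral>\<^sup>+x. indicator A (T x - y) * indicator ?B (T x) \<partial>lborel) \<partial>lborel)"
    by (simp add: linear_diff[OF lin] TS)
  also have "\<dots> = (\<integral>\<^sup>+x. (\<integral>\<^sup>+y. indicator A (T x - y) * indicator ?B (T x) \<partial>lborel) \<partial>lborel)"
    by (rule lborel_pair.Fubini'[symmetric]) measurable
  also have "\<dots> = (\<integral>\<^sup>+x. emeasure lborel A * indicator ?B x \<partial>lborel)"
  proof (intro nn_integral_cong)
    fix x :: 'a
    have "(\<integral>\<^sup>+y. indicator A (T x - y) * indicator ?B (T x) \<partial>lborel) = (\<integral>\<^sup>+y. indicator A (T x - y) \<partial>lborel) * indicator ?B (T x)"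
      by (rule nn_integral_multc) simp
    moreover have "(\<integral>\<^sup>+y. indicator A (T x - y) \<partial>lborel) = emeasure lborel A"
      by (subst nn_integral_lborel_shift(2)) simp_all
    moreover have "indicator ?B (T x) = (indicator ?B x :: ennreal)"
      using TB[of x] by (simp add: indicator_def)
    ultimately show "(\<integral>\<^sup>+y. indicator A (T x - y) * indicator ?B (T x) \<partial>lborel) = emeasure lborel A * indicator ?B x"
      by simp
  qed
  also have "\<dots> = emeasure lborel A * emeasure lborel ?B"
    by (rule nn_integral_cmult_indicator) simp
  finally have eq: "?\<nu> A * emeasure lborel ?B = emeasure lborel A * emeasure lborel ?B" .
  have fin: "emeasure lborel ?B \<noteq> 0" "emeasure lborel ?B \<noteq> \<infinity>"
    using emeasure_lborel_ball_finite[of "0::'a" 1] content_ball_pos[of 1 "0::'a"]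
    by (auto simp: measure_def enn2real_eq_0_iff)
  have "?\<nu> A = emeasure lborel A"
    using eq fin unfolding mult.commute[of _ "emeasure lborel ?B"] ennreal_mult_cancel_left by auto
  moreover have "emeasure (distr lborel borel T) A = ?\<nu> A"
    by (simp add: nn_integral_distr[of T lborel borel "indicator A", symmetric])
  ultimately show "emeasure (distr lborel borel T) A = emeasure lborel A" by simp
qed simp

definition equator_cylinder :: "real ^ 'n \<Rightarrow> (real ^ 'n) set" where
  "equator_cylinder x = {y. 0 \<le> y \<bullet> x \<and> y \<bullet> x \<le> 1 \<and> norm (y - (y \<bullet> x) *\<^sub>R x) \<le> 1}"

lemma equator_measure_alt:
  "equator_measure x = scale_measure (of_nat (CARD('n) - 1))
     (distr (restrict_space lborel (equator_cylinder x)) borel (\<lambda>y::real^'n. sgn (y - (y \<bullet> x) *\<^sub>R x)))"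
  by (simp add: equator_measure_def equator_cylinder_def)

lemma equator_cylinder_sets [measurable]: "equator_cylinder x \<in> sets borel"
  unfolding equator_cylinder_def by measurable

lemma sgn_measurable' [measurable]: "(\<lambda>y::real^'n. sgn (y - (y \<bullet> x) *\<^sub>R x)) \<in> borel_measurable borel"
  unfolding sgn_div_norm by measurable

lemma sets_equator_measure [simp, measurable_cong]: "sets (equator_measure x) = sets borel"
  by (simp add: equator_measure_def)

lemma space_equator_measure [simp]: "space (equator_measure x) = UNIV"
  by (simp add: equator_measure_def space_scale_measure)

lemma emeasure_equator_measure:
  fixes x :: "real ^ 'n"
  assumes "A \<in> sets borel"
  shows "emeasure (equator_measure x) A =
    of_nat (CARD('n) - 1) * emeasure lborel {y \<in> equator_cylinder x. sgn (y - (y \<bullet> x) *\<^sub>R x) \<in> A}"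
proof -
  have "emeasure (distr (restrict_space lborel (equator_cylinder x)) borel (\<lambda>y. sgn (y - (y \<bullet> x) *\<^sub>R x))) A
      = emeasure (restrict_space lborel (equator_cylinder x)) ((\<lambda>y. sgn (y - (y \<bullet> x) *\<^sub>R x)) -` A \<inter> equator_cylinder x)"
    using assms by (subst emeasure_distr) (auto intro!: measurable_restrict_space1 simp: space_restrict_space)
  also have "\<dots> = emeasure lborel ((\<lambda>y. sgn (y - (y \<bullet> x) *\<^sub>R x)) -` A \<inter> equator_cylinder x)"
    by (rule emeasure_restrict_space) auto
  also have "(\<lambda>y. sgn (y - (y \<bullet> x) *\<^sub>R x)) -` A \<inter> equator_cylinder x = {y \<in> equator_cylinder x. sgn (y - (y \<bullet> x) *\<^sub>R x) \<in> A}"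
    by auto
  finally show ?thesis by (simp add: equator_measure_alt)
qed

lemma equator_cylinder_bounded:
  fixes x :: "real ^ 'n"
  assumes "norm x = 1"
  shows "equator_cylinder x \<subseteq> cball 0 2"
proof
  fix y assume y: "y \<in> equator_cylinder x"
  have "norm y = norm ((y - (y \<bullet> x) *\<^sub>R x) + (y \<bullet> x) *\<^sub>R x)" by simp
  also have "\<dots> \<le> norm (y - (y \<bullet> x) *\<^sub>R x) + norm ((y \<bullet> x) *\<^sub>R x)" by (rule norm_triangle_ineq)
  also have "\<dots> \<le> 1 + 1" using y assms by (intro add_mono) (auto simp: equator_cylinder_def)
  finally show "y \<in> cball 0 2" by simp
qed

lemma finite_measure_equator:
  fixes x :: "real ^ 'n"
  assumes "norm x = 1"
  shows "finite_measure (equator_measure x)"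
proof
  have "emeasure lborel {y \<in> equator_cylinder x. sgn (y - (y \<bullet> x) *\<^sub>R x) \<in> UNIV} \<le> emeasure lborel (cball (0::real^'n) 2)"
    using equator_cylinder_bounded[OF assms] by (intro emeasure_mono) auto
  also have "\<dots> < \<infinity>" by (rule emeasure_lborel_cball_finite)
  finally show "emeasure (equator_measure x) (space (equator_measure x)) \<noteq> \<infinity>"
    by (simp add: emeasure_equator_measure ennreal_mult_eq_top_iff)
qed

lemma equator_measure_pos:
  fixes x :: "real ^ 'n"
  assumes x: "norm x = 1" and n: "CARD('n) \<ge> 2"
  shows "measure (equator_measure x) UNIV > 0"
proof -
  interpret finite_measure "equator_measure x" by (rule finite_measure_equator[OF x])
  have xx: "x \<bullet> x = 1" using x by (simp add: norm_eq_1)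
  \<comment> \<open>The midpoint of the axis has distance 1/2 from both end faces of the cylinder
    and 1 from its lateral surface, so a ball of radius 1/4 fits.\<close>
  have sub: "ball (x /\<^sub>R 2) (1/4) \<subseteq> {y \<in> equator_cylinder x. sgn (y - (y \<bullet> x) *\<^sub>R x) \<in> UNIV}"
  proof
    fix y assume y: "y \<in> ball (x /\<^sub>R 2) (1/4)"
    define z where "z = y - x /\<^sub>R 2"
    have z: "norm z < 1/4" using y by (simp add: z_def dist_norm norm_minus_commute)
    have y': "y = z + x /\<^sub>R 2" by (simp add: z_def)
    have zx: "\<bar>z \<bullet> x\<bar> < 1/4" using Cauchy_Schwarz_ineq2[of z x] z x by simp
    have "norm (y - (y \<bullet> x) *\<^sub>R x) = norm (z - (z \<bullet> x) *\<^sub>R x)"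
      by (simp add: y' inner_add_left xx scaleR_add_left)
    also have "\<dots> \<le> norm z + norm ((z \<bullet> x) *\<^sub>R x)" by (rule norm_triangle_ineq4)
    also have "\<dots> \<le> 1" using z zx x by simp
    finally show "y \<in> {y \<in> equator_cylinder x. sgn (y - (y \<bullet> x) *\<^sub>R x) \<in> UNIV}"
      using zx by (auto simp: equator_cylinder_def y' inner_add_left xx)
  qed
  have "emeasure lborel (ball (x /\<^sub>R 2) (1/4)) \<noteq> 0"
    using content_ball_pos[of "1/4" "x /\<^sub>R 2"] by (auto simp: measure_def)
  moreover have "emeasure lborel (ball (x /\<^sub>R 2) (1/4)) \<le> emeasure lborel {y \<in> equator_cylinder x. sgn (y - (y \<bullet> x) *\<^sub>R x) \<in> UNIV}"
    by (intro emeasure_mono sub) auto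
  ultimately have "emeasure (equator_measure x) UNIV \<noteq> 0"
    using n by (auto simp: emeasure_equator_measure)
  then show ?thesis
    by (simp add: emeasure_eq_measure zero_less_measure_iff)
qed

text \<open>The radial projection fails only on the axis, where \<open>sgn\<close> gives 0, and a
  line is negligible in dimension at least 2. As the measure is defined on the whole space, unit
  length and orthogonality to x are available only almost everywhere.\<close>

lemma AE_equator_measure:
  fixes x :: "real ^ 'n"
  assumes x: "norm x = 1" and n: "CARD('n) \<ge> 2"
  shows "AE \<omega> in equator_measure x. norm \<omega> = 1 \<and> \<omega> \<bullet> x = 0"
proof -
  have xx: "x \<bullet> x = 1" using x by (simp add: norm_eq_1)
  let ?N = "{\<omega>. \<not> (norm \<omega> = 1 \<and> \<omega> \<bullet> x = 0)}"
  have sub: "{y \<in> equator_cylinder x. sgn (y - (y \<bullet> x) *\<^sub>R x) \<in> ?N} \<subseteq> span {x}"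
  proof
    fix y assume y: "y \<in> {y \<in> equator_cylinder x. sgn (y - (y \<bullet> x) *\<^sub>R x) \<in> ?N}"
    have "y - (y \<bullet> x) *\<^sub>R x = 0"
    proof (rule ccontr)
      assume "y - (y \<bullet> x) *\<^sub>R x \<noteq> 0"
      moreover have "(y - (y \<bullet> x) *\<^sub>R x) \<bullet> x = 0" by (simp add: inner_diff_left xx)
      ultimately show False using y by (auto simp: sgn_div_norm)
    qed
    then show "y \<in> span {x}" by (metis eq_iff_diff_eq_0 span_base span_scale singletonI)
  qed
  have "dim {x} \<le> 1" using dim_le_card'[of "{x}"] by simp
  then have "negligible (span {x})"
    using n by (intro negligible_lowdim) simp
  then have "span {x} \<in> null_sets lebesgue" by (simp add: negligible_iff_null_sets)
  then have "span {x} \<in> null_sets lborel"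
    using closed_subspace[OF subspace_span[of "{x}"]] by (auto simp: null_sets_def null_sets_completion_iff)
  then have "emeasure lborel {y \<in> equator_cylinder x. sgn (y - (y \<bullet> x) *\<^sub>R x) \<in> ?N} = 0"
    using sub null_sets_subset[of "span {x}" lborel "{y \<in> equator_cylinder x. sgn (y - (y \<bullet> x) *\<^sub>R x) \<in> ?N}"]
    by (auto simp: null_sets_def)
  then have "emeasure (equator_measure x) ?N = 0"
    by (subst emeasure_equator_measure) auto
  then show ?thesis
    by (intro AE_I[of _ _ ?N]) auto
qed

text \<open>T commutes with the projection along x and with \<open>sgn\<close>, and it preserves the
  cylinder, so the invariance of Lebesgue measure carries over.\<close>

lemma equator_measure_invariant:
  fixes x :: "real ^ 'n"
  assumes T: "orthogonal_transformation T" and Tx: "T x = x"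
  shows "distr (equator_measure x) borel T = equator_measure x"
proof (rule measure_eqI)
  fix A assume "A \<in> sets (distr (equator_measure x) borel T)"
  then have A [measurable]: "A \<in> sets borel" by simp
  have lin: "linear T" using T orthogonal_transformation by blast
  have [measurable]: "T \<in> borel_measurable borel"
    by (rule borel_measurable_continuous_onI[OF linear_continuous_on[OF linear_conv_bounded_linear[THEN iffD1, OF lin]]])
  have inner: "T y \<bullet> x = y \<bullet> x" for y using T Tx unfolding orthogonal_transformation_def by metis
  have proj: "T (y - (y \<bullet> x) *\<^sub>R x) = T y - (T y \<bullet> x) *\<^sub>R x" for y
    by (simp add: linear_diff[OF lin] linear_scale[OF lin] Tx inner)
  have nT: "norm (T y) = norm y" for y using T by (simp add: orthogonal_transformation)
  have sgnT: "T (sgn y) = sgn (T y)" for y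
    by (simp add: sgn_div_norm linear_scale[OF lin] nT)
  have cyl: "T y \<in> equator_cylinder x \<longleftrightarrow> y \<in> equator_cylinder x" for y
    using proj[of y] nT[of "y - (y \<bullet> x) *\<^sub>R x"] by (simp add: equator_cylinder_def inner)
  let ?E = "{y \<in> equator_cylinder x. sgn (y - (y \<bullet> x) *\<^sub>R x) \<in> A}"
  have E: "?E \<in> sets borel" by measurable
  have "emeasure (distr (equator_measure x) borel T) A = emeasure (equator_measure x) (T -` A)"
    by (subst emeasure_distr) auto
  also have "\<dots> = of_nat (CARD('n) - 1) * emeasure lborel {y \<in> equator_cylinder x. sgn (y - (y \<bullet> x) *\<^sub>R x) \<in> T -` A}"
    by (rule emeasure_equator_measure) (use measurable_sets[of T borel borel A] in simp)
  also have "{y \<in> equator_cylinder x. sgn (y - (y \<bullet> x) *\<^sub>R x) \<in> T -` A} = T -` ?E \<inter> space lborel"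
    by (auto simp: cyl sgnT proj)
  also have "emeasure lborel (T -` ?E \<inter> space lborel) = emeasure (distr lborel borel T) ?E"
    using E by (subst emeasure_distr) auto
  also have "\<dots> = emeasure lborel ?E" by (simp add: lborel_distr_orthogonal[OF T])
  also have "of_nat (CARD('n) - 1) * \<dots> = emeasure (equator_measure x) A"
    by (rule emeasure_equator_measure[symmetric]) simp
  finally show "emeasure (distr (equator_measure x) borel T) A = emeasure (equator_measure x) A" .
qed simp

lemma equator_integral_invariant:
  fixes f :: "real ^ 'n \<Rightarrow> complex"
  assumes T: "orthogonal_transformation T" and Tx: "T x = x" and f: "continuous_on UNIV f"
  shows "(\<integral>\<omega>. f (T \<omega>) \<partial>equator_measure x) = (\<integral>\<omega>. f \<omega> \<partial>equator_measure x)"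
proof -
  have lin: "linear T" using T orthogonal_transformation by blast
  have T': "T \<in> borel_measurable borel"
    by (rule borel_measurable_continuous_onI[OF linear_continuous_on[OF linear_conv_bounded_linear[THEN iffD1, OF lin]]])
  have "(\<integral>\<omega>. f \<omega> \<partial>distr (equator_measure x) borel T) = (\<integral>\<omega>. f (T \<omega>) \<partial>equator_measure x)"
    by (rule integral_distr) (use T' borel_measurable_continuous_onI[OF f] in auto)
  then show ?thesis by (simp add: equator_measure_invariant[OF T Tx])
qed

lemma integrable_equator:
  fixes f :: "real ^ 'n \<Rightarrow> complex"
  assumes x: "norm x = 1" and n: "CARD('n) \<ge> 2" and f: "continuous_on UNIV f"
  shows "integrable (equator_measure x) f"
proof -
  interpret finite_measure "equator_measure x" by (rule finite_measure_equator[OF x])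
  have "bounded (f ` cball 0 1)"
    by (intro compact_imp_bounded compact_continuous_image continuous_on_subset[OF f]) auto
  then obtain B where B: "\<And>\<omega>. norm \<omega> \<le> 1 \<Longrightarrow> norm (f \<omega>) \<le> B"
    unfolding bounded_iff by (metis dist_0_norm imageI mem_cball)
  show ?thesis
  proof (rule integrable_const_bound[where B = B])
    show "AE \<omega> in equator_measure x. norm (f \<omega>) \<le> B"
      using AE_equator_measure[OF x n] by eventually_elim (auto intro: B)
    show "f \<in> borel_measurable (equator_measure x)"
      using borel_measurable_continuous_onI[OF f] by simp
  qed
qed

lemma measurable_equatorI: "f \<in> borel_measurable borel \<Longrightarrow> f \<in> borel_measurable (equator_measure x)"
  by (simp cong: measurable_cong_sets)

section \<open>Infinitesimal rotations and the Casimir operator\<close>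

definition plane_rotation :: "'a::real_inner \<Rightarrow> 'a \<Rightarrow> real \<Rightarrow> 'a \<Rightarrow> 'a" where
  "plane_rotation b c \<theta> y = y + ((cos \<theta> - 1) * (b \<bullet> y) - sin \<theta> * (c \<bullet> y)) *\<^sub>R b + ((cos \<theta> - 1) * (c \<bullet> y) + sin \<theta> * (b \<bullet> y)) *\<^sub>R c"

text \<open>The rotation is the identity plus a correction inside the plane of b and c, and this
  correction changes the squared norm by a multiple of cos^2 + sin^2 - 1.\<close>

lemma orthogonal_plane_rotation:
  fixes b c :: "'a::euclidean_space"
  assumes "b \<bullet> b = 1" "c \<bullet> c = 1" "b \<bullet> c = 0"
  shows "orthogonal_transformation (plane_rotation b c \<theta>)"
  unfolding orthogonal_transformation
proof (intro conjI allI)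
  show "linear (plane_rotation b c \<theta>)"
    by (rule linearI) (simp_all add: plane_rotation_def inner_add_right algebra_simps)
  fix y
  let ?k = "cos \<theta> - 1" and ?s = "sin \<theta>" and ?B = "b \<bullet> y" and ?C = "c \<bullet> y"
  have cb: "c \<bullet> b = 0" using assms(3) by (simp add: inner_commute)
  have alg: "Y + 2 * ((k - 1) * B - s * C) * B + 2 * ((k - 1) * C + s * B) * C + ((k - 1) * B - s * C)\<^sup>2 + ((k - 1) * C + s * B)\<^sup>2
      = Y + (k\<^sup>2 + s\<^sup>2 - 1) * (B\<^sup>2 + C\<^sup>2)" for Y k s B C :: real
    by (simp add: power2_eq_square algebra_simps)
  have exp: "(y + r *\<^sub>R b + s *\<^sub>R c) \<bullet> (y + r *\<^sub>R b + s *\<^sub>R c) = y \<bullet> y + 2 * r * ?B + 2 * s * ?C + r\<^sup>2 + s\<^sup>2" for r s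
    by (simp only: inner_add_left inner_add_right inner_scaleR_left inner_scaleR_right assms cb inner_commute[of y b] inner_commute[of y c])
       (simp add: power2_eq_square algebra_simps)
  have "plane_rotation b c \<theta> y \<bullet> plane_rotation b c \<theta> y =
     y \<bullet> y + 2 * (?k * ?B - ?s * ?C) * ?B + 2 * (?k * ?C + ?s * ?B) * ?C + (?k * ?B - ?s * ?C)\<^sup>2 + (?k * ?C + ?s * ?B)\<^sup>2"
    unfolding plane_rotation_def by (rule exp)
  also have "\<dots> = y \<bullet> y + ((cos \<theta>)\<^sup>2 + (sin \<theta>)\<^sup>2 - 1) * (?B\<^sup>2 + ?C\<^sup>2)"
    by (rule alg)
  also have "\<dots> = y \<bullet> y" by simp
  finally show "norm (plane_rotation b c \<theta> y) = norm y"
    by (simp add: norm_eq)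
qed

lemma continuous_polynomial_function:
  fixes p :: "'a::euclidean_space \<Rightarrow> complex"
  assumes "polynomial_function p"
  shows "continuous_on S p"
  using continuous_on_polymonial_function assms by blast

text \<open>Invariance under the rotations in the plane of \<open>b\<close> and \<open>c\<close>, differentiated at angle 0.\<close>

lemma equator_rotation_first_order:
  fixes x :: "real ^ 'n" and p :: "real ^ 'n \<Rightarrow> complex"
  assumes x: "norm x = 1" and n: "CARD('n) \<ge> 2" and p: "polynomial_function p"
    and bc: "b \<bullet> b = 1" "c \<bullet> c = 1" "b \<bullet> c = 0" "b \<bullet> x = 0" "c \<bullet> x = 0"
  shows "(\<integral>\<omega>. (b \<bullet> (x + \<rho> *\<^sub>R \<omega>)) *\<^sub>R dird p c (x + \<rho> *\<^sub>R \<omega>) - (c \<bullet> (x + \<rho> *\<^sub>R \<omega>)) *\<^sub>R dird p b (x + \<rho> *\<^sub>R \<omega>) \<partial>equator_measure x) = 0"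
    (is "integral\<^sup>L ?M ?G = 0")
proof -
  interpret finite_measure ?M by (rule finite_measure_equator[OF x])
  let ?R = "plane_rotation b c"
  let ?F = "\<lambda>\<theta> \<omega>. p (x + \<rho> *\<^sub>R ?R \<theta> \<omega>)"
  have Rx: "?R \<theta> x = x" for \<theta> using bc by (simp add: plane_rotation_def)
  have T: "orthogonal_transformation (?R \<theta>)" for \<theta> by (rule orthogonal_plane_rotation[OF bc(1-3)])
  have cont: "continuous_on UNIV (\<lambda>\<omega>. p (x + \<rho> *\<^sub>R \<omega>))"
    by (rule continuous_on_compose2[OF continuous_polynomial_function[OF p, of UNIV]]) (auto intro!: continuous_intros)
  have contF: "continuous_on UNIV (?F \<theta>)" for \<theta>
    unfolding plane_rotation_def
    by (rule continuous_on_compose2[OF continuous_polynomial_function[OF p, of UNIV]]) (auto intro!: continuous_intros)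
  have const: "(\<integral>\<omega>. ?F \<theta> \<omega> \<partial>?M) = (\<integral>\<omega>. ?F 0 \<omega> \<partial>?M)" for \<theta>
    using equator_integral_invariant[OF T Rx cont, of \<theta>] equator_integral_invariant[OF T Rx cont, of 0] by simp
  \<comment> \<open>Coordinates along b and c of the velocity of \<rho> times the rotated
    vector.\<close>
  define u v where "u \<theta> \<omega> = \<rho> * (- sin \<theta> * (b \<bullet> \<omega>) - cos \<theta> * (c \<bullet> \<omega>))"
    and "v \<theta> \<omega> = \<rho> * (- sin \<theta> * (c \<bullet> \<omega>) + cos \<theta> * (b \<bullet> \<omega>))" for \<theta> \<omega>
  let ?D = "\<lambda>\<theta> \<omega>. u \<theta> \<omega> *\<^sub>R dird p b (x + \<rho> *\<^sub>R ?R \<theta> \<omega>) + v \<theta> \<omega> *\<^sub>R dird p c (x + \<rho> *\<^sub>R ?R \<theta> \<omega>)"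
  have deriv: "((\<lambda>\<theta>. ?F \<theta> \<omega>) has_vector_derivative ?D \<theta> \<omega>) (at \<theta>)" for \<theta> \<omega>
  proof -
    have "((\<lambda>\<theta>. x + \<rho> *\<^sub>R ?R \<theta> \<omega>) has_vector_derivative u \<theta> \<omega> *\<^sub>R b + v \<theta> \<omega> *\<^sub>R c) (at \<theta>)"
      unfolding plane_rotation_def u_def v_def
      by (auto intro!: derivative_eq_intros simp: algebra_simps)
    then have "((\<lambda>\<theta>. ?F \<theta> \<omega>) has_derivative (\<lambda>h. dird p (h *\<^sub>R (u \<theta> \<omega> *\<^sub>R b + v \<theta> \<omega> *\<^sub>R c)) (x + \<rho> *\<^sub>R ?R \<theta> \<omega>))) (at \<theta>)"
      unfolding has_vector_derivative_def
      by (rule has_derivative_compose) (rule polynomial_function_derivative(1)[OF p])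
    then show ?thesis
      unfolding has_vector_derivative_def linear_scale[OF linear_dird[OF p]] linear_add[OF linear_dird[OF p]] .
  qed
  have "\<exists>K. \<forall>z\<in>cball 0 (1 + \<bar>\<rho>\<bar>). norm (dird p e z) \<le> K" for e
  proof -
    have "bounded (dird p e ` cball 0 (1 + \<bar>\<rho>\<bar>))"
      by (intro compact_imp_bounded compact_continuous_image continuous_polynomial_function polynomial_function_derivative(2)[OF p]) simp
    then show ?thesis by (auto simp: bounded_iff)
  qed
  then obtain K where K: "\<And>e z. z \<in> cball 0 (1 + \<bar>\<rho>\<bar>) \<Longrightarrow> norm (dird p e z) \<le> K e" by metis
  define L where "L = 2 * \<bar>\<rho>\<bar> * K b + 2 * \<bar>\<rho>\<bar> * K c"
  have Dle: "norm (?D \<theta> \<omega>) \<le> L" if w: "norm \<omega> = 1" for \<theta> \<omega>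
  proof -
    have "norm (x + \<rho> *\<^sub>R ?R \<theta> \<omega>) \<le> norm x + norm (\<rho> *\<^sub>R ?R \<theta> \<omega>)" by (rule norm_triangle_ineq)
    also have "\<dots> = 1 + \<bar>\<rho>\<bar>" using T[of \<theta>] w x by (simp add: orthogonal_transformation)
    finally have z: "x + \<rho> *\<^sub>R ?R \<theta> \<omega> \<in> cball 0 (1 + \<bar>\<rho>\<bar>)" by simp
    have b1: "\<bar>b \<bullet> \<omega>\<bar> \<le> 1" "\<bar>c \<bullet> \<omega>\<bar> \<le> 1"
      using Cauchy_Schwarz_ineq2[of b \<omega>] Cauchy_Schwarz_ineq2[of c \<omega>] w bc(1,2) by (simp_all add: norm_eq_1[symmetric])
    have 1: "\<bar>s * y\<bar> \<le> 1" if "\<bar>s\<bar> \<le> 1" "\<bar>y\<bar> \<le> 1" for s y :: real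
      unfolding abs_mult using mult_mono[OF that] by simp
    have uv: "\<bar>u \<theta> \<omega>\<bar> \<le> 2 * \<bar>\<rho>\<bar>" "\<bar>v \<theta> \<omega>\<bar> \<le> 2 * \<bar>\<rho>\<bar>"
    proof -
      have "\<bar>- sin \<theta> * (b \<bullet> \<omega>) - cos \<theta> * (c \<bullet> \<omega>)\<bar> \<le> 2" "\<bar>- sin \<theta> * (c \<bullet> \<omega>) + cos \<theta> * (b \<bullet> \<omega>)\<bar> \<le> 2"
        using 1[of "sin \<theta>" "b \<bullet> \<omega>"] 1[of "cos \<theta>" "c \<bullet> \<omega>"] 1[of "sin \<theta>" "c \<bullet> \<omega>"] 1[of "cos \<theta>" "b \<bullet> \<omega>"] b1 by auto
      then show "\<bar>u \<theta> \<omega>\<bar> \<le> 2 * \<bar>\<rho>\<bar>" "\<bar>v \<theta> \<omega>\<bar> \<le> 2 * \<bar>\<rho>\<bar>"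
        unfolding u_def v_def abs_mult by (auto simp: mult.commute[of 2] intro!: mult_left_mono)
    qed
    have "norm (?D \<theta> \<omega>) \<le> \<bar>u \<theta> \<omega>\<bar> * norm (dird p b (x + \<rho> *\<^sub>R ?R \<theta> \<omega>)) + \<bar>v \<theta> \<omega>\<bar> * norm (dird p c (x + \<rho> *\<^sub>R ?R \<theta> \<omega>))"
      by (rule order_trans[OF norm_triangle_ineq]) simp
    also have "\<dots> \<le> L"
      unfolding L_def using uv K[OF z] by (intro add_mono mult_mono) auto
    finally show ?thesis .
  qed
  \<comment> \<open>The mean value bound dominates all difference quotients by one constant,
    uniformly on the unit sphere.\<close>
  have lip: "norm ((?F h \<omega> - ?F 0 \<omega>) / of_real h) \<le> L" if w: "norm \<omega> = 1" and h: "h \<noteq> 0" for h \<omega>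
  proof -
    have "norm (?F h \<omega> - ?F 0 \<omega>) \<le> L * norm (h - 0)"
    proof (rule differentiable_bound[where S = UNIV and f' = "\<lambda>\<theta> h. h *\<^sub>R ?D \<theta> \<omega>"])
      show "((\<lambda>\<theta>. ?F \<theta> \<omega>) has_derivative (\<lambda>h. h *\<^sub>R ?D \<theta> \<omega>)) (at \<theta> within UNIV)" for \<theta>
        using deriv by (simp add: has_vector_derivative_def)
      show "onorm (\<lambda>h. h *\<^sub>R ?D \<theta> \<omega>) \<le> L" for \<theta>
      proof (rule onorm_le)
        fix h :: real
        show "norm (h *\<^sub>R ?D \<theta> \<omega>) \<le> L * norm h"
          using mult_left_mono[OF Dle[OF w, of \<theta>], of "\<bar>h\<bar>"] unfolding norm_scaleR by (simp only: mult.commute real_norm_def abs_ge_zero)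
      qed
    qed auto
    then show ?thesis using h by (simp add: norm_divide field_simps)
  qed
  have lim: "((\<lambda>h. (?F h \<omega> - ?F 0 \<omega>) / of_real h) \<longlongrightarrow> ?D 0 \<omega>) (at 0)" for \<omega>
  proof -
    have "((\<lambda>h. norm (?F (0 + h) \<omega> - ?F 0 \<omega> - h *\<^sub>R ?D 0 \<omega>) / norm h) \<longlongrightarrow> 0) (at 0)"
      using deriv[of \<omega> 0] unfolding has_vector_derivative_def has_derivative_at by blast
    moreover have "eventually (\<lambda>h. norm (?F (0 + h) \<omega> - ?F 0 \<omega> - h *\<^sub>R ?D 0 \<omega>) / norm h =
        norm ((?F h \<omega> - ?F 0 \<omega>) / of_real h - ?D 0 \<omega>)) (at 0)"
    proof -
      have "norm (f - h *\<^sub>R d) / norm h = norm (f / of_real h - d)" if "h \<noteq> 0" for h :: real and f d :: complex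
      proof -
        have "f / of_real h - d = (f - h *\<^sub>R d) / of_real h"
          using that by (simp add: scaleR_conv_of_real field_simps)
        then show ?thesis by (simp add: norm_divide)
      qed
      then show ?thesis by (simp add: eventually_at_filter)
    qed
    ultimately have "((\<lambda>h. norm ((?F h \<omega> - ?F 0 \<omega>) / of_real h - ?D 0 \<omega>)) \<longlongrightarrow> 0) (at 0)"
      by (rule Lim_transform_eventually)
    then show ?thesis
      by (rule LIM_zero_cancel[OF tendsto_norm_zero_cancel])
  qed
  have "((\<lambda>h. \<integral>\<omega>. (?F h \<omega> - ?F 0 \<omega>) / of_real h \<partial>?M) \<longlongrightarrow> (\<integral>\<omega>. ?D 0 \<omega> \<partial>?M)) (at 0)"
  proof (rule tendsto_integral_dominated_at[where w = "\<lambda>_. L" and d = 1])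
    show "(\<lambda>\<omega>. (?F h \<omega> - ?F 0 \<omega>) / of_real h) \<in> borel_measurable ?M" for h
      using borel_measurable_continuous_onI[OF contF] by (intro borel_measurable_divide borel_measurable_diff) auto
    have cD: "continuous_on UNIV (\<lambda>\<omega>. dird p e (x + \<rho> *\<^sub>R ?R 0 \<omega>))" for e
      unfolding plane_rotation_def
      by (rule continuous_on_compose2[OF continuous_polynomial_function[OF polynomial_function_derivative(2)[OF p], of UNIV]]) (auto intro!: continuous_intros)
    have "continuous_on UNIV (?D 0)"
      unfolding u_def v_def by (intro continuous_intros cD)
    then show "?D 0 \<in> borel_measurable ?M"
      by (rule measurable_equatorI[OF borel_measurable_continuous_onI])
    fix h :: real assume "h \<noteq> 0"
    then show "AE \<omega> in ?M. norm ((?F h \<omega> - ?F 0 \<omega>) / of_real h) \<le> L"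
      using AE_equator_measure[OF x n] lip by (auto elim!: eventually_mono)
  qed (auto simp: lim)
  moreover have zero: "(\<integral>\<omega>. (?F h \<omega> - ?F 0 \<omega>) / of_real h \<partial>?M) = 0" for h
    unfolding integral_divide_zero
    by (simp add: Bochner_Integration.integral_diff[OF integrable_equator[OF x n contF] integrable_equator[OF x n contF]] const[of h])
  ultimately have "((\<lambda>h::real. 0) \<longlongrightarrow> (\<integral>\<omega>. ?D 0 \<omega> \<partial>?M)) (at 0)"
    by (simp only: zero)
  then have "(\<integral>\<omega>. ?D 0 \<omega> \<partial>?M) = 0"
    by (simp only: tendsto_const_iff[OF at_neq_bot])
  \<comment> \<open>At angle 0 the rotation is the identity, and since b and c are orthogonal to x,
    their inner products with x + \<rho> \<omega> are \<rho> times those with \<omega>.\<close>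
  moreover have "?D 0 = ?G"
    using bc by (auto simp: fun_eq_iff u_def v_def plane_rotation_def inner_add_right)
  ultimately show ?thesis by simp
qed

text \<open>The first-order identity applied to \<open>q\<close>, the infinitesimal rotation of p in
  the plane of b and c; the integrand is the square of that operator applied to p.\<close>

lemma equator_rotation_second_order:
  fixes x :: "real ^ 'n" and p :: "real ^ 'n \<Rightarrow> complex"
  assumes x: "norm x = 1" and n: "CARD('n) \<ge> 2" and p: "polynomial_function p"
    and bc: "b \<bullet> b = 1" "c \<bullet> c = 1" "b \<bullet> c = 0" "b \<bullet> x = 0" "c \<bullet> x = 0"
  shows "(\<integral>\<omega>. of_real (\<rho>\<^sup>2 * (b \<bullet> \<omega>)\<^sup>2) * dird (dird p c) c (x + \<rho> *\<^sub>R \<omega>)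
      - of_real (\<rho>\<^sup>2 * (b \<bullet> \<omega>) * (c \<bullet> \<omega>)) * dird (dird p b) c (x + \<rho> *\<^sub>R \<omega>)
      - of_real (\<rho> * (b \<bullet> \<omega>)) * dird p b (x + \<rho> *\<^sub>R \<omega>)
      - of_real (\<rho>\<^sup>2 * (b \<bullet> \<omega>) * (c \<bullet> \<omega>)) * dird (dird p c) b (x + \<rho> *\<^sub>R \<omega>)
      - of_real (\<rho> * (c \<bullet> \<omega>)) * dird p c (x + \<rho> *\<^sub>R \<omega>)
      + of_real (\<rho>\<^sup>2 * (c \<bullet> \<omega>)\<^sup>2) * dird (dird p b) b (x + \<rho> *\<^sub>R \<omega>) \<partial>equator_measure x) = 0"
proof -
  note pd = polynomial_function_derivative(2)[OF p]
  define q where "q y = (b \<bullet> y) *\<^sub>R dird p c y - (c \<bullet> y) *\<^sub>R dird p b y" for y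
  have q: "polynomial_function q"
    unfolding q_def[abs_def] by (intro polynomial_function_diff polynomial_function_inner_times pd)
  have dq: "dird q v y = ((b \<bullet> y) *\<^sub>R dird (dird p c) v y + (b \<bullet> v) *\<^sub>R dird p c y)
     - ((c \<bullet> y) *\<^sub>R dird (dird p b) v y + (c \<bullet> v) *\<^sub>R dird p b y)" for v y
    unfolding q_def[abs_def]
      dird_diff[OF polynomial_function_inner_times[OF pd] polynomial_function_inner_times[OF pd]]
      dird_inner_times[OF pd] ..
  have cb: "c \<bullet> b = 0" using bc by (simp add: inner_commute)
  have y: "b \<bullet> (x + \<rho> *\<^sub>R \<omega>) = \<rho> * (b \<bullet> \<omega>)" "c \<bullet> (x + \<rho> *\<^sub>R \<omega>) = \<rho> * (c \<bullet> \<omega>)" for \<omega>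
    using bc by (simp_all add: inner_add_right)
  show ?thesis
    using equator_rotation_first_order[OF x n q bc, of \<rho>]
    unfolding dq y bc cb
    by (rule trans[rotated], intro Bochner_Integration.integral_cong refl)
       (simp add: scaleR_conv_of_real power2_eq_square algebra_simps)
qed

text \<open>The algebra of adding squared infinitesimal rotations over ordered pairs, whence the
  factor 2. On the diagonal only first-order terms survive; leaving them out lowers
  \<open>card B\<close> to \<open>card B - 1\<close> in the radial coefficient.\<close>

lemma double_sum_identity:
  fixes \<beta> q :: "'b \<Rightarrow> complex" and P :: "'b \<Rightarrow> 'b \<Rightarrow> complex"
  assumes "finite B"
  shows "(\<Sum>b\<in>B. \<Sum>c\<in>B - {b}. r\<^sup>2 * (\<beta> b)\<^sup>2 * P c c - r\<^sup>2 * \<beta> b * \<beta> c * P b c - r * \<beta> b * q b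
      - r\<^sup>2 * \<beta> b * \<beta> c * P c b - r * \<beta> c * q c + r\<^sup>2 * (\<beta> c)\<^sup>2 * P b b) =
    2 * (r\<^sup>2 * (\<Sum>b\<in>B. (\<beta> b)\<^sup>2) * (\<Sum>b\<in>B. P b b) - r\<^sup>2 * (\<Sum>b\<in>B. \<Sum>c\<in>B. \<beta> b * \<beta> c * P b c)
      - (of_nat (card B) - 1) * r * (\<Sum>b\<in>B. \<beta> b * q b))"
proof -
  let ?t = "\<lambda>b c. r\<^sup>2 * (\<beta> b)\<^sup>2 * P c c - r\<^sup>2 * \<beta> b * \<beta> c * P b c - r * \<beta> b * q b
      - r\<^sup>2 * \<beta> b * \<beta> c * P c b - r * \<beta> c * q c + r\<^sup>2 * (\<beta> c)\<^sup>2 * P b b"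
  have "(\<Sum>c\<in>B - {b}. ?t b c) = (\<Sum>c\<in>B. ?t b c) + 2 * r * (\<beta> b * q b)" if "b \<in> B" for b
    using that assms by (subst sum_diff1) (auto simp: power2_eq_square)
  then have "(\<Sum>b\<in>B. \<Sum>c\<in>B - {b}. ?t b c) = (\<Sum>b\<in>B. \<Sum>c\<in>B. ?t b c) + 2 * r * (\<Sum>b\<in>B. \<beta> b * q b)"
    by (simp add: sum.distrib sum_distrib_left)
  also have "(\<Sum>b\<in>B. \<Sum>c\<in>B. ?t b c) =
     (\<Sum>b\<in>B. \<Sum>c\<in>B. r\<^sup>2 * (\<beta> b)\<^sup>2 * P c c) - (\<Sum>b\<in>B. \<Sum>c\<in>B. r\<^sup>2 * \<beta> b * \<beta> c * P b c) - (\<Sum>b\<in>B. \<Sum>c\<in>B. r * \<beta> b * q b)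
     - (\<Sum>b\<in>B. \<Sum>c\<in>B. r\<^sup>2 * \<beta> b * \<beta> c * P c b) - (\<Sum>b\<in>B. \<Sum>c\<in>B. r * \<beta> c * q c) + (\<Sum>b\<in>B. \<Sum>c\<in>B. r\<^sup>2 * (\<beta> c)\<^sup>2 * P b b)"
    by (simp add: sum.distrib sum_subtractf)
  also have "(\<Sum>b\<in>B. \<Sum>c\<in>B. r\<^sup>2 * \<beta> b * \<beta> c * P c b) = (\<Sum>b\<in>B. \<Sum>c\<in>B. r\<^sup>2 * \<beta> b * \<beta> c * P b c)"
    by (subst sum.swap) (simp add: mult_ac)
  also have "(\<Sum>b\<in>B. \<Sum>c\<in>B. r\<^sup>2 * (\<beta> c)\<^sup>2 * P b b) = (\<Sum>b\<in>B. \<Sum>c\<in>B. r\<^sup>2 * (\<beta> b)\<^sup>2 * P c c)"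
    by (rule sum.swap)
  also have "(\<Sum>b\<in>B. \<Sum>c\<in>B. r\<^sup>2 * (\<beta> b)\<^sup>2 * P c c) = r\<^sup>2 * (\<Sum>b\<in>B. (\<beta> b)\<^sup>2) * (\<Sum>b\<in>B. P b b)"
    unfolding mult.assoc sum_product by (simp only: sum_distrib_left)
  also have "(\<Sum>b\<in>B. \<Sum>c\<in>B. r\<^sup>2 * \<beta> b * \<beta> c * P b c) = r\<^sup>2 * (\<Sum>b\<in>B. \<Sum>c\<in>B. \<beta> b * \<beta> c * P b c)"
    by (simp add: sum_distrib_left mult.assoc)
  also have "(\<Sum>b\<in>B. \<Sum>c\<in>B. r * \<beta> b * q b) = of_nat (card B) * r * (\<Sum>b\<in>B. \<beta> b * q b)"
    by (simp add: sum_distrib_left mult.assoc)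
  also have "(\<Sum>b\<in>B. \<Sum>c\<in>B. r * \<beta> c * q c) = of_nat (card B) * r * (\<Sum>b\<in>B. \<beta> b * q b)"
    by (simp add: sum_distrib_left mult.assoc)
  finally show ?thesis by (simp add: algebra_simps)
qed

lemma continuous_on_shifted_polynomial:
  fixes p :: "'a::euclidean_space \<Rightarrow> complex"
  assumes "polynomial_function p"
  shows "continuous_on UNIV (\<lambda>\<omega>. p (x + \<rho> *\<^sub>R \<omega>))"
  by (rule continuous_on_compose2[OF continuous_polynomial_function[OF assms, of UNIV]]) (auto intro!: continuous_intros)

text \<open>The direction moves with the variable of integration, so continuity is read off from the
  expansion in the standard basis.\<close>

lemma continuous_on_dird2_diag:
  fixes p :: "'a::euclidean_space \<Rightarrow> complex"
  assumes p: "polynomial_function p"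
  shows "continuous_on UNIV (\<lambda>\<omega>. dird p \<omega> (x + \<rho> *\<^sub>R \<omega>))"
    and "continuous_on UNIV (\<lambda>\<omega>. dird (dird p \<omega>) \<omega> (x + \<rho> *\<^sub>R \<omega>))"
proof -
  note pd = polynomial_function_derivative(2)[OF p]
  have exp: "\<omega> = (\<Sum>b\<in>Basis. (\<omega> \<bullet> b) *\<^sub>R b)" for \<omega> :: 'a by (simp add: euclidean_representation)
  have 1: "dird p \<omega> y = (\<Sum>b\<in>Basis. (\<omega> \<bullet> b) *\<^sub>R dird p b y)" for \<omega> y
    using dird_sum[OF p, of "\<lambda>b. \<omega> \<bullet> b" Basis y] by (simp flip: exp)
  have c1: "continuous_on UNIV (\<lambda>\<omega>. \<Sum>b\<in>Basis. (\<omega> \<bullet> b) *\<^sub>R dird p b (x + \<rho> *\<^sub>R \<omega>))"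
    by (intro continuous_on_sum continuous_on_scaleR continuous_on_inner continuous_on_id continuous_on_const
        continuous_on_shifted_polynomial pd)
  show "continuous_on UNIV (\<lambda>\<omega>. dird p \<omega> (x + \<rho> *\<^sub>R \<omega>))"
    using c1 unfolding 1[symmetric] .
  have 2: "dird (dird p v) \<omega> y = (\<Sum>c\<in>Basis. (\<omega> \<bullet> c) *\<^sub>R dird (dird p v) c y)" for \<omega> y v
    using dird_sum[OF pd, of v "\<lambda>b. \<omega> \<bullet> b" Basis y] by (simp flip: exp)
  have 3: "dird (dird p \<omega>) \<omega> y = (\<Sum>b\<in>Basis. (\<omega> \<bullet> b) *\<^sub>R (\<Sum>c\<in>Basis. (\<omega> \<bullet> c) *\<^sub>R dird (dird p b) c y))" for \<omega> y
    using dird2_sum_left[OF p, of "\<lambda>b. \<omega> \<bullet> b" Basis \<omega> y] by (simp add: euclidean_representation flip: 2)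
  have c2: "continuous_on UNIV (\<lambda>\<omega>. \<Sum>b\<in>Basis. (\<omega> \<bullet> b) *\<^sub>R (\<Sum>c\<in>Basis. (\<omega> \<bullet> c) *\<^sub>R dird (dird p b) c (x + \<rho> *\<^sub>R \<omega>)))"
    by (intro continuous_on_sum continuous_on_scaleR continuous_on_inner continuous_on_id continuous_on_const
        continuous_on_shifted_polynomial polynomial_function_derivative(2)[OF pd])
  show "continuous_on UNIV (\<lambda>\<omega>. dird (dird p \<omega>) \<omega> (x + \<rho> *\<^sub>R \<omega>))"
    using c2 unfolding 3[symmetric] .
qed

lemma integral_eq_0_AE_sum:
  fixes g :: "'i \<Rightarrow> 'a \<Rightarrow> complex"
  assumes "finite I" "\<And>i. i \<in> I \<Longrightarrow> integrable M (g i)" "\<And>i. i \<in> I \<Longrightarrow> integral\<^sup>L M (g i) = 0"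
  shows "(\<integral>\<omega>. (\<Sum>i\<in>I. g i \<omega>) \<partial>M) = 0"
  using assms by (subst Bochner_Integration.integral_sum) auto

text \<open>The Casimir identity: on polynomials the squared infinitesimal rotations fixing \<open>x\<close> add up to
  \<open>\<rho>\<^sup>2 \<Delta>\<close> minus the radial part, for the Laplacian \<open>\<Delta>\<close> of the hyperplane orthogonal to \<open>x\<close>.\<close>

lemma equator_Casimir:
  fixes x :: "real ^ 'n" and p :: "real ^ 'n \<Rightarrow> complex"
  assumes x: "norm x = 1" and n: "CARD('n) \<ge> 2" and p: "polynomial_function p"
  shows "(\<integral>\<omega>. of_real (\<rho>\<^sup>2) * (laplacian p (x + \<rho> *\<^sub>R \<omega>) - dird (dird p x) x (x + \<rho> *\<^sub>R \<omega>)
      - dird (dird p \<omega>) \<omega> (x + \<rho> *\<^sub>R \<omega>)) - (of_nat CARD('n) - 2) * of_real \<rho> * dird p \<omega> (x + \<rho> *\<^sub>R \<omega>) \<partial>equator_measure x) = 0"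
proof -
  note pd = polynomial_function_derivative(2)[OF p]
  note pdd = polynomial_function_derivative(2)[OF pd]
  let ?M = "equator_measure x"
  have xx: "x \<bullet> x = 1" using x by (simp add: norm_eq_1)
  have sV: "subspace {v. x \<bullet> v = 0}" by (rule subspace_hyperplane)
  obtain B where B: "B \<subseteq> {v. x \<bullet> v = 0}" "pairwise orthogonal B" "\<And>b. b \<in> B \<Longrightarrow> norm b = 1" "independent B"
    "card B = dim {v. x \<bullet> v = 0}" "span B = {v. x \<bullet> v = 0}"
    using orthonormal_basis_subspace[OF sV] by blast
  have finB: "finite B" using B(4) by (rule independent_imp_finite)
  have "dim {v. x \<bullet> v = 0} = DIM(real^'n) - 1"
    using x by (intro dim_hyperplane) auto
  then have cardB: "of_nat (card B) = (of_nat CARD('n) - 1 :: complex)"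
    using n B(5) by (simp add: of_nat_diff)
  have bb: "b \<bullet> b = 1" and bx: "b \<bullet> x = 0" if "b \<in> B" for b
    using B(1) B(3)[OF that] that by (auto simp: norm_eq_1 inner_commute)
  have bc: "b \<bullet> c = 0" if "b \<in> B" "c \<in> B" "b \<noteq> c" for b c
    using B(2) that by (auto simp: pairwise_def orthogonal_def)
  have expB: "(\<Sum>b\<in>B. (v \<bullet> b) *\<^sub>R b) = v" if "v \<bullet> x = 0" for v
    using orthonormal_basis_expand[OF B(2,3) _ finB, of v] that B(6) by (simp add: inner_commute)
  have xB: "x \<notin> B" using bx xx by force
  have expxB: "(\<Sum>b\<in>insert x B. (v \<bullet> b) *\<^sub>R b) = v" for v
  proof -
    let ?w = "v - (v \<bullet> x) *\<^sub>R x"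
    have "?w \<bullet> x = 0" by (simp add: inner_diff_left xx)
    have "(\<Sum>b\<in>B. (v \<bullet> b) *\<^sub>R b) = (\<Sum>b\<in>B. (?w \<bullet> b) *\<^sub>R b)"
      by (intro sum.cong refl) (simp add: inner_diff_left bx inner_commute[of x])
    also have "\<dots> = ?w" using \<open>?w \<bullet> x = 0\<close> by (rule expB)
    finally show ?thesis using finB xB by simp
  qed
  \<comment> \<open>Together with x the set B is an orthonormal basis of the whole space, so the
    second derivative along x splits off from the Laplacian.\<close>
  have lap: "laplacian p y = dird (dird p x) x y + (\<Sum>b\<in>B. dird (dird p b) b y)" for y
    using sum_dird2_orthonormal[OF p, of "insert x B" y] expxB finB xB
    by (simp add: laplacian_polynomial[OF p])
  let ?y = "\<lambda>\<omega>. x + \<rho> *\<^sub>R \<omega>"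
  let ?r = "complex_of_real \<rho>"
  let ?\<beta> = "\<lambda>\<omega> b. complex_of_real (b \<bullet> \<omega>)"
  let ?t = "\<lambda>b c \<omega>. ?r\<^sup>2 * (?\<beta> \<omega> b)\<^sup>2 * dird (dird p c) c (?y \<omega>) - ?r\<^sup>2 * ?\<beta> \<omega> b * ?\<beta> \<omega> c * dird (dird p b) c (?y \<omega>)
      - ?r * ?\<beta> \<omega> b * dird p b (?y \<omega>) - ?r\<^sup>2 * ?\<beta> \<omega> b * ?\<beta> \<omega> c * dird (dird p c) b (?y \<omega>)
      - ?r * ?\<beta> \<omega> c * dird p c (?y \<omega>) + ?r\<^sup>2 * (?\<beta> \<omega> c)\<^sup>2 * dird (dird p b) b (?y \<omega>)"
  have ct: "continuous_on UNIV (?t b c)" for b c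
    by (intro continuous_on_add continuous_on_diff continuous_on_mult continuous_on_power continuous_on_of_real
        continuous_on_inner continuous_on_const continuous_on_id continuous_on_shifted_polynomial pd pdd)
  have it: "integrable ?M (?t b c)" for b c by (rule integrable_equator[OF x n ct])
  have zero: "(\<integral>\<omega>. ?t b c \<omega> \<partial>?M) = 0" if "b \<in> B" "c \<in> B" "b \<noteq> c" for b c
    using equator_rotation_second_order[OF x n p bb[OF that(1)] bb[OF that(2)] bc[OF that] bx[OF that(1)] bx[OF that(2)], of \<rho>]
    by (simp add: mult.assoc)
  have "(\<integral>\<omega>. (\<Sum>b\<in>B. \<Sum>c\<in>B - {b}. ?t b c \<omega>) \<partial>?M) = 0"
    by (intro integral_eq_0_AE_sum Bochner_Integration.integrable_sum it finB finite_Diff) (auto intro: zero)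
  \<comment> \<open>The sums over B collapse only for unit vectors orthogonal to x, hence almost
    everywhere.\<close>
  moreover have "AE \<omega> in ?M. (\<Sum>b\<in>B. \<Sum>c\<in>B - {b}. ?t b c \<omega>) =
     2 * (?r\<^sup>2 * (laplacian p (?y \<omega>) - dird (dird p x) x (?y \<omega>) - dird (dird p \<omega>) \<omega> (?y \<omega>))
        - (of_nat CARD('n) - 2) * ?r * dird p \<omega> (?y \<omega>))"
    using AE_equator_measure[OF x n]
  proof eventually_elim
    case (elim \<omega>)
    have w: "(\<Sum>b\<in>B. (\<omega> \<bullet> b) *\<^sub>R b) = \<omega>" using elim by (intro expB) simp
    have "1 = \<omega> \<bullet> (\<Sum>b\<in>B. (\<omega> \<bullet> b) *\<^sub>R b)" using elim by (simp add: w norm_eq_1)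
    also have "\<dots> = (\<Sum>b\<in>B. (b \<bullet> \<omega>)\<^sup>2)" by (simp add: inner_sum_right power2_eq_square inner_commute)
    finally have "(\<Sum>b\<in>B. (b \<bullet> \<omega>)\<^sup>2) = 1" ..
    then have "complex_of_real (\<Sum>b\<in>B. (b \<bullet> \<omega>)\<^sup>2) = 1" by (simp only: of_real_1)
    then have s1: "(\<Sum>b\<in>B. (?\<beta> \<omega> b)\<^sup>2) = 1" by (simp only: of_real_sum of_real_power)
    have s2: "(\<Sum>b\<in>B. ?\<beta> \<omega> b * dird p b (?y \<omega>)) = dird p \<omega> (?y \<omega>)"
      using dird_sum[OF p, of "\<lambda>b. \<omega> \<bullet> b" B "?y \<omega>"] unfolding w by (simp add: scaleR_conv_of_real[where 'a = complex] inner_commute)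
    have s3: "(\<Sum>c\<in>B. ?\<beta> \<omega> c * dird (dird p b) c (?y \<omega>)) = dird (dird p b) \<omega> (?y \<omega>)" for b
      using dird_sum[OF pd, of b "\<lambda>b. \<omega> \<bullet> b" B "?y \<omega>"] unfolding w by (simp add: scaleR_conv_of_real[where 'a = complex] inner_commute)
    have s4: "(\<Sum>b\<in>B. \<Sum>c\<in>B. ?\<beta> \<omega> b * ?\<beta> \<omega> c * dird (dird p b) c (?y \<omega>)) = dird (dird p \<omega>) \<omega> (?y \<omega>)"
    proof -
      have "(\<Sum>b\<in>B. \<Sum>c\<in>B. ?\<beta> \<omega> b * ?\<beta> \<omega> c * dird (dird p b) c (?y \<omega>)) =
          (\<Sum>b\<in>B. ?\<beta> \<omega> b * (\<Sum>c\<in>B. ?\<beta> \<omega> c * dird (dird p b) c (?y \<omega>)))"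
        by (simp only: sum_distrib_left mult.assoc)
      also have "\<dots> = (\<Sum>b\<in>B. (\<omega> \<bullet> b) *\<^sub>R dird (dird p b) \<omega> (?y \<omega>))"
        by (simp only: s3 scaleR_conv_of_real[where 'a = complex] inner_commute)
      also have "\<dots> = dird (dird p \<omega>) \<omega> (?y \<omega>)"
        using dird2_sum_left[OF p, of "\<lambda>b. \<omega> \<bullet> b" B \<omega> "?y \<omega>"] unfolding w ..
      finally show ?thesis .
    qed
    show ?case
      unfolding double_sum_identity[OF finB, of ?r "?\<beta> \<omega>" "\<lambda>b c. dird (dird p b) c (?y \<omega>)" "\<lambda>b. dird p b (?y \<omega>)"]
        s1 s2 s4 lap cardB by (simp add: algebra_simps)
  qed
  moreover have "(\<lambda>\<omega>. \<Sum>b\<in>B. \<Sum>c\<in>B - {b}. ?t b c \<omega>) \<in> borel_measurable ?M"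
    by (intro measurable_equatorI borel_measurable_continuous_onI continuous_on_sum ct)
  moreover have "continuous_on UNIV (\<lambda>\<omega>. 2 * (?r\<^sup>2 * (laplacian p (?y \<omega>) - dird (dird p x) x (?y \<omega>) - dird (dird p \<omega>) \<omega> (?y \<omega>))
        - (of_nat CARD('n) - 2) * ?r * dird p \<omega> (?y \<omega>)))"
    unfolding laplacian_polynomial[OF p]
    by (intro continuous_on_diff continuous_on_mult continuous_on_sum continuous_on_const
        continuous_on_shifted_polynomial pdd continuous_on_dird2_diag p)
  then have "(\<lambda>\<omega>. 2 * (?r\<^sup>2 * (laplacian p (?y \<omega>) - dird (dird p x) x (?y \<omega>) - dird (dird p \<omega>) \<omega> (?y \<omega>))
        - (of_nat CARD('n) - 2) * ?r * dird p \<omega> (?y \<omega>))) \<in> borel_measurable ?M"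
    by (intro measurable_equatorI borel_measurable_continuous_onI)
  ultimately have "(\<integral>\<omega>. 2 * (?r\<^sup>2 * (laplacian p (?y \<omega>) - dird (dird p x) x (?y \<omega>) - dird (dird p \<omega>) \<omega> (?y \<omega>))
        - (of_nat CARD('n) - 2) * ?r * dird p \<omega> (?y \<omega>)) \<partial>?M) = 0"
    by (subst integral_cong_AE[symmetric]) assumption+
  then show ?thesis
    unfolding integral_mult_right_zero mult_eq_0_iff of_real_power by simp
qed

section \<open>The averaged polynomial in the radius and its differential equation\<close>

lemma polynomial_function_line_family_real:
  fixes f :: "'a::real_normed_vector \<Rightarrow> real"
  assumes "real_polynomial_function f"
  shows "\<exists>(Q :: 'a \<Rightarrow> complex poly) N. (\<forall>\<omega> \<rho>. complex_of_real (f (x + \<rho> *\<^sub>R \<omega>)) = poly (Q \<omega>) (of_real \<rho>)) \<and>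
    (\<forall>\<omega>. degree (Q \<omega>) \<le> N) \<and> (\<forall>m. continuous_on UNIV (\<lambda>\<omega>. coeff (Q \<omega>) m))"
  using assms
proof induction
  case (linear f)
  have c: "continuous_on UNIV f" by (rule linear_continuous_on[OF linear])
  show ?case
  proof (intro exI conjI allI)
    show "complex_of_real (f (x + \<rho> *\<^sub>R \<omega>)) = poly [:of_real (f x), of_real (f \<omega>):] (of_real \<rho>)" for \<omega> \<rho>
      using linear by (simp add: bounded_linear.linear linear_add linear_scale)
    show "degree [:complex_of_real (f x), of_real (f \<omega>):] \<le> 1" for \<omega> by simp
    show "continuous_on UNIV (\<lambda>\<omega>. coeff [:complex_of_real (f x), of_real (f \<omega>):] m)" for m
    proof (cases m)
      case (Suc i)
      then show ?thesis by (cases i) (auto intro!: continuous_on_of_real c)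
    qed simp
  qed
next
  case (const c)
  show ?case
    by (intro exI[of _ "\<lambda>_. [:of_real c:]"] exI[of _ 0]) auto
next
  case (add f g)
  then obtain P Q N M where PQ: "\<And>\<omega> \<rho>. complex_of_real (f (x + \<rho> *\<^sub>R \<omega>)) = poly (P \<omega>) (of_real \<rho>)"
    "\<And>\<omega>. degree (P \<omega>) \<le> N" "\<And>m. continuous_on UNIV (\<lambda>\<omega>. coeff (P \<omega>) m)"
    "\<And>\<omega> \<rho>. complex_of_real (g (x + \<rho> *\<^sub>R \<omega>)) = poly (Q \<omega>) (of_real \<rho>)"
    "\<And>\<omega>. degree (Q \<omega>) \<le> M" "\<And>m. continuous_on UNIV (\<lambda>\<omega>. coeff (Q \<omega>) m)" by blast
  show ?case
  proof (intro exI conjI allI)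
    show "complex_of_real (f (x + \<rho> *\<^sub>R \<omega>) + g (x + \<rho> *\<^sub>R \<omega>)) = poly (P \<omega> + Q \<omega>) (of_real \<rho>)" for \<omega> \<rho>
      by (simp add: PQ)
    show "degree (P \<omega> + Q \<omega>) \<le> max N M" for \<omega>
      by (intro degree_add_le order_trans[OF PQ(2)] order_trans[OF PQ(5)]) auto
    show "continuous_on UNIV (\<lambda>\<omega>. coeff (P \<omega> + Q \<omega>) m)" for m
      unfolding coeff_add by (intro continuous_on_add PQ)
  qed
next
  case (mult f g)
  then obtain P Q N M where PQ: "\<And>\<omega> \<rho>. complex_of_real (f (x + \<rho> *\<^sub>R \<omega>)) = poly (P \<omega>) (of_real \<rho>)"
    "\<And>\<omega>. degree (P \<omega>) \<le> N" "\<And>m. continuous_on UNIV (\<lambda>\<omega>. coeff (P \<omega>) m)"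
    "\<And>\<omega> \<rho>. complex_of_real (g (x + \<rho> *\<^sub>R \<omega>)) = poly (Q \<omega>) (of_real \<rho>)"
    "\<And>\<omega>. degree (Q \<omega>) \<le> M" "\<And>m. continuous_on UNIV (\<lambda>\<omega>. coeff (Q \<omega>) m)" by blast
  show ?case
  proof (intro exI conjI allI)
    show "complex_of_real (f (x + \<rho> *\<^sub>R \<omega>) * g (x + \<rho> *\<^sub>R \<omega>)) = poly (P \<omega> * Q \<omega>) (of_real \<rho>)" for \<omega> \<rho>
      by (simp add: PQ)
    show "degree (P \<omega> * Q \<omega>) \<le> N + M" for \<omega>
      by (rule order_trans[OF degree_mult_le]) (intro add_mono PQ)
    show "continuous_on UNIV (\<lambda>\<omega>. coeff (P \<omega> * Q \<omega>) m)" for m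
      unfolding coeff_mult by (intro continuous_on_sum continuous_on_mult PQ)
  qed
qed

text \<open>Bounded degree and coefficients continuous in the direction allow integration over the
  equator coefficient by coefficient, so that the integral is again a polynomial in \<rho>.\<close>

lemma polynomial_function_line_family:
  fixes p :: "'a::real_normed_vector \<Rightarrow> complex"
  assumes "polynomial_function p"
  obtains Q :: "'a \<Rightarrow> complex poly" and N where "\<And>\<omega> \<rho>. p (x + \<rho> *\<^sub>R \<omega>) = poly (Q \<omega>) (of_real \<rho>)"
    "\<And>\<omega>. degree (Q \<omega>) \<le> N" "\<And>m. continuous_on UNIV (\<lambda>\<omega>. coeff (Q \<omega>) m)"
proof -
  obtain P N where P: "\<And>\<omega> \<rho>. complex_of_real (Re (p (x + \<rho> *\<^sub>R \<omega>))) = poly (P \<omega>) (of_real \<rho>)"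
    "\<And>\<omega>. degree (P \<omega>) \<le> N" "\<And>m. continuous_on UNIV (\<lambda>\<omega>. coeff (P \<omega>) m)"
    using polynomial_function_line_family_real[OF polynomial_function_Re_Im(1)[OF assms], of x] by blast
  obtain Q M where Q: "\<And>\<omega> \<rho>. complex_of_real (Im (p (x + \<rho> *\<^sub>R \<omega>))) = poly (Q \<omega>) (of_real \<rho>)"
    "\<And>\<omega>. degree (Q \<omega>) \<le> M" "\<And>m. continuous_on UNIV (\<lambda>\<omega>. coeff (Q \<omega>) m)"
    using polynomial_function_line_family_real[OF polynomial_function_Re_Im(2)[OF assms], of x] by blast
  show ?thesis
  proof (rule that[of "\<lambda>\<omega>. P \<omega> + Polynomial.smult \<i> (Q \<omega>)" "max N M"])
    show "p (x + \<rho> *\<^sub>R \<omega>) = poly (P \<omega> + Polynomial.smult \<i> (Q \<omega>)) (of_real \<rho>)" for \<omega> \<rho>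
      by (simp add: P(1)[symmetric] Q(1)[symmetric] complex_eq[symmetric])
    show "degree (P \<omega> + Polynomial.smult \<i> (Q \<omega>)) \<le> max N M" for \<omega>
      by (intro degree_add_le order_trans[OF P(2)] order_trans[OF degree_smult_le] order_trans[OF Q(2)]) auto
    show "continuous_on UNIV (\<lambda>\<omega>. coeff (P \<omega> + Polynomial.smult \<i> (Q \<omega>)) m)" for m
      unfolding coeff_add coeff_smult by (intro continuous_on_add continuous_on_mult continuous_on_const P Q)
  qed
qed

lemma poly_sum_bound:
  fixes q :: "complex poly"
  assumes "degree q \<le> N"
  shows "poly q z = (\<Sum>i\<le>N. coeff q i * z ^ i)"
  unfolding poly_altdef by (rule sum.mono_neutral_left) (use assms in \<open>auto simp: coeff_eq_0\<close>)

lemma integral_poly_family: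
  fixes Q :: "'a \<Rightarrow> complex poly"
  assumes "\<And>\<omega>. degree (Q \<omega>) \<le> N" "\<And>m. integrable M (\<lambda>\<omega>. coeff (Q \<omega>) m)"
    "\<And>m. coeff F m = (\<integral>\<omega>. coeff (Q \<omega>) m \<partial>M)"
  shows "(\<integral>\<omega>. poly (Q \<omega>) z \<partial>M) = poly F z"
proof -
  have "degree F \<le> N"
  proof (rule degree_le, intro allI impI)
    fix i assume "N < i"
    then have "coeff (Q \<omega>) i = 0" for \<omega> using assms(1)[of \<omega>] by (intro coeff_eq_0) simp
    then show "coeff F i = 0" by (simp add: assms(3))
  qed
  then have "poly F z = (\<Sum>i\<le>N. (\<integral>\<omega>. coeff (Q \<omega>) i \<partial>M) * z ^ i)"
    by (simp add: poly_sum_bound assms(3))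
  also have "\<dots> = (\<Sum>i\<le>N. (\<integral>\<omega>. coeff (Q \<omega>) i * z ^ i \<partial>M))"
    by simp
  also have "\<dots> = (\<integral>\<omega>. (\<Sum>i\<le>N. coeff (Q \<omega>) i * z ^ i) \<partial>M)"
    by (intro Bochner_Integration.integral_sum[symmetric] integrable_mult_left assms(2))
  finally show ?thesis
    by (simp add: poly_sum_bound[OF assms(1)])
qed

lemma poly_of_real_deriv_unique:
  assumes "\<And>\<rho>. f \<rho> = poly q (complex_of_real \<rho>)" "(f has_vector_derivative D) (at \<rho>)"
  shows "D = poly (pderiv q) (of_real \<rho>)"
proof -
  have "((\<lambda>\<rho>. poly q (complex_of_real \<rho>)) has_vector_derivative 1 * poly (pderiv q) (of_real \<rho>)) (at \<rho>)"
    using field_vector_diff_chain_at[of complex_of_real 1 \<rho> "poly q", OF _ poly_DERIV[of q "of_real \<rho>"]]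
      has_vector_derivative_of_real[where 'a = complex, OF DERIV_ident[of "at \<rho>"]] by (simp add: o_def)
  moreover have "f = (\<lambda>\<rho>. poly q (complex_of_real \<rho>))" using assms(1) by (simp add: fun_eq_iff)
  ultimately show ?thesis using assms(2) by (simp add: vector_derivative_unique_at)
qed

lemma harmonic_polysD:
  assumes "p \<in> harmonic_polys k"
  shows "polynomial_function p" "\<And>c x. p (c *\<^sub>R x) = of_real (c ^ k) * p x" "\<And>x. laplacian p x = 0"
  using assms by (auto simp: harmonic_polys_def)

text \<open>Integrating the line restriction \<open>\<rho> \<mapsto> p (x + \<rho> \<omega>)\<close> over the equator gives a polynomial \<open>F\<close>. The Casimir
  identity, harmonicity and Euler's identities turn into the Gegenbauer equation for \<open>F\<close>.\<close>

lemma equator_integral_poly: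
  fixes x :: "real ^ 'n" and p :: "real ^ 'n \<Rightarrow> complex"
  assumes x: "norm x = 1" and n: "CARD('n) \<ge> 2" and harm: "p \<in> harmonic_polys k"
  obtains F where "\<And>\<rho>. (\<integral>\<omega>. p (x + \<rho> *\<^sub>R \<omega>) \<partial>equator_measure x) = poly F (of_real \<rho>)"
    "\<And>m. of_nat (m + 2) * of_nat (m + CARD('n) - 1) * coeff F (m + 2) = - ((of_nat k - of_nat m) * (of_nat k - of_nat m - 1)) * coeff F m"
    "\<And>m. odd m \<Longrightarrow> coeff F m = 0"
proof -
  note p = harmonic_polysD(1)[OF harm] and hom = harmonic_polysD(2)[OF harm] and lap = harmonic_polysD(3)[OF harm]
  note pd = polynomial_function_derivative(2)[OF p]
  let ?M = "equator_measure x"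
  interpret finite_measure ?M by (rule finite_measure_equator[OF x])
  obtain Q N where Q: "\<And>\<omega> \<rho>. p (x + \<rho> *\<^sub>R \<omega>) = poly (Q \<omega>) (of_real \<rho>)"
    "\<And>\<omega>. degree (Q \<omega>) \<le> N" "\<And>m. continuous_on UNIV (\<lambda>\<omega>. coeff (Q \<omega>) m)"
    by (rule polynomial_function_line_family[OF p, of x]) blast
  have Q1: "dird p \<omega> (x + \<rho> *\<^sub>R \<omega>) = poly (pderiv (Q \<omega>)) (of_real \<rho>)" for \<omega> \<rho>
    by (rule poly_of_real_deriv_unique[OF Q(1)[of _ \<omega>] dird_line_has_vector_derivative[OF p]])
  have Q2: "dird (dird p \<omega>) \<omega> (x + \<rho> *\<^sub>R \<omega>) = poly (pderiv (pderiv (Q \<omega>))) (of_real \<rho>)" for \<omega> \<rho>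
    by (rule poly_of_real_deriv_unique[OF Q1[of \<omega>] dird_line_has_vector_derivative[OF pd]])
  have int: "integrable ?M (\<lambda>\<omega>. coeff (Q \<omega>) m)" for m
    by (rule integrable_equator[OF x n Q(3)])
  define F where "F = (\<Sum>m\<le>N. monom (\<integral>\<omega>. coeff (Q \<omega>) m \<partial>?M) m)"
  have F: "coeff F m = (\<integral>\<omega>. coeff (Q \<omega>) m \<partial>?M)" for m
  proof (cases "m \<le> N")
    case False
    then have "coeff (Q \<omega>) m = 0" for \<omega> using Q(2)[of \<omega>] by (intro coeff_eq_0) simp
    then show ?thesis using False by (simp add: F_def coeff_sum)
  qed (simp add: F_def coeff_sum)
  have deg1: "degree (pderiv q) \<le> N" if "degree q \<le> N" for q :: "complex poly"
    using that by (simp add: degree_pderiv)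
  have int1: "integrable ?M (\<lambda>\<omega>. coeff (pderiv (Q \<omega>)) m)" for m
    unfolding coeff_pderiv by (intro integrable_mult_right int)
  have int2: "integrable ?M (\<lambda>\<omega>. coeff (pderiv (pderiv (Q \<omega>))) m)" for m
    unfolding coeff_pderiv by (intro integrable_mult_right int)
  have I0: "(\<integral>\<omega>. poly (Q \<omega>) z \<partial>?M) = poly F z" for z
    by (rule integral_poly_family[OF Q(2) int F])
  have I1: "(\<integral>\<omega>. poly (pderiv (Q \<omega>)) z \<partial>?M) = poly (pderiv F) z" for z
    by (rule integral_poly_family[OF deg1[OF Q(2)] int1]) (simp add: coeff_pderiv F)
  have I2: "(\<integral>\<omega>. poly (pderiv (pderiv (Q \<omega>))) z \<partial>?M) = poly (pderiv (pderiv F)) z" for z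
    by (rule integral_poly_family[OF deg1[OF deg1[OF Q(2)]] int2]) (simp add: coeff_pderiv F)
  have ip0: "integrable ?M (\<lambda>\<omega>. poly (Q \<omega>) z)" for z
    unfolding poly_sum_bound[OF Q(2)] by (intro Bochner_Integration.integrable_sum integrable_mult_left int)
  have ip1: "integrable ?M (\<lambda>\<omega>. poly (pderiv (Q \<omega>)) z)" for z
    unfolding poly_sum_bound[OF deg1[OF Q(2)]] by (intro Bochner_Integration.integrable_sum integrable_mult_left int1)
  have ip2: "integrable ?M (\<lambda>\<omega>. poly (pderiv (pderiv (Q \<omega>))) z)" for z
    unfolding poly_sum_bound[OF deg1[OF deg1[OF Q(2)]]] by (intro Bochner_Integration.integrable_sum integrable_mult_left int2)
  define c d e :: complex where "c = of_nat k * (of_nat k - 1)" and "d = 2 * (of_nat k - 1)" and "e = of_nat CARD('n) - 2"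
  \<comment> \<open>At y = x + \<rho> \<omega> both directions x are replaced by y - \<rho>
    \<omega>; derivatives along y are given by Euler's identities, and those along \<omega> are
    \<rho>-derivatives of the line restriction.\<close>
  have xx: "dird (dird p x) x (x + \<rho> *\<^sub>R \<omega>) = c * poly (Q \<omega>) (of_real \<rho>) - d * of_real \<rho> * poly (pderiv (Q \<omega>)) (of_real \<rho>)
      + (of_real \<rho>)\<^sup>2 * poly (pderiv (pderiv (Q \<omega>))) (of_real \<rho>)" for \<rho> \<omega>
  proof -
    define y where "y = x + \<rho> *\<^sub>R \<omega>"
    have xy: "x = y - \<rho> *\<^sub>R \<omega>" by (simp add: y_def)
    have "dird (dird p x) x y = dird (dird p (y - \<rho> *\<^sub>R \<omega>)) x y" by (simp flip: xy)
    also have "\<dots> = dird (dird p y) x y - \<rho> *\<^sub>R dird (dird p \<omega>) x y"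
      by (simp add: linear_diff[OF linear_dird2[OF p]] linear_scale[OF linear_dird2[OF p]])
    also have "dird (dird p y) x y = dird (dird p y) (y - \<rho> *\<^sub>R \<omega>) y" by (simp flip: xy)
    also have "\<dots> = dird (dird p y) y y - \<rho> *\<^sub>R dird (dird p y) \<omega> y"
      by (simp add: linear_diff[OF linear_dird[OF pd]] linear_scale[OF linear_dird[OF pd]])
    also have "dird (dird p \<omega>) x y = dird (dird p \<omega>) (y - \<rho> *\<^sub>R \<omega>) y" by (simp flip: xy)
    also have "\<dots> = dird (dird p \<omega>) y y - \<rho> *\<^sub>R dird (dird p \<omega>) \<omega> y"
      by (simp add: linear_diff[OF linear_dird[OF pd]] linear_scale[OF linear_dird[OF pd]])
    also have "dird (dird p y) y y = (of_nat k - 1) * (of_nat k * p y)"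
      unfolding Euler_identity_dird_right[OF p hom] Euler_identity[OF p hom] ..
    also have "dird (dird p y) \<omega> y = (of_nat k - 1) * dird p \<omega> y"
      by (rule Euler_identity_dird_left[OF p hom])
    also have "dird (dird p \<omega>) y y = (of_nat k - 1) * dird p \<omega> y"
      by (rule Euler_identity_dird_right[OF p hom])
    finally show ?thesis
      unfolding y_def Q Q1 Q2 by (simp add: c_def d_def scaleR_conv_of_real power2_eq_square algebra_simps)
  qed
  \<comment> \<open>The equation \<rho>^2 (1 + \<rho>^2) F'' + (e \<rho> - d \<rho>^3) F' + c
    \<rho>^2 F = 0, kept as a polynomial: it vanishes at all real \<rho>, hence identically, and its
    coefficient of degree m + 2 is the recurrence.\<close>
  define H where "H = Polynomial.smult c (monom 1 2 * F) - Polynomial.smult d (monom 1 3 * pderiv F) + monom 1 4 * pderiv (pderiv F)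
     + monom 1 2 * pderiv (pderiv F) + Polynomial.smult e (monom 1 1 * pderiv F)"
  have H: "poly H (of_real \<rho>) = 0" for \<rho>
  proof -
    let ?r = "complex_of_real \<rho>"
    have "(\<integral>\<omega>. - ?r\<^sup>2 * c * poly (Q \<omega>) ?r + (d * ?r ^ 3 - e * ?r) * poly (pderiv (Q \<omega>)) ?r
         + (- (?r ^ 4) - ?r\<^sup>2) * poly (pderiv (pderiv (Q \<omega>))) ?r \<partial>?M) = 0"
      using equator_Casimir[OF x n p, of \<rho>] unfolding lap xx Q2 Q1 e_def[symmetric]
      by (rule trans[rotated], intro Bochner_Integration.integral_cong refl) (simp add: algebra_simps power2_eq_square power3_eq_cube power4_eq_xxxx)
    then have "- ?r\<^sup>2 * c * poly F ?r + (d * ?r ^ 3 - e * ?r) * poly (pderiv F) ?r + (- (?r ^ 4) - ?r\<^sup>2) * poly (pderiv (pderiv F)) ?r = 0"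
      by (simp add: ip0 ip1 ip2 I0 I1 I2)
    then show ?thesis
      by (simp add: H_def poly_monom algebra_simps)
  qed
  have "H = 0"
  proof (rule ccontr)
    assume "H \<noteq> 0"
    then have "finite {z. poly H z = 0}" by (rule poly_roots_finite)
    moreover have "range complex_of_real \<subseteq> {z. poly H z = 0}" using H by auto
    ultimately have "finite (range complex_of_real)" by (rule rev_finite_subset)
    then show False using infinite_UNIV_char_0[where 'a = real] finite_imageD[of complex_of_real UNIV] by (auto simp: inj_def)
  qed
  have rec: "of_nat (m + 2) * of_nat (m + CARD('n) - 1) * coeff F (m + 2) = - ((of_nat k - of_nat m) * (of_nat k - of_nat m - 1)) * coeff F m" for m
  proof -
    have "coeff H (m + 2) = 0" using \<open>H = 0\<close> by simp
    moreover have "coeff H (m + 2) = c * coeff F m - d * of_nat m * coeff F m + of_nat m * (of_nat m - 1) * coeff F m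
       + of_nat (m + 1) * of_nat (m + 2) * coeff F (m + 2) + e * of_nat (m + 2) * coeff F (m + 2)"
    proof -
      \<comment> \<open>Two of the multiplying monomials have degrees 3 and 4, so m = 0 and m = 1
        are treated separately.\<close>
      have cH: "coeff H (m + 2) = c * coeff F m - d * (if m + 2 < 3 then 0 else coeff (pderiv F) (m + 2 - 3))
         + (if m + 2 < 4 then 0 else coeff (pderiv (pderiv F)) (m + 2 - 4)) + coeff (pderiv (pderiv F)) m + e * coeff (pderiv F) (m + 1)"
        unfolding H_def coeff_add coeff_diff coeff_smult coeff_monom_mult by simp
      consider "m = 0" | "m = 1" | i where "m = i + 2" by (metis add.commute add_2_eq_Suc not0_implies_Suc One_nat_def)
      then show ?thesis
        unfolding cH by cases (simp_all add: coeff_pderiv algebra_simps eval_nat_numeral)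
    qed
    moreover have "of_nat (m + CARD('n) - 1) = (of_nat m + 1 + e :: complex)" using n by (simp add: e_def of_nat_diff)
    ultimately show ?thesis
      by (simp add: c_def d_def algebra_simps)
  qed
  \<comment> \<open>In degree 1 the equation says only \<open>e * coeff F 1 = 0\<close>, which is
    void in dimension 2. Parity comes instead from the orthogonal map that fixes x and negates its
    orthogonal complement.\<close>
  have odd: "coeff F m = 0" if "odd m" for m
  proof -
    let ?T = "\<lambda>y. (2 * (y \<bullet> x)) *\<^sub>R x - y"
    have xx1: "x \<bullet> x = 1" using x by (simp add: norm_eq_1)
    have T: "orthogonal_transformation ?T"
      unfolding orthogonal_transformation
    proof (intro conjI allI)
      show "linear ?T" by (rule linearI) (simp_all add: inner_add_left algebra_simps)
      fix y show "norm (?T y) = norm y"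
        unfolding norm_eq by (simp add: inner_diff_left inner_diff_right xx1 inner_commute)
    qed
    have even: "poly F (- of_real \<rho>) = poly F (of_real \<rho>)" for \<rho>
    proof -
      have cont: "continuous_on UNIV (\<lambda>\<omega>. p (x + \<rho> *\<^sub>R \<omega>))" for \<rho>
        by (rule continuous_on_shifted_polynomial[OF p])
      have "(\<integral>\<omega>. p (x + \<rho> *\<^sub>R ?T \<omega>) \<partial>?M) = (\<integral>\<omega>. p (x + \<rho> *\<^sub>R \<omega>) \<partial>?M)"
        by (rule equator_integral_invariant[OF T _ cont]) (simp add: xx1 scaleR_2)
      moreover have "(\<integral>\<omega>. p (x + \<rho> *\<^sub>R ?T \<omega>) \<partial>?M) = (\<integral>\<omega>. p (x + (- \<rho>) *\<^sub>R \<omega>) \<partial>?M)"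
      proof (rule integral_cong_AE)
        show "AE \<omega> in ?M. p (x + \<rho> *\<^sub>R ?T \<omega>) = p (x + (- \<rho>) *\<^sub>R \<omega>)"
          using AE_equator_measure[OF x n] by eventually_elim simp
        show "(\<lambda>\<omega>. p (x + \<rho> *\<^sub>R ?T \<omega>)) \<in> borel_measurable ?M"
          by (intro measurable_equatorI borel_measurable_continuous_onI continuous_on_compose2[OF continuous_polynomial_function[OF p, of UNIV]])
             (auto intro!: continuous_intros)
        show "(\<lambda>\<omega>. p (x + (- \<rho>) *\<^sub>R \<omega>)) \<in> borel_measurable ?M"
          by (intro measurable_equatorI borel_measurable_continuous_onI cont)
      qed
      ultimately show ?thesis
        using I0[of "of_real \<rho>"] I0[of "of_real (- \<rho>)"] unfolding Q by simp
    qed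
    define G where "G = pcompose F [:0, -1:] - F"
    have G: "poly G (of_real \<rho>) = 0" for \<rho> by (simp add: G_def poly_pcompose even)
    have "G = 0"
    proof (rule ccontr)
      assume "G \<noteq> 0"
      then have "finite {z. poly G z = 0}" by (rule poly_roots_finite)
      moreover have "range complex_of_real \<subseteq> {z. poly G z = 0}" using G by auto
      ultimately have "finite (range complex_of_real)" by (rule rev_finite_subset)
      then show False using infinite_UNIV_char_0[where 'a = real] finite_imageD[of complex_of_real UNIV] by (auto simp: inj_def)
    qed
    then have "coeff (pcompose F [:0, -1:]) m = coeff F m" by (simp add: G_def)
    then show ?thesis using that by (simp add: coeff_pcompose_linear)
  qed
  show ?thesis
    using that[of F] I0 rec odd unfolding Q by blast
qed

section \<open>Gegenbauer coefficients and the eigenvalue of the average\<close>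

lemma gegenbauer_coeff_rec:
  fixes n k j :: nat
  assumes "n \<ge> 2"
  defines "e \<equiv> \<lambda>j. gegenbauer_sum_coeff k j / pochhammer ((real n - 1) / 2) j"
  shows "(real (2 * j) + 2) * (real (2 * j) + real n - 1) * e (Suc j) = - ((real k - real (2 * j)) * (real k - real (2 * j) - 1)) * e j"
proof -
  define b where "b = (real n - 1) / 2"
  have b: "b > 0" using assms(1) by (simp add: b_def)
  have p: "pochhammer b j > 0" by (rule pochhammer_pos[OF b])
  have n: "real (2 * j) + real n - 1 = 2 * (b + real j)" by (simp add: b_def field_simps)
  have bj: "b + real j \<noteq> 0" using b by simp
  have c: "4 * (real j + 1) * gegenbauer_sum_coeff k (Suc j) = - ((real k - real (2 * j)) * (real k - real (2 * j) - 1)) * gegenbauer_sum_coeff k j"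
  proof -
    consider "2 * j + 2 \<le> k" | "k = 2 * j" | "k = 2 * j + 1" | "k < 2 * j" by linarith
    then show ?thesis
    proof cases
      case 1
      then obtain m where m: "k = 2 * j + 2 + m" using le_Suc_ex by blast
      have e: "k - 2 * j = Suc (Suc m)" "k - 2 * Suc j = m" using m by auto
      have k: "real k = 2 * real j + 2 + real m" using m by simp
      show ?thesis
        unfolding gegenbauer_sum_coeff_def e using 1
        by (simp add: k divide_simps)
    qed (auto simp: gegenbauer_sum_coeff_def)
  qed
  have cancel: "(2 * J + 2) * (2 * B) * (g / (P * B)) = 4 * (J + 1) * g / P" if "B \<noteq> 0" "P \<noteq> 0" for B P g J :: real
    using that by (simp add: field_simps)
  have "(real (2 * j) + 2) * (real (2 * j) + real n - 1) * e (Suc j) = (4 * (real j + 1) * gegenbauer_sum_coeff k (Suc j)) / pochhammer b j"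
    unfolding e_def n b_def[symmetric] pochhammer_Suc
    using cancel[OF bj less_imp_neq[OF p, symmetric], of "real j"] by simp
  also have "\<dots> = - ((real k - real (2 * j)) * (real k - real (2 * j) - 1)) * e j"
    unfolding c e_def b_def[symmetric] by simp
  finally show ?thesis .
qed

text \<open>The factors on the left of the recurrence never vanish, so the even coefficients are
  determined by the constant one. That is the total mass times p x, the integrand at \<rho> = 0
  being constant.\<close>

lemma equator_integral_harmonic:
  fixes x :: "real ^ 'n" and p :: "real ^ 'n \<Rightarrow> complex"
  assumes x: "norm x = 1" and n: "CARD('n) \<ge> 2" and harm: "p \<in> harmonic_polys k"
  shows "(\<integral>\<omega>. p (x + \<rho> *\<^sub>R \<omega>) \<partial>equator_measure x) =
     (\<Sum>j\<le>k. of_real (gegenbauer_sum_coeff k j / pochhammer ((real CARD('n) - 1) / 2) j * \<rho> ^ (2 * j)))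
       * (of_real (measure (equator_measure x) UNIV) * p x)"
proof -
  let ?M = "equator_measure x"
  obtain F where F: "\<And>\<rho>. (\<integral>\<omega>. p (x + \<rho> *\<^sub>R \<omega>) \<partial>?M) = poly F (of_real \<rho>)"
    "\<And>m. of_nat (m + 2) * of_nat (m + CARD('n) - 1) * coeff F (m + 2) = - ((of_nat k - of_nat m) * (of_nat k - of_nat m - 1)) * coeff F m"
    "\<And>m. odd m \<Longrightarrow> coeff F m = 0"
    by (rule equator_integral_poly[OF x n harm]) blast
  define e where "e j = gegenbauer_sum_coeff k j / pochhammer ((real CARD('n) - 1) / 2) j" for j
  have e0: "e 0 = 1" by (simp add: e_def gegenbauer_sum_coeff_def)
  have e_zero: "e j = 0" if "k < 2 * j" for j using that by (simp add: e_def gegenbauer_sum_coeff_def)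
  have F_even: "coeff F (2 * j) = of_real (e j) * coeff F 0" for j
  proof (induction j)
    case (Suc j)
    define a where "a = (real (2 * j) + 2) * (real (2 * j) + real CARD('n) - 1)"
    have a: "a \<noteq> 0" using n by (auto simp: a_def)
    have a': "of_nat (2 * j + 2) * of_nat (2 * j + CARD('n) - 1) = complex_of_real a"
      using n by (simp add: of_nat_diff a_def)
    have "complex_of_real a * coeff F (2 * Suc j) = - ((of_nat k - of_nat (2 * j)) * (of_nat k - of_nat (2 * j) - 1)) * coeff F (2 * j)"
      using F(2)[of "2 * j"] unfolding a' by simp
    also have "\<dots> = complex_of_real (- ((real k - real (2 * j)) * (real k - real (2 * j) - 1)) * e j) * coeff F 0"
      unfolding Suc.IH by simp
    also have "- ((real k - real (2 * j)) * (real k - real (2 * j) - 1)) * e j = a * e (Suc j)"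
      unfolding e_def a_def by (rule gegenbauer_coeff_rec[OF n, symmetric])
    finally show ?case using a by simp
  qed (simp add: e0)
  have Feq: "F = (\<Sum>j\<le>k. monom (coeff F (2 * j)) (2 * j))"
  proof (rule poly_eqI)
    fix m
    show "coeff F m = coeff (\<Sum>j\<le>k. monom (coeff F (2 * j)) (2 * j)) m"
    proof (cases "even m")
      case False
      then have "2 * j \<noteq> m" for j by auto
      then show ?thesis using False F(3) by (simp add: coeff_sum)
    next
      case True
      then obtain i where i: "m = 2 * i" by blast
      show ?thesis
      proof (cases "i \<le> k")
        case True
        then show ?thesis by (simp add: coeff_sum i)
      next
        case False
        then show ?thesis using F_even[of i] e_zero[of i] by (simp add: coeff_sum i)
      qed
    qed
  qed
  have F0: "coeff F 0 = of_real (measure ?M UNIV) * p x"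
    using F(1)[of 0] by (simp add: poly_0_coeff_0 scaleR_conv_of_real)
  have "poly F (of_real \<rho>) = (\<Sum>j\<le>k. coeff F (2 * j) * of_real \<rho> ^ (2 * j))"
    by (subst Feq) (simp add: poly_sum poly_monom)
  also have "\<dots> = (\<Sum>j\<le>k. of_real (e j * \<rho> ^ (2 * j))) * coeff F 0"
    unfolding F_even sum_distrib_right by (intro sum.cong refl) simp
  finally show ?thesis
    unfolding F(1) F0 e_def .
qed

text \<open>Homogeneity pulls out t^k and turns the sphere of latitude t into the equator scaled by
  \<rho> = sqrt (1 - t^2) / t; this is where t > 0 enters.\<close>

lemma sphere_average_harmonic:
  fixes x :: "real ^ 'n" and p :: "real ^ 'n \<Rightarrow> complex"
  assumes x: "norm x = 1" and n: "CARD('n) \<ge> 2" and harm: "p \<in> harmonic_polys k" and t: "0 < t" "t < 1"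
  shows "sphere_average t p x = of_real (gegenbauer_poly CARD('n) k t) * p x"
proof -
  let ?M = "equator_measure x"
  define \<rho> where "\<rho> = sqrt (1 - t\<^sup>2) / t"
  have t2: "t\<^sup>2 < 1" using t by (simp add: power_less_one_iff)
  have "t *\<^sub>R x + sqrt (1 - t\<^sup>2) *\<^sub>R \<omega> = t *\<^sub>R (x + \<rho> *\<^sub>R \<omega>)" for \<omega>
    using t by (simp add: \<rho>_def scaleR_add_right)
  then have "p (t *\<^sub>R x + sqrt (1 - t\<^sup>2) *\<^sub>R \<omega>) = of_real (t ^ k) * p (x + \<rho> *\<^sub>R \<omega>)" for \<omega>
    using harmonic_polysD(2)[OF harm] by simp
  then have "(\<integral>\<omega>. p (t *\<^sub>R x + sqrt (1 - t\<^sup>2) *\<^sub>R \<omega>) \<partial>?M) = of_real (t ^ k) * (\<integral>\<omega>. p (x + \<rho> *\<^sub>R \<omega>) \<partial>?M)"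
    by simp
  also have "\<dots> = of_real (t ^ k * (\<Sum>j\<le>k. gegenbauer_sum_coeff k j / pochhammer ((real CARD('n) - 1) / 2) j * \<rho> ^ (2 * j)))
       * (of_real (measure ?M UNIV) * p x)"
    unfolding equator_integral_harmonic[OF x n harm] by (simp add: mult.assoc)
  also have "t ^ k * (\<Sum>j\<le>k. gegenbauer_sum_coeff k j / pochhammer ((real CARD('n) - 1) / 2) j * \<rho> ^ (2 * j)) = gegenbauer_poly CARD('n) k t"
    unfolding gegenbauer_poly_def sum_distrib_left
  proof (intro sum.cong refl)
    fix j
    show "t ^ k * (gegenbauer_sum_coeff k j / pochhammer ((real CARD('n) - 1) / 2) j * \<rho> ^ (2 * j)) =
      gegenbauer_sum_coeff k j / pochhammer ((real CARD('n) - 1) / 2) j * t ^ (k - 2 * j) * (1 - t\<^sup>2) ^ j"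
    proof (cases "2 * j \<le> k")
      case True
      have "\<rho> ^ (2 * j) = (1 - t\<^sup>2) ^ j / t ^ (2 * j)"
        using t2 by (simp add: \<rho>_def power_divide power_mult)
      moreover have "t ^ k = t ^ (k - 2 * j) * t ^ (2 * j)"
        using True by (simp flip: power_add)
      ultimately show ?thesis using t by simp
    qed (simp add: gegenbauer_sum_coeff_def)
  qed
  finally show ?thesis
    using equator_measure_pos[OF x n] by (simp add: sphere_average_def)
qed

text \<open>The power (y_i + \<i> y_j)^k is harmonic because the linear form is isotropic, 1 +
  \<i>^2 = 0. A harmonic polynomial that does not vanish on the whole sphere makes the scalar in
  \<open>avg_eigenvalue\<close> unique.\<close>

lemma exists_harmonic_poly:
  assumes "CARD('n) \<ge> 2"
  shows "\<exists>p \<in> (harmonic_polys k :: (real ^ 'n::finite \<Rightarrow> complex) set). \<exists>x. norm x = 1 \<and> p x = 1"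
proof -
  obtain i j :: 'n where ij: "i \<noteq> j"
    using assms by (metis (full_types) UNIV_I card_2_iff' card_le_Suc0_iff_eq finite numeral_2_eq_2 not_less_eq_eq)
  define L where "L y = complex_of_real (y $ i) + \<i> * complex_of_real (y $ j)" for y :: "real ^ 'n"
  let ?p = "\<lambda>y. L y ^ k"
  have nthpoly: "real_polynomial_function (\<lambda>y::real^'n. y $ i)" for i
    by (rule real_polynomial_function.intros(1)) (rule bounded_linear_vec_nth)
  have Lpoly: "polynomial_function L"
    unfolding L_def[abs_def] by (intro polynomial_function_complexI nthpoly)
  have ppoly: "polynomial_function (\<lambda>y. L y ^ m)" for m
    by (induction m) (auto intro!: polynomial_function_mult_complex Lpoly)
  have Lder: "(L has_derivative L) (at y)" for y
  proof -
    have "bounded_linear L"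
      unfolding L_def[abs_def]
      by (intro bounded_linear_add bounded_linear_const_mult bounded_linear_compose[OF bounded_linear_of_real] bounded_linear_vec_nth)
    then show ?thesis by (rule bounded_linear_imp_has_derivative)
  qed
  have d: "dird (\<lambda>y. L y ^ k) v y = of_nat k * L v * L y ^ (k - 1)" for k v y
    by (rule dird_eqI[OF has_derivative_power[OF Lder]])
  have dd: "dird (dird ?p b) b y = of_nat k * of_nat (k - 1) * L y ^ (k - 1 - 1) * (L b)\<^sup>2" for b y
  proof -
    have "((\<lambda>y. of_nat k * L b * L y ^ (k - 1)) has_derivative (\<lambda>v. of_nat k * L b * (of_nat (k - 1) * L v * L y ^ (k - 1 - 1)))) (at y)"
      by (rule has_derivative_mult_right[OF has_derivative_power[OF Lder]])
    then have "dird (\<lambda>y. of_nat k * L b * L y ^ (k - 1)) b y = of_nat k * L b * (of_nat (k - 1) * L b * L y ^ (k - 1 - 1))"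
      by (rule dird_eqI)
    moreover have "dird ?p b = (\<lambda>y. of_nat k * L b * L y ^ (k - 1))" by (simp add: fun_eq_iff d)
    ultimately show ?thesis by (simp add: power2_eq_square mult_ac)
  qed
  have "(\<Sum>b\<in>Basis. (L b)\<^sup>2) = (\<Sum>m\<in>UNIV. (L (axis m 1))\<^sup>2)"
    unfolding Basis_vec_def by (subst sum.UNION_disjoint) (auto simp: axis_eq_axis)
  also have "\<dots> = (\<Sum>m\<in>UNIV. (if m = i then 1 else 0) + (if m = j then \<i>\<^sup>2 else 0))"
    by (intro sum.cong refl) (use ij in \<open>auto simp: L_def axis_def\<close>)
  also have "\<dots> = 0" by (simp add: sum.distrib)
  finally have L0: "(\<Sum>b\<in>Basis. (L b)\<^sup>2) = 0" .
  have "laplacian ?p y = 0" for y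
    unfolding laplacian_polynomial[OF ppoly] dd sum_distrib_left[symmetric] L0 by simp
  moreover have "?p (c *\<^sub>R y) = of_real (c ^ k) * ?p y" for c y
    by (simp add: L_def power_mult_distrib[symmetric] algebra_simps)
  ultimately have "?p \<in> harmonic_polys k"
    using ppoly by (simp add: harmonic_polys_def)
  moreover have "norm (axis i 1 :: real ^ 'n) = 1"
    by (rule norm_axis_1)
  moreover have "L (axis i 1) = 1"
    using ij by (simp add: L_def axis_def)
  then have "?p (axis i 1) = 1"
    by simp
  ultimately show ?thesis
    by (intro bexI[of _ ?p] exI[of _ "axis i 1"] conjI)
qed

lemma avg_eigenvalue_eq:
  assumes "CARD('n::finite) \<ge> 2" "0 < t" "t < 1"
  shows "avg_eigenvalue TYPE('n) k t = of_real (gegenbauer_poly CARD('n) k t)"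
  unfolding avg_eigenvalue_def
proof (rule the_equality)
  show "\<forall>p\<in>harmonic_polys k. \<forall>x\<in>sphere (0::real^'n) 1. sphere_average t p x = of_real (gegenbauer_poly CARD('n) k t) * p x"
    using sphere_average_harmonic assms by auto
next
  fix c assume c: "\<forall>p\<in>harmonic_polys k. \<forall>x\<in>sphere (0::real^'n) 1. sphere_average t p x = c * p x"
  obtain p and x :: "real ^ 'n" where p: "p \<in> harmonic_polys k" "norm x = 1" "p x = 1"
    using exists_harmonic_poly[OF assms(1), of k] by blast
  then show "c = of_real (gegenbauer_poly CARD('n) k t)"
    using bspec[OF bspec[OF c p(1)], of x] sphere_average_harmonic[OF p(2) assms(1) p(1) assms(2,3)] by simp
qed

section \<open>The Euler operator\<close>

text \<open>After i steps this is t^(i+1-k) (d/dt)^i t^(k-1), written as the product of the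
  commuting factors \<open>theta\<close> + k - 1 - j for j < i, hence homogeneous of degree 0. On
  t^s it acts as the product of the scalars s + k - 1 - j.\<close>

primrec euler_op :: "nat \<Rightarrow> nat \<Rightarrow> (real \<Rightarrow> complex) \<Rightarrow> real \<Rightarrow> complex" where
  "euler_op k 0 \<phi> = \<phi>"
| "euler_op k (Suc i) \<phi> = (\<lambda>u. theta (euler_op k i \<phi>) u + (of_nat k - 1 - of_nat i) * euler_op k i \<phi> u)"

lemma test_fun_euler_op: "test_fun \<phi> \<Longrightarrow> test_fun (euler_op k i \<phi>)"
  by (induction i) (auto intro!: test_fun_add test_fun_cmult test_fun_theta)

text \<open>Values of \<open>euler_op\<close> on an open set are determined by the function there,
  so the criterion also serves for extensions that are prescribed only on (0,2).\<close>

lemma euler_op_eqI: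
  assumes S: "open S" and D0: "\<And>x. x \<in> S \<Longrightarrow> \<phi> x = D 0 x"
    and D: "\<And>i x. x \<in> S \<Longrightarrow> (D i has_vector_derivative D' i x) (at x)"
    and rec: "\<And>i x. x \<in> S \<Longrightarrow> D (Suc i) x = of_real x * D' i x + (of_nat k - 1 - of_nat i) * D i x"
  shows "x \<in> S \<Longrightarrow> euler_op k i \<phi> x = D i x"
proof (induction i arbitrary: x)
  case (Suc i)
  have "(euler_op k i \<phi> has_vector_derivative D' i x) (at x)"
    by (rule has_vector_derivative_transform_within_open[OF D S]) (use Suc in auto)
  then have "theta (euler_op k i \<phi>) x = of_real x * D' i x"
    by (simp add: theta_def vector_derivative_at)
  then show ?case using Suc by (simp add: rec)
qed (simp add: D0)

lemma euler_op_has_vector_derivative: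
  "test_fun \<phi> \<Longrightarrow> (euler_op k i \<phi> has_vector_derivative vector_derivative (euler_op k i \<phi>) (at x)) (at x)"
  by (intro test_fun_deriv1 test_fun_euler_op)

lemma euler_op_dilation:
  assumes \<phi>: "test_fun \<phi>" and x: "x > 0" and y: "y > 0"
  shows "euler_op k i (\<lambda>y. \<phi> (x * y)) y = euler_op k i \<phi> (x * y)"
proof (rule euler_op_eqI[where S = "{0<..}" and D' = "\<lambda>i y. of_real x * vector_derivative (euler_op k i \<phi>) (at (x * y))"])
  fix i and y :: real
  have "((\<lambda>y. x * y) has_vector_derivative x) (at y)"
    by (auto intro!: derivative_eq_intros)
  from vector_diff_chain_at[OF this euler_op_has_vector_derivative[OF \<phi>]]
  show "((\<lambda>y. euler_op k i \<phi> (x * y)) has_vector_derivative of_real x * vector_derivative (euler_op k i \<phi>) (at (x * y))) (at y)"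
    by (simp add: o_def scaleR_conv_of_real)
qed (use y in \<open>auto simp: theta_def\<close>)

lemma smooth_on_powi: "smooth_on {0<..} (\<lambda>t. complex_of_real (t powi j))"
proof (rule smooth_on_coinduct[where P = "\<lambda>f. \<exists>c j. f = (\<lambda>t. complex_of_real (c * t powi j))"])
  show "\<exists>c j'. (\<lambda>t. complex_of_real (t powi j)) = (\<lambda>t. complex_of_real (c * t powi j'))"
    by (rule exI[of _ 1], rule exI[of _ j]) simp
next
  fix g assume "\<exists>c j. g = (\<lambda>t. complex_of_real (c * t powi j))"
  then obtain c j where g: "g = (\<lambda>t. complex_of_real (c * t powi j))" by blast
  have "(g has_vector_derivative complex_of_real ((c * of_int j) * t powi (j - 1))) (at t)" if "t > 0" for t
    unfolding g using that
    by (intro has_vector_derivative_of_real) (auto intro!: derivative_eq_intros)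
  then show "\<exists>h. (\<exists>c j. h = (\<lambda>t. complex_of_real (c * t powi j))) \<and> (\<forall>t\<in>{0<..}. (g has_vector_derivative h t) (at t))"
    by (intro exI[of _ "\<lambda>t. complex_of_real ((c * of_int j) * t powi (j - 1))"]) blast
qed simp

text \<open>The derivative of t^a f is t^(a-1) times \<open>theta f\<close> + a f, with a = k - 1 -
  i at stage i. Integer powers are used because the exponent becomes negative.\<close>

lemma nth_deriv_powi_mult:
  assumes \<phi>: "test_fun \<phi>" and t: "t > 0"
  shows "nth_deriv i (\<lambda>t. of_real (t powi (int k - 1)) * \<phi> t) t = of_real (t powi (int k - 1 - int i)) * euler_op k i \<phi> t"
proof (rule nth_deriv_eqI[where S = "{0<..}"])
  fix j and t :: real assume t: "t \<in> {0<..}"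
  let ?E = "euler_op k j \<phi>"
  have "((\<lambda>t. complex_of_real (t powi (int k - 1 - int j))) has_vector_derivative
      complex_of_real (of_int (int k - 1 - int j) * t powi (int k - 1 - int j - 1))) (at t)"
    by (intro has_vector_derivative_of_real) (use t in \<open>auto intro!: derivative_eq_intros\<close>)
  from has_vector_derivative_mult[OF this euler_op_has_vector_derivative[OF \<phi>, of k j t]]
  have "((\<lambda>t. of_real (t powi (int k - 1 - int j)) * ?E t) has_vector_derivative
      of_real (t powi (int k - 1 - int j)) * vector_derivative ?E (at t) +
      of_real (of_int (int k - 1 - int j) * t powi (int k - 1 - int j - 1)) * ?E t) (at t)" .
  also have "of_real (t powi (int k - 1 - int j)) = complex_of_real (t powi (int k - 1 - int (Suc j))) * of_real t"
  proof -
    have "t powi (int k - 1 - int j) = t powi (int k - 1 - int (Suc j)) * t"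
    proof -
      have "int k - 1 - int j = int k - 1 - int (Suc j) + 1" by simp
      then show ?thesis using t power_int_add_1[of t "int k - 1 - int (Suc j)"] by (simp only:) simp
    qed
    then show ?thesis by (simp only: of_real_mult)
  qed
  also have "int k - 1 - int j - 1 = int k - 1 - int (Suc j)" by simp
  also have "complex_of_real (t powi (int k - 1 - int (Suc j))) * of_real t * vector_derivative ?E (at t) +
      of_real (of_int (int k - 1 - int j) * t powi (int k - 1 - int (Suc j))) * ?E t =
      of_real (t powi (int k - 1 - int (Suc j))) * euler_op k (Suc j) \<phi> t"
    by (simp add: theta_def algebra_simps)
  finally show "((\<lambda>t. of_real (t powi (int k - 1 - int j)) * ?E t) has_vector_derivative
      of_real (t powi (int k - 1 - int (Suc j))) * euler_op k (Suc j) \<phi> t) (at t)" .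
qed (use t in auto)

text \<open>The sign in - d/dt cancels the sign of the distributional derivative, so transposition
  introduces none.\<close>

lemma funpow_neg_dist_deriv:
  assumes "test_fun \<phi>"
  shows "((\<lambda>\<gamma>. dist_scale (-1) (dist_deriv \<gamma>)) ^^ m) \<gamma> \<phi> = \<gamma> (nth_deriv m \<phi>)"
  using assms
proof (induction m arbitrary: \<phi>)
  case (Suc m)
  then show ?case
    using Suc.IH[OF test_fun_vector_derivative[OF Suc.prems]]
    by (simp add: dist_scale_def dist_deriv_def nth_deriv_Suc')
qed simp

text \<open>The x-derivative of \<phi> (x y), multiplied by x, is \<open>theta \<phi>\<close> at x
  y, so the operator passes through the pairing. Thus also in the order \<beta>, \<alpha> the
  densities are tested against the same function.\<close>

lemma euler_op_dist_pairing:
  assumes \<delta>: "distribution \<delta>" and \<phi>: "test_fun \<phi>"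
    and \<psi>: "\<And>x. 0 < x \<Longrightarrow> x < 2 \<Longrightarrow> \<psi> x = \<delta> (\<lambda>y. \<phi> (x * y))" and x: "0 < x" "x < 2"
  shows "euler_op k i \<psi> x = \<delta> (\<lambda>y. euler_op k i \<phi> (x * y))"
proof (rule euler_op_eqI[where S = "{0<..<2}" and D' = "\<lambda>i x. of_real (1 / x) * \<delta> (\<lambda>y. theta (euler_op k i \<phi>) (x * y))"])
  fix i and x :: real assume x: "x \<in> {0<..<2}"
  show "((\<lambda>x. \<delta> (\<lambda>y. euler_op k i \<phi> (x * y))) has_vector_derivative of_real (1 / x) * \<delta> (\<lambda>y. theta (euler_op k i \<phi>) (x * y))) (at x)"
    using x by (intro dist_pairing_deriv_theta \<delta> test_fun_euler_op \<phi>) auto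
  have t: "test_fun (\<lambda>y. theta (euler_op k i \<phi>) (x * y))" "test_fun (\<lambda>y. euler_op k i \<phi> (x * y))"
    using x by (auto intro!: test_fun_dilation test_fun_theta test_fun_euler_op \<phi>)
  show "\<delta> (\<lambda>y. euler_op k (Suc i) \<phi> (x * y)) =
     of_real x * (of_real (1 / x) * \<delta> (\<lambda>y. theta (euler_op k i \<phi>) (x * y))) + (of_nat k - 1 - of_nat i) * \<delta> (\<lambda>y. euler_op k i \<phi> (x * y))"
    using x distribution_add[OF \<delta> t(1) test_fun_cmult[OF t(2)]] distribution_cmult[OF \<delta> t(2)] by simp
qed (use \<psi> x in auto)

text \<open>The repeated integral \<open>\<integral> (1-u)\<^sup>i / i! \<eta>\<^sup>(\<^sup>i\<^sup>+\<^sup>1\<^sup>) du\<close>, through the antiderivative given by Taylor's formula.\<close>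

lemma Taylor_integral:
  assumes \<eta>: "test_fun \<eta>"
  shows "(LBINT u:{0<..<1}. of_real ((1 - u) ^ i / fact i) * nth_deriv (Suc i) \<eta> u) = \<eta> 1"
proof -
  define W where "W i u = (\<Sum>l\<le>i. of_real ((1 - u) ^ l / fact l) * nth_deriv l \<eta> u)" for i u
  have d: "(nth_deriv l \<eta> has_vector_derivative nth_deriv (Suc l) \<eta> u) (at u)" for l u
    by (rule smooth_on_has_vector_derivative[OF test_fun_smooth[OF \<eta>, of UNIV]]) simp
  have W: "(W i has_vector_derivative of_real ((1 - u) ^ i / fact i) * nth_deriv (Suc i) \<eta> u) (at u)" for u
  proof (induction i)
    case 0
    show ?case using d[of 0 u] by (simp add: W_def)
  next
    case (Suc i)
    have "((\<lambda>u. (1 - u) ^ Suc i / fact (Suc i)) has_real_derivative - ((1 - u) ^ i / fact i)) (at u)"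
      by (rule derivative_eq_intros refl | simp)+
    from has_vector_derivative_add[OF Suc has_vector_derivative_mult[OF has_vector_derivative_of_real[OF this] d[of "Suc i" u]]]
    show ?case by (simp add: W_def[abs_def])
  qed
  let ?f = "\<lambda>u. complex_of_real ((1 - u) ^ i / fact i) * nth_deriv (Suc i) \<eta> u"
  have cont: "continuous_on {0..1} ?f"
    using smooth_on_continuous[OF test_fun_smooth[OF \<eta>, of UNIV]]
    by (intro continuous_intros continuous_at_imp_continuous_on) auto
  have "(?f has_integral (W i 1 - W i 0)) {0..1}"
    by (rule fundamental_theorem_of_calculus) (use W in \<open>auto intro: has_vector_derivative_at_within\<close>)
  then have "integral {0..1} ?f = W i 1 - W i 0" by (rule integral_unique)
  moreover have "nth_deriv l \<eta> 0 = 0" for l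
  proof -
    obtain a b where "0 < a" "a \<le> b" "\<And>x. x \<notin> {a..b} \<Longrightarrow> \<eta> x = 0" using \<eta> by (rule test_funE) blast
    then show ?thesis by (intro vector_derivative_eq_0_outside[of "{a..b}"]) auto
  qed
  then have "W i 0 = 0" by (simp add: W_def)
  moreover have "W i 1 = \<eta> 1"
  proof -
    have "W i 1 = (\<Sum>l\<le>i. if l = 0 then \<eta> 1 else 0)"
      unfolding W_def by (intro sum.cong refl) (auto simp: power_0_left)
    then show ?thesis by simp
  qed
  moreover have "(LBINT u:{0..1}. ?f u) = integral {0..1} ?f"
    by (intro set_borel_integral_eq_integral(2) borel_integrable_atLeastAtMost' cont)
  moreover have "(LBINT u:{0<..<1}. ?f u) = (LBINT u:{0..1}. ?f u)"
    unfolding set_lebesgue_integral_def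
  proof (rule integral_cong_AE)
    have "continuous_on UNIV ?f"
      using smooth_on_continuous[OF test_fun_smooth[OF \<eta>, of UNIV]]
      by (intro continuous_intros continuous_at_imp_continuous_on) auto
    then have [measurable]: "?f \<in> borel_measurable borel" by (rule borel_measurable_continuous_onI)
    show "(\<lambda>u. indicator {0<..<1} u *\<^sub>R ?f u) \<in> borel_measurable lborel" by measurable
    show "(\<lambda>u. indicator {0..1} u *\<^sub>R ?f u) \<in> borel_measurable lborel" by measurable
    show "AE u in lborel. indicator {0<..<1} u *\<^sub>R ?f u = indicator {0..1} u *\<^sub>R ?f u"
      using AE_lborel_singleton[of "0::real"] AE_lborel_singleton[of "1::real"]
      by eventually_elim (auto simp: indicator_def)
  qed
  ultimately show ?thesis by simp
qed

section \<open>Multiplicative convolution of densities\<close>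

lemma set_integrable_bounded_mult:
  fixes h F :: "real \<Rightarrow> complex"
  assumes h: "set_integrable lborel {0<..<1} h" and [measurable]: "F \<in> borel_measurable borel"
    and B: "\<And>x. 0 < x \<Longrightarrow> x < 1 \<Longrightarrow> norm (F x) \<le> B"
  shows "set_integrable lborel {0<..<1} (\<lambda>x. h x * F x)"
    and "norm (LBINT x:{0<..<1}. h x * F x) \<le> (LBINT x:{0<..<1}. norm (h x)) * B"
proof -
  let ?h = "\<lambda>x. indicator {0<..<1} x *\<^sub>R h x"
  have hi: "integrable lborel ?h" using h by (simp add: set_integrable_def)
  have eq: "indicator {0<..<1} x *\<^sub>R (h x * F x) = ?h x * F x" for x by simp
  have le: "norm (?h x * F x) \<le> norm (?h x) * B" for x
    by (cases "x \<in> {0<..<1}") (auto simp: norm_mult intro!: mult_left_mono B)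
  have dom: "integrable lborel (\<lambda>x. norm (?h x) * B)"
    by (rule integrable_mult_left[OF integrable_norm[OF hi]])
  have m: "(\<lambda>x. ?h x * F x) \<in> borel_measurable lborel"
    by (intro borel_measurable_times borel_measurable_integrable[OF hi]) simp
  have int: "integrable lborel (\<lambda>x. ?h x * F x)"
  proof (rule Bochner_Integration.integrable_bound[OF dom m], rule AE_I2)
    fix x show "norm (?h x * F x) \<le> norm (norm (?h x) * B)"
      by (rule order_trans[OF le]) simp
  qed
  show "set_integrable lborel {0<..<1} (\<lambda>x. h x * F x)"
    unfolding set_integrable_def eq by (rule int)
  have "norm (integral\<^sup>L lborel (\<lambda>x. ?h x * F x)) \<le> integral\<^sup>L lborel (\<lambda>x. norm (?h x) * B)"
    by (rule Bochner_Integration.integral_norm_bound_integral[OF int dom le])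
  then show "norm (LBINT x:{0<..<1}. h x * F x) \<le> (LBINT x:{0<..<1}. norm (h x)) * B"
    unfolding set_lebesgue_integral_def eq by simp
qed

text \<open>Multiplicative convolution of two densities on \<open>(0,1)\<close>, tested against \<open>F\<close>. By the Weierstrass
  approximation theorem it is determined by the moments.\<close>

definition conv_test :: "(real \<Rightarrow> complex) \<Rightarrow> (real \<Rightarrow> complex) \<Rightarrow> (real \<Rightarrow> complex) \<Rightarrow> complex" where
  "conv_test h k F = (LBINT x:{0<..<1}. h x * (LBINT y:{0<..<1}. k y * F (x * y)))"

text \<open>Measurability of the inner integral comes from joint measurability on the product space;
  the rest is the bound by B, as x y stays in (0,1).\<close>

lemma conv_test_facts:
  fixes h k F :: "real \<Rightarrow> complex"
  assumes h: "set_integrable lborel {0<..<1} h" and k: "set_integrable lborel {0<..<1} k"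
    and F: "continuous_on UNIV F" and B: "\<And>x. 0 < x \<Longrightarrow> x < 1 \<Longrightarrow> norm (F x) \<le> B"
  shows "set_integrable lborel {0<..<1} (\<lambda>x. h x * (LBINT y:{0<..<1}. k y * F (x * y)))"
    and "norm (conv_test h k F) \<le> (LBINT x:{0<..<1}. norm (h x)) * ((LBINT x:{0<..<1}. norm (k x)) * B)"
    and "\<And>x. 0 < x \<Longrightarrow> x < 1 \<Longrightarrow> set_integrable lborel {0<..<1} (\<lambda>y. k y * F (x * y))"
proof -
  have Fm [measurable]: "F \<in> borel_measurable borel" by (rule borel_measurable_continuous_onI[OF F])
  have xy: "0 < x * y \<and> x * y < 1" if "0 < x" "x < 1" "0 < y" "y < 1" for x y :: real
    using that mult_strict_mono[of x 1 y 1] by simp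
  show "\<And>x. 0 < x \<Longrightarrow> x < 1 \<Longrightarrow> set_integrable lborel {0<..<1} (\<lambda>y. k y * F (x * y))"
    by (rule set_integrable_bounded_mult(1)[OF k, where B = B]) (use xy B in auto)
  let ?K = "\<lambda>x. LBINT y:{0<..<1}. k y * F (x * y)"
  have Kb: "norm (?K x) \<le> (LBINT x:{0<..<1}. norm (k x)) * B" if "0 < x" "x < 1" for x
    by (rule set_integrable_bounded_mult(2)[OF k]) (use that xy B in auto)
  have km [measurable]: "(\<lambda>y. indicator {0<..<1} y *\<^sub>R k y) \<in> borel_measurable lborel"
    using k unfolding set_integrable_def by (rule borel_measurable_integrable)
  have "(\<lambda>(x, y). (indicator {0<..<1} y *\<^sub>R k y) * F (x * y)) \<in> borel_measurable (lborel \<Otimes>\<^sub>M lborel)"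
    by measurable
  then have "(\<lambda>x. LBINT y. (indicator {0<..<1} y *\<^sub>R k y) * F (x * y)) \<in> borel_measurable lborel"
    by (rule lborel.borel_measurable_lebesgue_integral)
  then have Km: "?K \<in> borel_measurable borel"
    by (simp add: set_lebesgue_integral_def)
  show "set_integrable lborel {0<..<1} (\<lambda>x. h x * ?K x)"
    by (rule set_integrable_bounded_mult(1)[OF h Km Kb])
  show "norm (conv_test h k F) \<le> (LBINT x:{0<..<1}. norm (h x)) * ((LBINT x:{0<..<1}. norm (k x)) * B)"
    unfolding conv_test_def by (rule set_integrable_bounded_mult(2)[OF h Km Kb])
qed

lemma continuous_bounded_01:
  fixes F :: "real \<Rightarrow> complex"
  assumes "continuous_on UNIV F"
  obtains B where "\<And>x. 0 < x \<Longrightarrow> x < 1 \<Longrightarrow> norm (F x) \<le> B"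
proof -
  have "bounded (F ` {0..1})"
    by (intro compact_imp_bounded compact_continuous_image continuous_on_subset[OF assms]) auto
  then obtain B where "\<forall>x\<in>F ` {0..1}. norm x \<le> B" using bounded_iff by metis
  then show ?thesis by (intro that[of B]) auto
qed

lemma conv_test_linear:
  fixes h k F G :: "real \<Rightarrow> complex"
  assumes h: "set_integrable lborel {0<..<1} h" and k: "set_integrable lborel {0<..<1} k"
    and F: "continuous_on UNIV F" and G: "continuous_on UNIV G"
  shows "conv_test h k (\<lambda>x. F x + G x) = conv_test h k F + conv_test h k G"
    and "conv_test h k (\<lambda>x. c * F x) = c * conv_test h k F"
proof -
  obtain B C where B: "\<And>x. 0 < x \<Longrightarrow> x < 1 \<Longrightarrow> norm (F x) \<le> B" and C: "\<And>x. 0 < x \<Longrightarrow> x < 1 \<Longrightarrow> norm (G x) \<le> C"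
    using continuous_bounded_01[OF F] continuous_bounded_01[OF G] by metis
  note f = conv_test_facts[OF h k F B] and g = conv_test_facts[OF h k G C]
  have "conv_test h k (\<lambda>x. F x + G x) =
     (LBINT x:{0<..<1}. h x * (LBINT y:{0<..<1}. k y * F (x * y)) + h x * (LBINT y:{0<..<1}. k y * G (x * y)))"
    unfolding conv_test_def
  proof (rule set_lebesgue_integral_cong, simp, intro allI impI)
    fix x :: real assume "x \<in> {0<..<1}"
    then have x: "0 < x" "x < 1" by auto
    show "h x * (LBINT y:{0<..<1}. k y * (F (x * y) + G (x * y))) =
       h x * (LBINT y:{0<..<1}. k y * F (x * y)) + h x * (LBINT y:{0<..<1}. k y * G (x * y))"
      using set_integral_add(2)[OF f(3)[OF _ _ x] g(3)[OF _ _ x]] by (simp add: distrib_left)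
  qed
  then show "conv_test h k (\<lambda>x. F x + G x) = conv_test h k F + conv_test h k G"
    using set_integral_add(2)[OF f(1) g(1)] by (simp add: conv_test_def)
  show "conv_test h k (\<lambda>x. c * F x) = c * conv_test h k F"
    by (simp add: conv_test_def mult.left_commute[of _ c])
qed

text \<open>Both sides are linear in F and bounded by a multiple of its supremum on (0,1), and on
  monomials they agree by \<open>mom\<close>, since the double integral of (x y)^j factors. Density
  of polynomials does the rest.\<close>

lemma conv_test_eq_moments:
  fixes h k g F :: "real \<Rightarrow> complex"
  assumes h: "set_integrable lborel {0<..<1} h" and k: "set_integrable lborel {0<..<1} k"
    and g: "set_integrable lborel {0<..<1} g"
    and mom: "\<And>j. (LBINT x:{0<..<1}. h x * of_real x ^ j) * (LBINT x:{0<..<1}. k x * of_real x ^ j) = (LBINT x:{0<..<1}. g x * of_real x ^ j)"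
    and F: "continuous_on UNIV F"
  shows "conv_test h k F = (LBINT x:{0<..<1}. g x * F x)"
proof -
  let ?S = "\<lambda>F. LBINT x:{0<..<1}. g x * F x"
  have monomial: "conv_test h k (\<lambda>x. of_real x ^ j) = ?S (\<lambda>x. of_real x ^ j)" for j
  proof -
    have "(LBINT y:{0<..<1}. k y * of_real (x * y) ^ j) = of_real x ^ j * (LBINT y:{0<..<1}. k y * of_real y ^ j)" for x
      by (simp add: power_mult_distrib mult.left_commute[of _ "of_real x ^ j"])
    then show ?thesis
      unfolding conv_test_def mom[symmetric] by (simp add: mult.assoc[symmetric])
  qed
  have Sadd: "?S (\<lambda>x. F x + G x) = ?S F + ?S G" if F: "continuous_on UNIV F" and G: "continuous_on UNIV G" for F G
  proof -
    obtain B C where B: "\<And>x. 0 < x \<Longrightarrow> x < 1 \<Longrightarrow> norm (F x) \<le> B" and C: "\<And>x. 0 < x \<Longrightarrow> x < 1 \<Longrightarrow> norm (G x) \<le> C"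
      using continuous_bounded_01[OF F] continuous_bounded_01[OF G] by metis
    show ?thesis
      using set_integral_add(2)[OF set_integrable_bounded_mult(1)[OF g borel_measurable_continuous_onI[OF F] B]
          set_integrable_bounded_mult(1)[OF g borel_measurable_continuous_onI[OF G] C]]
      by (simp add: distrib_left)
  qed
  have poly: "conv_test h k (\<lambda>x. poly q (of_real x)) = ?S (\<lambda>x. poly q (of_real x))" for q
  proof -
    have "conv_test h k (\<lambda>x. \<Sum>i<m. coeff q i * of_real x ^ i) = ?S (\<lambda>x. \<Sum>i<m. coeff q i * of_real x ^ i)" for m
    proof (induction m)
      case 0
      show ?case by (simp add: conv_test_def)
    next
      case (Suc m)
      have c1: "continuous_on UNIV (\<lambda>x. \<Sum>i<m. coeff q i * complex_of_real x ^ i)"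
        and c2: "continuous_on UNIV (\<lambda>x. coeff q m * complex_of_real x ^ m)" and c3: "continuous_on UNIV (\<lambda>x. complex_of_real x ^ m)"
        by (intro continuous_intros)+
      have S: "?S (\<lambda>x. coeff q m * of_real x ^ m) = coeff q m * ?S (\<lambda>x. of_real x ^ m)"
        by (simp add: mult.left_commute[of _ "coeff q m"])
      show ?case
        unfolding sum.lessThan_Suc conv_test_linear(1)[OF h k c1 c2] Sadd[OF c1 c2] conv_test_linear(2)[OF h k c3 c3] S monomial Suc.IH ..
    qed
    from this[of "Suc (degree q)"] show ?thesis
      by (simp add: poly_altdef lessThan_Suc_atMost)
  qed
  let ?H = "(LBINT x:{0<..<1}. norm (h x))" and ?K = "(LBINT x:{0<..<1}. norm (k x))" and ?G = "(LBINT x:{0<..<1}. norm (g x))"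
  have nn: "?H \<ge> 0" "?K \<ge> 0" "?G \<ge> 0"
    by (simp_all add: set_lebesgue_integral_def)
  have bnd: "norm (conv_test h k F - ?S F) \<le> (?H * ?K + ?G) * e" if e: "e > 0" for e
  proof -
    have "\<exists>p. polynomial_function p \<and> (\<forall>x\<in>{0..1}. norm (F x - p x) < e)"
      by (rule Stone_Weierstrass_polynomial_function[OF _ continuous_on_subset[OF F] e]) auto
    then obtain p where p: "polynomial_function p" "\<And>x. x \<in> {0..1} \<Longrightarrow> norm (F x - p x) < e" by blast
    \<comment> \<open>The approximation theorem yields an abstract
      \<open>polynomial_function\<close>; restricting it to the line through 0 in direction 1
      produces an actual polynomial.\<close>
    obtain Q :: "real \<Rightarrow> complex poly" and N where Q: "\<And>\<omega> \<rho>. p (0 + \<rho> *\<^sub>R \<omega>) = poly (Q \<omega>) (of_real \<rho>)"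
      by (rule polynomial_function_line_family[OF p(1), of 0]) blast
    define R where "R x = F x - poly (Q 1) (of_real x)" for x
    have Rb: "norm (R x) \<le> e" if "0 < x" "x < 1" for x
      using p(2)[of x] Q[of x 1] that by (simp add: R_def)
    have cq: "continuous_on UNIV (\<lambda>x. poly (Q 1) (complex_of_real x))"
      by (intro continuous_intros)
    have cR: "continuous_on UNIV R"
      unfolding R_def[abs_def] by (intro continuous_on_diff F cq)
    have FR: "F = (\<lambda>x. R x + poly (Q 1) (of_real x))" by (simp add: R_def fun_eq_iff)
    have "conv_test h k F - ?S F = conv_test h k R - ?S R"
      by (subst (1 2) FR) (simp only: conv_test_linear(1)[OF h k cR cq] Sadd[OF cR cq] poly, simp)
    also have "norm \<dots> \<le> ?H * (?K * e) + ?G * e"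
      by (rule order_trans[OF norm_triangle_ineq4])
         (intro add_mono conv_test_facts(2)[OF h k cR Rb] set_integrable_bounded_mult(2)[OF g borel_measurable_continuous_onI[OF cR] Rb])
    finally show ?thesis by (simp add: algebra_simps)
  qed
  have "norm (conv_test h k F - ?S F) \<le> 0"
  proof (rule field_le_epsilon)
    fix e :: real assume e: "e > 0"
    let ?C = "?H * ?K + ?G"
    have C: "?C \<ge> 0" using nn by simp
    have "norm (conv_test h k F - ?S F) \<le> ?C * (e / (?C + 1))"
      by (rule bnd) (use e C in simp)
    also have "\<dots> \<le> 0 + e" using e C by (simp add: field_simps)
    finally show "norm (conv_test h k F - ?S F) \<le> 0 + e" .
  qed
  then show ?thesis by simp
qed

section \<open>The densities of alpha and beta\<close>

lemma regular_dist_01: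
  assumes "test_fun \<phi>"
  shows "regular_dist (\<lambda>t. if 0 < t \<and> t < 1 then f t else 0) \<phi> = (LBINT t:{0<..<1}. f t * \<phi> t)"
proof -
  have "indicator {0<..} t *\<^sub>R ((if 0 < t \<and> t < 1 then f t else 0) * \<phi> t) = indicator {0<..<1} t *\<^sub>R (f t * \<phi> t)" for t
    by (auto simp: indicator_def)
  then show ?thesis
    using assms by (simp add: regular_dist_def set_lebesgue_integral_def)
qed

text \<open>The factor t^N tames a singularity at 0; on a compact K bounded below by a > 0 it can be
  divided out at the cost of a^(-N).\<close>

lemma regular_dist_01_in_carrier:
  assumes f: "set_integrable lborel {0<..<1} (\<lambda>t. f t * of_real t ^ N)"
  shows "regular_dist (\<lambda>t. if 0 < t \<and> t < 1 then f t else 0) \<in> carrier conv_algebra"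
proof (rule regular_dist_in_carrier)
  fix K :: "real set" assume K: "compact K" "K \<subseteq> {0<..}"
  obtain a where a: "a > 0" "\<And>t. t \<in> K \<Longrightarrow> a \<le> t"
  proof (cases "K = {}")
    case False
    obtain a where "a \<in> K" "\<And>t. t \<in> K \<Longrightarrow> a \<le> t"
      using compact_attains_inf[OF K(1) False] by blast
    then show ?thesis using that[of a] K(2) by auto
  qed (use that[of 1] in auto)
  have [measurable]: "K \<in> sets borel" using K(1) by (simp add: compact_imp_closed borel_closed)
  have "set_integrable lborel {0<..<1} (\<lambda>t. f t * of_real t ^ N * (indicator K t * of_real (inverse t ^ N)))"
  proof (rule set_integrable_bounded_mult(1)[OF f, where B = "inverse a ^ N"])
    show "(\<lambda>t. indicator K t * complex_of_real (inverse t ^ N)) \<in> borel_measurable borel"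
      by measurable
    fix t :: real assume t: "0 < t" "t < 1"
    show "norm (indicator K t * complex_of_real (inverse t ^ N)) \<le> inverse a ^ N"
      using a t by (auto simp: indicator_def norm_power norm_inverse intro!: power_mono le_imp_inverse_le)
  qed
  moreover have "indicator {0<..<1} t *\<^sub>R (f t * of_real t ^ N * (indicator K t * of_real (inverse t ^ N))) =
      indicator K t *\<^sub>R (if 0 < t \<and> t < 1 then f t else 0)" for t
    by (auto simp: indicator_def field_simps)
  ultimately show "set_integrable lborel K (\<lambda>t. if 0 < t \<and> t < 1 then f t else 0)"
    by (simp add: set_integrable_def)
qed auto

lemma powi_times_powr:
  assumes "t > 0"
  shows "complex_of_real (t powi (- int m)) * of_real t powr s = of_real t powr (s - of_nat m)"
proof -
  have "complex_of_real t powr (s - of_nat m) = of_real t powr s / of_real t powr of_nat m"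
    by (rule powr_diff)
  also have "complex_of_real t powr of_nat m = of_real t ^ m"
    using assms by (subst powr_nat) auto
  finally show ?thesis
    by (simp add: power_int_minus divide_inverse)
qed

section \<open>Explicit densities and their Mellin moments\<close>

definition alpha_density :: "nat \<Rightarrow> nat \<Rightarrow> real \<Rightarrow> complex" where
  "alpha_density n k t = of_real (mes_sphere (n - 2)) *
     (of_real (t powi (- int n)) * of_real (gegenbauer_poly n k t * (1 - t\<^sup>2) powr ((real n - 3) / 2)))"

text \<open>What remains of \<open>beta\<close> after integration by parts: t^(1-k) from the weight
  times t^(k-1-m) from the differentiated test function gives t^(-m), with m = n + k - 1.\<close>

definition beta_density :: "nat \<Rightarrow> nat \<Rightarrow> real \<Rightarrow> complex" where
  "beta_density n k t = of_real (1 / (2 ^ (n + k - 2) * pi powr ((real n - 1) / 2) * Gamma ((real n + 2 * real k - 1) / 2))) *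
     (of_real (t powi (- int (n + k - 1))) * of_real ((1 - t\<^sup>2) powr ((real n + 2 * real k - 3) / 2)))"

text \<open>Since \<open>rGamma\<close> is entire, the closed form simply vanishes where a Gamma
  function in a denominator would have a pole.\<close>

definition Mellin_alpha :: "nat \<Rightarrow> nat \<Rightarrow> complex \<Rightarrow> complex" where
  "Mellin_alpha n k s = of_real (pi powr (real n / 2)) * 2 powr (of_nat n - s) * Gamma (s - of_nat n + 1)
     * rGamma ((s - of_nat n - of_nat k) / 2 + 1) * rGamma ((s + of_nat k) / 2)"

text \<open>The transform of \<open>beta_density\<close> alone; the scalar by which the Euler
  operator acts on t^s is still missing.\<close>

definition Mellin_beta0 :: "nat \<Rightarrow> nat \<Rightarrow> complex \<Rightarrow> complex" where
  "Mellin_beta0 n k s = of_real (1 / (2 ^ (n + k - 1) * pi powr ((real n - 1) / 2)))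
     * Gamma ((s - of_nat n - of_nat k) / 2 + 1) * rGamma ((s + of_nat k + 1) / 2)"

text \<open>The area of the (n-2)-sphere is 2 pi^b / Gamma b with b = (n-1)/2, so it cancels the
  Gamma factor of the Gegenbauer moment.\<close>

lemma mes_sphere_eq:
  assumes "n \<ge> 2"
  shows "mes_sphere (n - 2) * (sqrt pi * Gamma ((real n - 1) / 2) / 2) = pi powr (real n / 2)"
proof -
  define b where "b = (real n - 1) / 2"
  have b: "b > 0" using assms by (simp add: b_def)
  have n: "real (n - 2 + 1) = 2 * b" using assms by (simp add: b_def)
  have G: "Gamma (b + 1) = b * Gamma b"
    using b by (intro Gamma_plus1) (auto elim!: nonpos_Ints_cases)
  have Gb: "Gamma b \<noteq> 0" using Gamma_real_pos[OF b] by linarith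
  have "mes_sphere (n - 2) * (sqrt pi * Gamma b / 2) = pi powr b * sqrt pi"
    unfolding mes_sphere_def n unit_ball_vol_def using b Gb by (simp add: G)
  also have "\<dots> = pi powr (b + 1/2)"
    by (simp add: powr_add powr_half_sqrt)
  also have "b + 1/2 = real n / 2" by (simp add: b_def field_simps)
  finally show ?thesis by (simp add: b_def)
qed

lemma alpha_density_moment:
  assumes n: "n \<ge> 2" and s: "Re s > real n - 1"
  shows "set_integrable lborel {0<..<1} (\<lambda>t. alpha_density n k t * of_real t powr s)"
    and "(LBINT t:{0<..<1}. alpha_density n k t * of_real t powr s) = Mellin_alpha n k s"
proof -
  have s': "Re (s - of_nat n) > -1" using s by simp
  let ?w = "\<lambda>t. complex_of_real (gegenbauer_poly n k t * (1 - t\<^sup>2) powr ((real n - 3) / 2)) * of_real t powr (s - of_nat n)"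
  have eq: "indicator {0<..<1} t *\<^sub>R (alpha_density n k t * of_real t powr s) =
     of_real (mes_sphere (n - 2)) * (indicator {0<..<1} t *\<^sub>R ?w t)" for t :: real
  proof (cases "t \<in> {0<..<1}")
    case True
    then have "t > 0" by simp
    show ?thesis
      unfolding powi_times_powr[OF \<open>t > 0\<close>, symmetric] alpha_density_def using True by simp
  qed simp
  show "set_integrable lborel {0<..<1} (\<lambda>t. alpha_density n k t * of_real t powr s)"
    unfolding set_integrable_def eq
    using gegenbauer_moment(1)[OF n s', of k] by (intro integrable_mult_right) (simp add: set_integrable_def)
  have "(LBINT t:{0<..<1}. alpha_density n k t * of_real t powr s) = of_real (mes_sphere (n - 2)) * (LBINT t:{0<..<1}. ?w t)"
    unfolding set_lebesgue_integral_def eq by (rule integral_mult_right_zero)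
  also have "\<dots> = of_real (mes_sphere (n - 2) * (sqrt pi * Gamma ((real n - 1) / 2) / 2)) * 2 powr (- (s - of_nat n)) * Gamma (s - of_nat n + 1) *
      rGamma ((s - of_nat n - of_nat k) / 2 + 1) * rGamma ((s - of_nat n + of_nat n + of_nat k) / 2)"
    unfolding gegenbauer_moment(2)[OF n s'] by (simp only: of_real_mult mult.assoc)
  also have "\<dots> = Mellin_alpha n k s"
    unfolding mes_sphere_eq[OF n] Mellin_alpha_def by simp
  finally show "(LBINT t:{0<..<1}. alpha_density n k t * of_real t powr s) = Mellin_alpha n k s" .
qed

text \<open>With l + 1 = (n + 2 k - 1)/2 the Beta integral produces the factor Gamma (l + 1), which
  the normalising constant of \<open>beta\<close> is there to cancel.\<close>

lemma beta_density_moment: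
  assumes n: "n \<ge> 2" and s: "Re s > real (n + k) - 2"
  shows "set_integrable lborel {0<..<1} (\<lambda>t. beta_density n k t * of_real t powr s)"
    and "(LBINT t:{0<..<1}. beta_density n k t * of_real t powr s) = Mellin_beta0 n k s"
proof -
  let ?m = "n + k - 1"
  define l where "l = (real n + 2 * real k - 3) / 2"
  have l: "l > -1" using n by (simp add: l_def)
  have m: "complex_of_nat ?m = of_nat n + of_nat k - 1" "real ?m = real n + real k - 1" using n by (simp_all add: of_nat_diff)
  have s': "Re (s - of_nat ?m) > -1" unfolding m(1) using s by simp
  define c where "c = 1 / (2 ^ (n + k - 2) * pi powr ((real n - 1) / 2) * Gamma ((real n + 2 * real k - 1) / 2))"
  let ?w = "\<lambda>t. complex_of_real ((1 - t\<^sup>2) powr l) * of_real t powr (s - of_nat ?m)"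
  have eq: "indicator {0<..<1} t *\<^sub>R (beta_density n k t * of_real t powr s) = of_real c * (indicator {0<..<1} t *\<^sub>R ?w t)" for t :: real
  proof (cases "t \<in> {0<..<1}")
    case True
    then have "t > 0" by simp
    show ?thesis
      unfolding powi_times_powr[OF \<open>t > 0\<close>, symmetric] beta_density_def c_def l_def using True by simp
  qed simp
  show "set_integrable lborel {0<..<1} (\<lambda>t. beta_density n k t * of_real t powr s)"
    unfolding set_integrable_def eq
    using Beta_integral_complex(1)[OF l s'] by (intro integrable_mult_right) (simp add: set_integrable_def)
  have "(LBINT t:{0<..<1}. beta_density n k t * of_real t powr s) = of_real c * (LBINT t:{0<..<1}. ?w t)"
    unfolding set_lebesgue_integral_def eq by (rule integral_mult_right_zero)
  also have "\<dots> = of_real c * (Gamma ((s - of_nat n - of_nat k) / 2 + 1) * of_real (Gamma (l + 1)) * rGamma ((s + of_nat k + 1) / 2) / 2)"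
  proof -
    have "(s - of_nat ?m + 1) / 2 = (s - of_nat n - of_nat k) / 2 + 1" unfolding m(1) by (simp add: field_simps)
    moreover have "(s - of_nat n - of_nat k) / 2 + 1 + complex_of_real (l + 1) = (s + of_nat k + 1) / 2"
      by (simp add: l_def field_simps)
    ultimately show ?thesis
      unfolding Beta_integral_complex(2)[OF l s'] by (simp only: Gamma_complex_of_real)
  qed
  also have "\<dots> = of_real (c * Gamma (l + 1) / 2) * Gamma ((s - of_nat n - of_nat k) / 2 + 1) * rGamma ((s + of_nat k + 1) / 2)"
    by simp
  also have "c * Gamma (l + 1) / 2 = 1 / (2 ^ (n + k - 1) * pi powr ((real n - 1) / 2))"
  proof -
    have l1: "l + 1 = (real n + 2 * real k - 1) / 2" by (simp add: l_def field_simps)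
    have G: "Gamma ((real n + 2 * real k - 1) / 2) > 0" using n by (intro Gamma_real_pos) auto
    have p: "(2::real) ^ (n + k - 1) = 2 * 2 ^ (n + k - 2)"
    proof -
      have "n + k - 1 = Suc (n + k - 2)" using n by simp
      then show ?thesis by (simp only: power_Suc)
    qed
    show ?thesis
      unfolding c_def l1 p using G by simp
  qed
  finally show "(LBINT t:{0<..<1}. beta_density n k t * of_real t powr s) = Mellin_beta0 n k s"
    by (simp add: Mellin_beta0_def)
qed

text \<open>Only t in (0,1) enters the integral, so the eigenvalue has to be known only
  there.\<close>

lemma alpha_eq:
  assumes "CARD('n::finite) = n" "n \<ge> 2"
  shows "alpha TYPE('n) k = regular_dist (\<lambda>t. if 0 < t \<and> t < 1 then alpha_density n k t else 0)"
  unfolding alpha_def regular_dist_def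
proof (rule ext, rule if_cong[OF refl _ refl], rule set_lebesgue_integral_cong)
  fix \<phi> :: "real \<Rightarrow> complex"
  show "\<forall>t. t \<in> {0<..} \<longrightarrow> (if t < 1 then complex_of_real (mes_sphere (CARD('n) - 2)) * of_real (t powi - int CARD('n)) *
         avg_eigenvalue TYPE('n) k t * of_real ((1 - t\<^sup>2) powr ((real CARD('n) - 3) / 2)) else 0) * \<phi> t =
      (if 0 < t \<and> t < 1 then alpha_density n k t else 0) * \<phi> t"
    using assms by (auto simp: avg_eigenvalue_eq alpha_density_def)
qed simp

lemma alpha_apply:
  assumes "CARD('n::finite) = n" "n \<ge> 2" "test_fun \<phi>"
  shows "alpha TYPE('n) k \<phi> = (LBINT t:{0<..<1}. alpha_density n k t * \<phi> t)"
  unfolding alpha_eq[OF assms(1,2)] by (rule regular_dist_01[OF assms(3)])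

lemma powr_of_nat_of_real: "t > 0 \<Longrightarrow> complex_of_real t powr of_nat j = of_real t ^ j"
  by (subst powr_nat) auto

lemma set_integrable_power_density:
  assumes "set_integrable lborel {0<..<1} (\<lambda>t. f t * complex_of_real t powr of_nat j)"
  shows "set_integrable lborel {0<..<1} (\<lambda>t. f t * complex_of_real t ^ j)"
  using assms by (subst set_integrable_cong[where f' = "\<lambda>t. f t * complex_of_real t powr of_nat j"]) (auto simp: powr_of_nat_of_real)

lemma integral_power_density:
  "(LBINT t:{0<..<1}. f t * complex_of_real t ^ j) = (LBINT t:{0<..<1}. f t * complex_of_real t powr of_nat j)"
  by (rule set_lebesgue_integral_cong) (auto simp: powr_of_nat_of_real)

lemma alpha_in_carrier:
  assumes "CARD('n::finite) = n" "n \<ge> 2"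
  shows "alpha TYPE('n) k \<in> carrier conv_algebra"
  unfolding alpha_eq[OF assms]
  by (rule regular_dist_01_in_carrier[where N = n], rule set_integrable_power_density, rule alpha_density_moment(1)[OF assms(2)]) simp

lemma beta_weight_eq:
  assumes n: "n \<ge> 2"
  shows "regular_dist (\<lambda>t. of_real (t powi (1 - int k) * one_minus_sq_plus ((real n + 2 * real k - 3) / 2) t)) =
    regular_dist (\<lambda>t. if 0 < t \<and> t < 1 then of_real (t powi (1 - int k) * (1 - t\<^sup>2) powr ((real n + 2 * real k - 3) / 2)) else 0)"
  unfolding regular_dist_def
  by (rule ext, rule if_cong[OF refl _ refl], rule set_lebesgue_integral_cong) (auto simp: one_minus_sq_plus_def)

lemma beta_in_carrier:
  assumes n: "n \<ge> 2"
  shows "beta n k \<in> carrier conv_algebra"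
proof -
  let ?w = "\<lambda>t. complex_of_real (t powi (1 - int k) * (1 - t\<^sup>2) powr ((real n + 2 * real k - 3) / 2))"
  have l: "(real n + 2 * real k - 3) / 2 > -1" using n by simp
  \<comment> \<open>The factor t^k turns the singular weight t^(1-k) into t, and the Beta integral
    with exponent 1 applies.\<close>
  have "set_integrable lborel {0<..<1} (\<lambda>t. ?w t * of_real t ^ k)"
  proof (subst set_integrable_cong[where f' = "\<lambda>t. of_real ((1 - t\<^sup>2) powr ((real n + 2 * real k - 3) / 2)) * of_real t powr 1"])
    show "set_integrable lborel {0<..<1} (\<lambda>t. complex_of_real ((1 - t\<^sup>2) powr ((real n + 2 * real k - 3) / 2)) * of_real t powr 1)"
      by (rule Beta_integral_complex(1)[OF l]) simp
    fix t :: real assume t: "t \<in> {0<..<1}"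
    have "t powi (1 - int k) * t ^ k = t"
      using t by (simp add: power_int_diff)
    then have "complex_of_real (t powi (1 - int k)) * of_real t ^ k = of_real t"
      by (metis of_real_mult of_real_power)
    then show "?w t * of_real t ^ k = of_real ((1 - t\<^sup>2) powr ((real n + 2 * real k - 3) / 2)) * of_real t powr 1"
      using t by (simp add: mult_ac)
  qed auto
  then have "regular_dist (\<lambda>t. if 0 < t \<and> t < 1 then ?w t else 0) \<in> carrier conv_algebra"
    by (rule regular_dist_01_in_carrier)
  moreover have "((\<lambda>\<gamma>. dist_scale (-1) (dist_deriv \<gamma>)) ^^ m) \<gamma> \<in> carrier conv_algebra" if "\<gamma> \<in> carrier conv_algebra" for m \<gamma>
    using that by (induction m) (auto intro!: dist_scale_in_carrier dist_deriv_in_carrier)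
  ultimately show ?thesis
    unfolding beta_def beta_weight_eq[OF n]
    by (intro dist_scale_in_carrier dist_fun_mult_in_carrier smooth_on_powi) blast
qed

lemma beta_apply:
  assumes n: "n \<ge> 2" and \<phi>: "test_fun \<phi>"
  shows "beta n k \<phi> = (LBINT t:{0<..<1}. beta_density n k t * euler_op k (n + k - 1) \<phi> t)"
proof -
  let ?m = "n + k - 1"
  let ?\<eta> = "\<lambda>t. complex_of_real (t powi (int k - 1)) * \<phi> t"
  let ?w = "\<lambda>t. complex_of_real (t powi (1 - int k) * (1 - t\<^sup>2) powr ((real n + 2 * real k - 3) / 2))"
  define c where "c = 1 / (2 ^ (n + k - 2) * pi powr ((real n - 1) / 2) * Gamma ((real n + 2 * real k - 1) / 2))"
  have \<eta>: "test_fun ?\<eta>" by (rule test_fun_mult_smooth[OF \<phi> smooth_on_powi])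
  have "beta n k \<phi> = of_real c * regular_dist (\<lambda>t. if 0 < t \<and> t < 1 then ?w t else 0) (nth_deriv ?m ?\<eta>)"
    using \<phi> funpow_neg_dist_deriv[OF \<eta>, of ?m]
    unfolding beta_def beta_weight_eq[OF n] dist_scale_def[of "of_real _"] dist_fun_mult_def c_def[symmetric] by simp
  also have "\<dots> = of_real c * (LBINT t:{0<..<1}. ?w t * nth_deriv ?m ?\<eta> t)"
    by (simp only: regular_dist_01[OF test_fun_nth_deriv[OF \<eta>]])
  also have "\<dots> = (LBINT t:{0<..<1}. of_real c * (?w t * nth_deriv ?m ?\<eta> t))"
    by simp
  also have "\<dots> = (LBINT t:{0<..<1}. beta_density n k t * euler_op k ?m \<phi> t)"
  proof (rule set_lebesgue_integral_cong, simp, intro allI impI)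
    fix t :: real assume "t \<in> {0<..<1}"
    then have t: "t > 0" by simp
    have "t powi (1 - int k) * t powi (int k - 1 - int ?m) = t powi (- int ?m)"
      using t by (simp add: power_int_add[symmetric])
    then have e: "complex_of_real (t powi (- int ?m)) = complex_of_real (t powi (1 - int k)) * of_real (t powi (int k - 1 - int ?m))"
      by (simp only: of_real_mult[symmetric])
    show "of_real c * (?w t * nth_deriv ?m ?\<eta> t) = beta_density n k t * euler_op k ?m \<phi> t"
      unfolding nth_deriv_powi_mult[OF \<phi> t] beta_density_def c_def[symmetric] of_real_mult e by (simp only: mult_ac)
  qed
  finally show ?thesis .
qed

lemma rGamma_duplication:
  assumes "z \<notin> \<int>\<^sub>\<le>\<^sub>0" "z + 1/2 \<notin> \<int>\<^sub>\<le>\<^sub>0"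
  shows "of_real (sqrt pi) * 2 powr (1 - 2 * z) * rGamma z * rGamma (z + 1/2) = rGamma (2 * z :: complex)"
proof -
  have p: "exp ((1 - 2*z) * of_real (ln 2)) = 2 powr (1 - 2 * z)"
    by (simp add: powr_def Ln_of_real[of 2, simplified])
  have g: "Gamma z * Gamma (z + 1/2) = of_real (sqrt pi) * 2 powr (1 - 2 * z) * Gamma (2 * z)"
    unfolding Gamma_legendre_duplication[OF assms] p by simp
  have nz: "Gamma z \<noteq> 0" "Gamma (z + 1/2) \<noteq> 0" using assms by (simp_all add: Gamma_eq_zero_iff)
  then have "Gamma (2 * z) \<noteq> 0" using g by (metis mult_eq_0_iff)
  then show ?thesis
    using g nz by (simp add: rGamma_inverse_Gamma field_simps)
qed

text \<open>One pair of Gamma factors cancels, and the duplication formula merges the reciprocals at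
  (s + k)/2 and (s + k + 1)/2 into that at s + k. The powers of 2 and pi in the normalisation are
  exactly those of that formula.\<close>

lemma Mellin_alpha_beta0:
  assumes n: "n \<ge> 2" and s: "(s - of_nat n - of_nat k) / 2 + 1 \<notin> \<int>\<^sub>\<le>\<^sub>0" "(s + of_nat k) / 2 \<notin> \<int>\<^sub>\<le>\<^sub>0" "(s + of_nat k + 1) / 2 \<notin> \<int>\<^sub>\<le>\<^sub>0"
  shows "Mellin_alpha n k s * Mellin_beta0 n k s = Gamma (s - of_nat n + 1) * rGamma (s + of_nat k)"
proof -
  have g: "rGamma ((s - of_nat n - of_nat k) / 2 + 1) * Gamma ((s - of_nat n - of_nat k) / 2 + 1) = 1"
    using s(1) by (simp add: rGamma_inverse_Gamma Gamma_eq_zero_iff)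
  have z: "(s + of_nat k) / 2 + 1/2 = (s + of_nat k + 1) / 2" by (simp add: field_simps)
  have d: "of_real (sqrt pi) * 2 powr (1 - s - of_nat k) * rGamma ((s + of_nat k) / 2) * rGamma ((s + of_nat k + 1) / 2) = rGamma (s + of_nat k)"
  proof -
    have e: "2 * ((s + of_nat k) / 2) = s + of_nat k" by simp
    have "1 - (s + of_nat k) = 1 - s - of_nat k" by simp
    then show ?thesis
      using rGamma_duplication[of "(s + of_nat k) / 2", unfolded z e, OF s(2,3)] by (simp only:)
  qed
  have c: "of_real (pi powr (real n / 2)) * 2 powr (of_nat n - s) * of_real (1 / (2 ^ (n + k - 1) * pi powr ((real n - 1) / 2)))
     = of_real (sqrt pi) * (2::complex) powr (1 - s - of_nat k)"
  proof -
    have "pi powr (real n / 2) = sqrt pi * pi powr ((real n - 1) / 2)"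
      by (simp add: powr_half_sqrt[symmetric] powr_add[symmetric] field_simps)
    moreover have "(2::complex) powr (of_nat n - s) = 2 powr (1 - s - of_nat k) * 2 ^ (n + k - 1)"
    proof -
      have "(2::complex) ^ (n + k - 1) = 2 powr of_nat (n + k - 1)" by (subst powr_nat) auto
      moreover have "1 - s - of_nat k + of_nat (n + k - 1) = of_nat n - s" using n by (simp add: of_nat_diff)
      ultimately show ?thesis by (simp only: powr_add[symmetric])
    qed
    ultimately show ?thesis by simp
  qed
  have "Mellin_alpha n k s * Mellin_beta0 n k s =
     (of_real (pi powr (real n / 2)) * 2 powr (of_nat n - s) * of_real (1 / (2 ^ (n + k - 1) * pi powr ((real n - 1) / 2))))
      * (rGamma ((s - of_nat n - of_nat k) / 2 + 1) * Gamma ((s - of_nat n - of_nat k) / 2 + 1))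
      * rGamma ((s + of_nat k) / 2) * rGamma ((s + of_nat k + 1) / 2) * Gamma (s - of_nat n + 1)"
    by (simp only: Mellin_alpha_def Mellin_beta0_def mult_ac)
  then show ?thesis
    unfolding g c d[symmetric] by (simp only: mult_ac mult_1)
qed

text \<open>The fundamental solution of the transposed Euler operator of length m = n + k - 1: its
  moments are the reciprocals of the scalars by which the operator acts on powers of t.\<close>

definition delta_density :: "nat \<Rightarrow> nat \<Rightarrow> real \<Rightarrow> complex" where
  "delta_density n k t = of_real (t powi (- int n) * ((1 - t) ^ (n + k - 2) / fact (n + k - 2)))"

lemma delta_density_moment:
  fixes j :: nat
  assumes n: "n \<ge> 2" and j: "j \<ge> n"
  shows "set_integrable lborel {0<..<1} (\<lambda>t. delta_density n k t * of_real t ^ j)"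
    and "(LBINT t:{0<..<1}. delta_density n k t * of_real t ^ j) = Gamma (of_nat j - of_nat n + 1) * rGamma (of_nat j + of_nat k)"
proof -
  define a where "a = real j - real n + 1"
  define b where "b = real (n + k - 1)"
  have ab: "a > 0" "b > 0" using n j by (simp_all add: a_def b_def)
  let ?f = "\<lambda>t. t powr (a - 1) * (1 - t) powr (b - 1)"
  \<comment> \<open>At the end points the right-hand side is 0 as well, since
    \<open>0 powr z\<close> is 0 for every z.\<close>
  have eq: "indicator {0<..<1} t *\<^sub>R (delta_density n k t * of_real t ^ j) = of_real (1 / fact (n + k - 2)) * of_real (indicator {0..1} t *\<^sub>R ?f t)" for t :: real
  proof (cases "t \<in> {0<..<1}")
    case True
    have "t powi (- int n) * t ^ j = t powr (a - 1)"
      using True by (simp add: a_def power_int_minus powr_diff powr_realpow divide_inverse)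
    moreover have "(1 - t) ^ (n + k - 2) = (1 - t) powr (b - 1)"
    proof -
      have "b - 1 = real (n + k - 2)" using n by (simp add: b_def of_nat_diff)
      then show ?thesis using True by (simp add: powr_realpow)
    qed
    ultimately have "t powi (- int n) * ((1 - t) ^ (n + k - 2) / fact (n + k - 2)) * t ^ j = 1 / fact (n + k - 2) * ?f t"
      by (simp add: field_simps)
    then have "complex_of_real (t powi (- int n) * ((1 - t) ^ (n + k - 2) / fact (n + k - 2)) * t ^ j) = of_real (1 / fact (n + k - 2) * ?f t)"
      by (rule arg_cong)
    then show ?thesis using True by (simp add: delta_density_def)
  qed (auto simp: indicator_def)
  have int: "integrable lborel (\<lambda>t. indicator {0..1} t *\<^sub>R ?f t)"
    using integrable_Beta[OF ab] by (simp add: set_integrable_def)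
  show "set_integrable lborel {0<..<1} (\<lambda>t. delta_density n k t * of_real t ^ j)"
    unfolding set_integrable_def eq by (intro integrable_mult_right integrable_of_real int)
  have "(LBINT t:{0<..<1}. delta_density n k t * of_real t ^ j) = of_real (1 / fact (n + k - 2)) * (LBINT t. of_real (indicator {0..1} t *\<^sub>R ?f t))"
    unfolding set_lebesgue_integral_def eq by (rule integral_mult_right_zero)
  also have "(LBINT t. complex_of_real (indicator {0..1} t *\<^sub>R ?f t)) = of_real (LBINT t:{0..1}. ?f t)"
    unfolding set_lebesgue_integral_def by (rule integral_complex_of_real)
  also have "(LBINT t:{0..1}. ?f t) = integral {0..1} ?f"
    by (rule set_borel_integral_eq_integral(2)[OF integrable_Beta[OF ab]])
  also have "\<dots> = Beta a b"
    using has_integral_Beta_real[OF ab] by (rule integral_unique)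
  also have "Beta a b = Gamma a * fact (n + k - 2) * rGamma (a + b)"
  proof -
    have "Gamma (1 + real (n + k - 2)) = fact (n + k - 2)" by (rule Gamma_fact)
    moreover have "1 + real (n + k - 2) = b" using n by (simp add: b_def of_nat_diff)
    ultimately show ?thesis by (simp add: Beta_altdef)
  qed
  also have "of_real (1 / fact (n + k - 2)) * complex_of_real (Gamma a * fact (n + k - 2) * rGamma (a + b)) = of_real (Gamma a) * of_real (rGamma (a + b))"
    by simp
  also have "complex_of_real (Gamma a) = Gamma (of_nat j - of_nat n + 1)"
    unfolding Gamma_complex_of_real[symmetric] by (simp add: a_def)
  also have "complex_of_real (rGamma (a + b)) = rGamma (of_nat j + of_nat k)"
    unfolding rGamma_complex_of_real[symmetric] using n by (simp add: a_def b_def of_nat_diff)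
  finally show "(LBINT t:{0<..<1}. delta_density n k t * of_real t ^ j) = Gamma (of_nat j - of_nat n + 1) * rGamma (of_nat j + of_nat k)" .
qed

text \<open>In terms of the m-th derivative of t^(k-1) \<phi> the Euler operator carries the factor
  t^n. This cancels t^(-n) and leaves the Taylor remainder integral.\<close>

lemma delta_density_apply:
  assumes n: "n \<ge> 2" and \<phi>: "test_fun \<phi>"
  shows "(LBINT t:{0<..<1}. delta_density n k t * euler_op k (n + k - 1) \<phi> t) = \<phi> 1"
proof -
  let ?m = "n + k - 1"
  let ?\<eta> = "\<lambda>t. complex_of_real (t powi (int k - 1)) * \<phi> t"
  have \<eta>: "test_fun ?\<eta>" by (rule test_fun_mult_smooth[OF \<phi> smooth_on_powi])
  have m: "?m = Suc (n + k - 2)" using n by simp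
  have e: "int k - 1 - int ?m = - int n" using n by simp
  have "(LBINT t:{0<..<1}. delta_density n k t * euler_op k ?m \<phi> t) =
     (LBINT t:{0<..<1}. of_real ((1 - t) ^ (n + k - 2) / fact (n + k - 2)) * nth_deriv (Suc (n + k - 2)) ?\<eta> t)"
  proof (rule set_lebesgue_integral_cong, simp, intro allI impI)
    fix t :: real assume "t \<in> {0<..<1}"
    then have t: "t > 0" by simp
    show "delta_density n k t * euler_op k ?m \<phi> t = of_real ((1 - t) ^ (n + k - 2) / fact (n + k - 2)) * nth_deriv (Suc (n + k - 2)) ?\<eta> t"
      unfolding m[symmetric] nth_deriv_powi_mult[OF \<phi> t] e delta_density_def of_real_mult by (simp only: mult_ac)
  qed
  also have "\<dots> = ?\<eta> 1" by (rule Taylor_integral[OF \<eta>])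
  finally show ?thesis by simp
qed

section \<open>The two convolution products\<close>

lemma conv_test_densities:
  assumes n: "n \<ge> 2" and \<phi>: "test_fun \<phi>"
  shows "(LBINT x:{0<..<1}. alpha_density n k x * (LBINT y:{0<..<1}. beta_density n k y * euler_op k (n + k - 1) \<phi> (x * y))) = \<phi> 1"
    and "(LBINT x:{0<..<1}. beta_density n k x * (LBINT y:{0<..<1}. alpha_density n k y * euler_op k (n + k - 1) \<phi> (x * y))) = \<phi> 1"
proof -
  \<comment> \<open>Large enough for all three densities times t^N to be integrable, the conditions
    being N > n - 1, N > n + k - 2 and N \<ge> n.\<close>
  define N where "N = n + k"
  let ?F = "euler_op k (n + k - 1) \<phi>"
  have F: "test_fun ?F" by (rule test_fun_euler_op[OF \<phi>])
  \<comment> \<open>The factor t^N is taken out of the test function; as (x y)^N = x^N y^N, it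
    distributes over both densities.\<close>
  define F0 where "F0 t = complex_of_real (t powi (- int N)) * ?F t" for t
  have "test_fun F0" unfolding F0_def by (rule test_fun_mult_smooth[OF F smooth_on_powi])
  then have cF0: "continuous_on UNIV F0"
    using smooth_on_continuous[OF test_fun_smooth[of F0 UNIV], of _ 0] by (auto intro!: continuous_at_imp_continuous_on)
  have F0: "of_real t ^ N * F0 t = ?F t" if "t > 0" for t
  proof -
    have "complex_of_real t ^ N * of_real (t powi (- int N)) = 1"
      using that by (simp add: power_int_minus)
    then show ?thesis by (simp add: F0_def mult.assoc[symmetric])
  qed
  let ?a = "\<lambda>t. alpha_density n k t * of_real t ^ N" and ?b = "\<lambda>t. beta_density n k t * of_real t ^ N" and ?g = "\<lambda>t. delta_density n k t * of_real t ^ N"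
  have A: "set_integrable lborel {0<..<1} (\<lambda>t. ?a t * of_real t ^ j)" "(LBINT t:{0<..<1}. ?a t * of_real t ^ j) = Mellin_alpha n k (of_nat (N + j))" for j
  proof -
    have "Re (of_nat (N + j)) > real n - 1" by (simp add: N_def)
    note al = alpha_density_moment[OF n this, of k]
    show "set_integrable lborel {0<..<1} (\<lambda>t. ?a t * of_real t ^ j)"
      using set_integrable_power_density[OF al(1)] by (simp only: mult.assoc power_add)
    show "(LBINT t:{0<..<1}. ?a t * of_real t ^ j) = Mellin_alpha n k (of_nat (N + j))"
      using al(2) unfolding integral_power_density[symmetric] by (simp only: mult.assoc power_add)
  qed
  have B: "set_integrable lborel {0<..<1} (\<lambda>t. ?b t * of_real t ^ j)" "(LBINT t:{0<..<1}. ?b t * of_real t ^ j) = Mellin_beta0 n k (of_nat (N + j))" for j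
  proof -
    have "Re (of_nat (N + j)) > real (n + k) - 2" by (simp add: N_def)
    note be = beta_density_moment[OF n this]
    show "set_integrable lborel {0<..<1} (\<lambda>t. ?b t * of_real t ^ j)"
      using set_integrable_power_density[OF be(1)] by (simp only: mult.assoc power_add)
    show "(LBINT t:{0<..<1}. ?b t * of_real t ^ j) = Mellin_beta0 n k (of_nat (N + j))"
      using be(2) unfolding integral_power_density[symmetric] by (simp only: mult.assoc power_add)
  qed
  have G: "set_integrable lborel {0<..<1} (\<lambda>t. ?g t * of_real t ^ j)"
    "(LBINT t:{0<..<1}. ?g t * of_real t ^ j) = Gamma (of_nat (N + j) - of_nat n + 1) * rGamma (of_nat (N + j) + of_nat k)" for j
  proof -
    have "N + j \<ge> n" by (simp add: N_def)
    note de = delta_density_moment[OF n this, of k]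
    show "set_integrable lborel {0<..<1} (\<lambda>t. ?g t * of_real t ^ j)"
      using de(1) by (simp only: mult.assoc power_add)
    show "(LBINT t:{0<..<1}. ?g t * of_real t ^ j) = Gamma (of_nat (N + j) - of_nat n + 1) * rGamma (of_nat (N + j) + of_nat k)"
      using de(2) by (simp only: mult.assoc power_add)
  qed
  have prod: "Mellin_alpha n k (of_nat (N + j)) * Mellin_beta0 n k (of_nat (N + j)) = Gamma (of_nat (N + j) - of_nat n + 1) * rGamma (of_nat (N + j) + of_nat k)" for j
    by (rule Mellin_alpha_beta0[OF n]) (use n in \<open>auto intro!: not_nonpos_IntI simp: N_def\<close>)
  have mom: "(LBINT t:{0<..<1}. ?a t * of_real t ^ j) * (LBINT t:{0<..<1}. ?b t * of_real t ^ j) = (LBINT t:{0<..<1}. ?g t * of_real t ^ j)" for j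
    unfolding A(2) B(2) G(2) by (rule prod)
  have a0: "set_integrable lborel {0<..<1} ?a" and b0: "set_integrable lborel {0<..<1} ?b" and g0: "set_integrable lborel {0<..<1} ?g"
    using A(1)[of 0] B(1)[of 0] G(1)[of 0] by simp_all
  have nested: "(LBINT x:{0<..<1}. f x * (LBINT y:{0<..<1}. g y * ?F (x * y))) = conv_test (\<lambda>t. f t * of_real t ^ N) (\<lambda>t. g t * of_real t ^ N) F0" for f g :: "real \<Rightarrow> complex"
    unfolding conv_test_def
  proof (rule set_lebesgue_integral_cong, simp, intro allI impI)
    fix x :: real assume x: "x \<in> {0<..<1}"
    have "(LBINT y:{0<..<1}. g y * ?F (x * y)) = (LBINT y:{0<..<1}. of_real x ^ N * (g y * of_real y ^ N * F0 (x * y)))"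
    proof (rule set_lebesgue_integral_cong, simp, intro allI impI)
      fix y :: real assume y: "y \<in> {0<..<1}"
      have "x * y > 0" using x y by simp
      from F0[OF this] show "g y * ?F (x * y) = of_real x ^ N * (g y * of_real y ^ N * F0 (x * y))"
        by (simp add: power_mult_distrib mult_ac)
    qed
    also have "\<dots> = of_real x ^ N * (LBINT y:{0<..<1}. g y * of_real y ^ N * F0 (x * y))"
      by (rule set_integral_mult_right)
    finally show "f x * (LBINT y:{0<..<1}. g y * ?F (x * y)) = f x * of_real x ^ N * (LBINT y:{0<..<1}. g y * of_real y ^ N * F0 (x * y))"
      by (simp only: mult.assoc)
  qed
  have g1: "(LBINT t:{0<..<1}. ?g t * F0 t) = \<phi> 1"
  proof -
    have "(LBINT t:{0<..<1}. ?g t * F0 t) = (LBINT t:{0<..<1}. delta_density n k t * ?F t)"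
      by (rule set_lebesgue_integral_cong) (auto simp: F0 mult.assoc)
    then show ?thesis by (simp only: delta_density_apply[OF n \<phi>])
  qed
  show "(LBINT x:{0<..<1}. alpha_density n k x * (LBINT y:{0<..<1}. beta_density n k y * ?F (x * y))) = \<phi> 1"
    unfolding nested conv_test_eq_moments[OF a0 b0 g0 mom cF0] by (rule g1)
  show "(LBINT x:{0<..<1}. beta_density n k x * (LBINT y:{0<..<1}. alpha_density n k y * ?F (x * y))) = \<phi> 1"
    unfolding nested conv_test_eq_moments[OF b0 a0 g0 mom[unfolded mult.commute[of "LBINT t:{0<..<1}. ?a t * of_real t ^ j" for j]] cF0] by (rule g1)
qed

lemma dist_conv_alpha_beta:
  assumes "CARD('n::finite) = n" and n: "n \<ge> 2"
  shows "dist_conv (alpha TYPE('n) k) (beta n k) = delta_one" "dist_conv (beta n k) (alpha TYPE('n) k) = delta_one"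
proof -
  let ?\<alpha> = "alpha TYPE('n) k" and ?\<beta> = "beta n k" and ?m = "n + k - 1"
  have \<alpha>: "?\<alpha> \<in> carrier conv_algebra" by (rule alpha_in_carrier[OF assms])
  have \<beta>: "?\<beta> \<in> carrier conv_algebra" by (rule beta_in_carrier[OF n])
  have \<alpha>d: "distribution ?\<alpha>" using \<alpha> by (simp add: conv_carrier_iff)
  have 1: "dist_conv ?\<alpha> ?\<beta> \<phi> = \<phi> 1" if \<phi>: "test_fun \<phi>" for \<phi>
  proof -
    obtain \<psi> where \<psi>: "test_fun \<psi>" "\<And>x. 0 < x \<Longrightarrow> x < 2 \<Longrightarrow> \<psi> x = ?\<beta> (\<lambda>y. \<phi> (x * y))"
      by (rule dist_pairing_extension[OF \<beta> \<phi>]) blast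
    have "dist_conv ?\<alpha> ?\<beta> \<phi> = ?\<alpha> \<psi>"
      by (rule dist_conv_eq[OF \<alpha> \<phi> \<psi>(1), of 1]) (use \<psi>(2) in auto)
    also have "\<dots> = (LBINT x:{0<..<1}. alpha_density n k x * \<psi> x)"
      by (rule alpha_apply[OF assms \<psi>(1)])
    also have "\<dots> = (LBINT x:{0<..<1}. alpha_density n k x * (LBINT y:{0<..<1}. beta_density n k y * euler_op k ?m \<phi> (x * y)))"
    proof (rule set_lebesgue_integral_cong, simp, intro allI impI)
      fix x :: real assume x: "x \<in> {0<..<1}"
      have "\<psi> x = (LBINT y:{0<..<1}. beta_density n k y * euler_op k ?m (\<lambda>y. \<phi> (x * y)) y)"
        using x by (simp add: \<psi>(2) beta_apply[OF n test_fun_dilation[OF \<phi>]])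
      also have "\<dots> = (LBINT y:{0<..<1}. beta_density n k y * euler_op k ?m \<phi> (x * y))"
        by (rule set_lebesgue_integral_cong) (use x in \<open>auto simp: euler_op_dilation[OF \<phi>]\<close>)
      finally show "alpha_density n k x * \<psi> x = alpha_density n k x * (LBINT y:{0<..<1}. beta_density n k y * euler_op k ?m \<phi> (x * y))"
        by (simp only:)
    qed
    also have "\<dots> = \<phi> 1" by (rule conv_test_densities(1)[OF n \<phi>])
    finally show ?thesis .
  qed
  have 2: "dist_conv ?\<beta> ?\<alpha> \<phi> = \<phi> 1" if \<phi>: "test_fun \<phi>" for \<phi>
  proof -
    obtain \<psi> where \<psi>: "test_fun \<psi>" "\<And>x. 0 < x \<Longrightarrow> x < 2 \<Longrightarrow> \<psi> x = ?\<alpha> (\<lambda>y. \<phi> (x * y))"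
      by (rule dist_pairing_extension[OF \<alpha> \<phi>]) blast
    have "dist_conv ?\<beta> ?\<alpha> \<phi> = ?\<beta> \<psi>"
      by (rule dist_conv_eq[OF \<beta> \<phi> \<psi>(1), of 1]) (use \<psi>(2) in auto)
    also have "\<dots> = (LBINT x:{0<..<1}. beta_density n k x * euler_op k ?m \<psi> x)"
      by (rule beta_apply[OF n \<psi>(1)])
    also have "\<dots> = (LBINT x:{0<..<1}. beta_density n k x * (LBINT y:{0<..<1}. alpha_density n k y * euler_op k ?m \<phi> (x * y)))"
    proof (rule set_lebesgue_integral_cong, simp, intro allI impI)
      fix x :: real assume x: "x \<in> {0<..<1}"
      \<comment> \<open>In this order the operator acts on the outer variable and has to be moved
        under the pairing with \<alpha>.\<close>
      have "euler_op k ?m \<psi> x = ?\<alpha> (\<lambda>y. euler_op k ?m \<phi> (x * y))"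
        by (rule euler_op_dist_pairing[OF \<alpha>d \<phi> \<psi>(2)]) (use x in auto)
      also have "\<dots> = (LBINT y:{0<..<1}. alpha_density n k y * euler_op k ?m \<phi> (x * y))"
        using x by (intro alpha_apply[OF assms] test_fun_dilation test_fun_euler_op \<phi>) auto
      finally show "beta_density n k x * euler_op k ?m \<psi> x = beta_density n k x * (LBINT y:{0<..<1}. alpha_density n k y * euler_op k ?m \<phi> (x * y))"
        by (simp only:)
    qed
    also have "\<dots> = \<phi> 1" by (rule conv_test_densities(2)[OF n \<phi>])
    finally show ?thesis .
  qed
  show "dist_conv ?\<alpha> ?\<beta> = delta_one"
    by (rule ext) (use 1 in \<open>auto simp: delta_one_def dist_conv_def\<close>)
  show "dist_conv ?\<beta> ?\<alpha> = delta_one"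
    by (rule ext) (use 2 in \<open>auto simp: delta_one_def dist_conv_def\<close>)
qed

section \<open>Mellin transforms\<close>

text \<open>Cutoffs with an arbitrary limit at infinity: applying the Euler operator to h
  (t/\<epsilon>) t^s produces a new cutoff whose limit need not be 1.\<close>

definition cutoff_to :: "complex \<Rightarrow> (real \<Rightarrow> complex) \<Rightarrow> bool" where
  "cutoff_to c H \<longleftrightarrow> smooth H \<and> (\<exists>a>0. \<forall>x\<le>a. H x = 0) \<and> (\<exists>b. \<forall>x\<ge>b. H x = c)"

lemma mellin_cutoff_iff: "mellin_cutoff h \<longleftrightarrow> cutoff_to 1 h"
  by (simp add: mellin_cutoff_def cutoff_to_def)

lemma cutoff_to_bounded:
  assumes "cutoff_to c H"
  obtains B where "B \<ge> 0" "\<And>x. norm (H x) \<le> B"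
proof -
  obtain a b where ab: "\<And>x. x \<le> a \<Longrightarrow> H x = 0" "\<And>x. x \<ge> b \<Longrightarrow> H x = c" and H: "smooth H"
    using assms unfolding cutoff_to_def by blast
  have "continuous_on {a..b} H"
    using smooth_on_continuous[of UNIV H _ 0] H by (intro continuous_at_imp_continuous_on) (simp add: smooth_iff_smooth_on)
  then have "bounded (H ` {a..b})"
    by (intro compact_imp_bounded compact_continuous_image) auto
  then obtain B where B: "\<And>x. x \<in> {a..b} \<Longrightarrow> norm (H x) \<le> B"
    unfolding bounded_iff by blast
  have "norm (H x) \<le> max (max B (norm c)) 0" for x
  proof (cases "x \<in> {a..b}")
    case True
    then show ?thesis using B[of x] by simp
  next
    case False
    then show ?thesis using ab[of x] by (cases "x \<le> a") auto
  qed
  then show ?thesis using that[of "max (max B (norm c)) 0"] by simp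
qed

lemma cutoff_to_tendsto:
  assumes H: "cutoff_to c H"
    and w: "set_integrable lborel {0<..<1} w"
  shows "((\<lambda>\<epsilon>. LBINT t:{0<..<1}. w t * H (t / \<epsilon>)) \<longlongrightarrow> c * (LBINT t:{0<..<1}. w t)) (at_right 0)"
proof -
  let ?I = "\<lambda>t::real. indicator {0<..<1} t :: real"
  obtain B where B: "B \<ge> 0" "\<And>x. norm (H x) \<le> B" by (rule cutoff_to_bounded[OF H]) blast
  obtain b where b: "\<And>x. x \<ge> b \<Longrightarrow> H x = c" and sH: "smooth H" using H unfolding cutoff_to_def by blast
  have cH: "continuous_on UNIV H"
    using smooth_on_continuous[of UNIV H _ 0] sH by (intro continuous_at_imp_continuous_on) (simp add: smooth_iff_smooth_on)
  have wm: "(\<lambda>t. ?I t *\<^sub>R w t) \<in> borel_measurable lborel"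
    using w unfolding set_integrable_def by (rule borel_measurable_integrable)
  have Hm: "(\<lambda>t. H (t / \<epsilon>)) \<in> borel_measurable lborel" for \<epsilon>
    using borel_measurable_continuous_onI[OF cH] by measurable
  have "((\<lambda>\<epsilon>. \<integral>t. (?I t *\<^sub>R w t) * H (t / \<epsilon>) \<partial>lborel) \<longlongrightarrow> (\<integral>t. (?I t *\<^sub>R w t) * c \<partial>lborel)) (at 0 within {0<..})"
  proof (rule tendsto_integral_dominated_at[where w = "\<lambda>t. B * norm (?I t *\<^sub>R w t)" and d = 1])
    show "(\<lambda>t. (?I t *\<^sub>R w t) * H (t / \<epsilon>)) \<in> borel_measurable lborel" for \<epsilon>
      by (rule borel_measurable_times[OF wm Hm])
    show "(\<lambda>t. (?I t *\<^sub>R w t) * c) \<in> borel_measurable lborel"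
      by (rule borel_measurable_times[OF wm]) simp
    show "integrable lborel (\<lambda>t. B * norm (?I t *\<^sub>R w t))"
      using w unfolding set_integrable_def by (intro integrable_mult_right integrable_norm)
    show "AE t in lborel. norm ((?I t *\<^sub>R w t) * H (t / \<epsilon>)) \<le> B * norm (?I t *\<^sub>R w t)" for \<epsilon>
      using mult_left_mono[OF B(2)[of "_ / \<epsilon>"] norm_ge_zero]
      by (intro AE_I2) (simp only: norm_mult mult.commute[of B])
    show "((\<lambda>\<epsilon>. (?I t *\<^sub>R w t) * H (t / \<epsilon>)) \<longlongrightarrow> (?I t *\<^sub>R w t) * c) (at 0 within {0<..})" for t
    proof (cases "t \<in> {0<..<1}")
      case True
      \<comment> \<open>Once \<epsilon> is below this bound, t/\<epsilon> lies beyond b; the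
        denominator is positive whatever the sign of b.\<close>
      then have "0 < t / (\<bar>b\<bar> + 1)" by simp
      then have "eventually (\<lambda>\<epsilon>. \<epsilon> \<in> {0<..<t / (\<bar>b\<bar> + 1)}) (at_right 0)"
        by (rule eventually_at_right_real)
      then have "eventually (\<lambda>\<epsilon>. t / \<epsilon> \<ge> b) (at_right 0)"
      proof eventually_elim
        case (elim \<epsilon>)
        then have "\<epsilon> * (\<bar>b\<bar> + 1) < t" by (simp add: pos_less_divide_eq)
        moreover have "b * \<epsilon> \<le> \<epsilon> * (\<bar>b\<bar> + 1)"
          using elim mult_right_mono[of b "\<bar>b\<bar> + 1" \<epsilon>] by (simp only: mult.commute[of \<epsilon>]) simp
        ultimately have "b * \<epsilon> \<le> t" by linarith
        then show ?case using elim by (simp add: pos_le_divide_eq)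
      qed
      then have "eventually (\<lambda>\<epsilon>. (?I t *\<^sub>R w t) * H (t / \<epsilon>) = (?I t *\<^sub>R w t) * c) (at_right 0)"
        by eventually_elim (simp add: b)
      then show ?thesis by (rule tendsto_eventually)
    qed simp
  qed simp
  then show ?thesis
    by (simp only: set_lebesgue_integral_def mult_scaleR_left[symmetric] integral_mult_left_zero mult.commute[of c])
qed

lemma cutoff_to_powr_extension:
  assumes H: "cutoff_to c H" and \<epsilon>: "\<epsilon> > 0"
  obtains \<psi> where "test_fun \<psi>" "\<And>t. t \<in> {0<..<2} \<Longrightarrow> \<psi> t = H (t / \<epsilon>) * of_real t powr s"
proof -
  obtain a where a: "a > 0" "\<And>x. x \<le> a \<Longrightarrow> H x = 0" and sH: "smooth H" using H unfolding cutoff_to_def by blast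
  have "smooth_on {0<..} (\<lambda>t. H ((1 / \<epsilon>) * t + 0) * of_real t powr s)"
    using sH by (intro smooth_on_mult smooth_on_powr smooth_on_affine[where T = UNIV]) (auto simp: smooth_iff_smooth_on)
  then have "smooth_on {0<..} (\<lambda>t. H (t / \<epsilon>) * of_real t powr s)" by simp
  moreover have "H (t / \<epsilon>) = 0" if "t \<le> a * \<epsilon>" for t
    using that \<epsilon> by (simp add: a pos_divide_le_eq)
  ultimately have "\<exists>\<psi>. test_fun \<psi> \<and> (\<forall>t\<in>{0<..<2}. \<psi> t = H (t / \<epsilon>) * of_real t powr s)"
    using a(1) \<epsilon> by (intro test_fun_extension[where a = "a * \<epsilon>"]) simp_all
  then show ?thesis using that by blast
qed

text \<open>The Euler operator conjugated by t^s: \<open>theta\<close> sends H t^s to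
  (\<open>theta H\<close> + s H) t^s, so each factor gains s. As \<open>theta\<close> commutes with
  dilations, the recursion does not involve \<epsilon>.\<close>

primrec cutoff_iter :: "complex \<Rightarrow> nat \<Rightarrow> nat \<Rightarrow> (real \<Rightarrow> complex) \<Rightarrow> real \<Rightarrow> complex" where
  "cutoff_iter s k 0 h = h"
| "cutoff_iter s k (Suc i) h = (\<lambda>u. theta (cutoff_iter s k i h) u + (s + of_nat k - 1 - of_nat i) * cutoff_iter s k i h u)"

lemma cutoff_to_theta:
  assumes "cutoff_to c H"
  shows "cutoff_to 0 (theta H)"
proof -
  obtain a b where ab: "a > 0" "\<And>x. x \<le> a \<Longrightarrow> H x = 0" "\<And>x. x \<ge> b \<Longrightarrow> H x = c" and sH: "smooth_on UNIV H"
    using assms unfolding cutoff_to_def smooth_iff_smooth_on by blast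
  have "smooth_on UNIV (theta H)"
    unfolding theta_def by (intro smooth_on_mult smooth_on_vector_derivative sH smooth_on_of_real) simp_all
  moreover have "theta H x = 0" if "x \<le> a / 2" for x
  proof -
    have "(H has_vector_derivative 0) (at x)"
      by (rule has_vector_derivative_transform_within_open[where S = "{..<a}" and f = "\<lambda>_. 0"]) (use that ab in auto)
    then show ?thesis by (simp add: theta_def vector_derivative_at)
  qed
  moreover have "theta H x = 0" if "x \<ge> b + 1" for x
  proof -
    have "(H has_vector_derivative 0) (at x)"
      by (rule has_vector_derivative_transform_within_open[where S = "{b<..}" and f = "\<lambda>_. c"]) (use that ab in auto)
    then show ?thesis by (simp add: theta_def vector_derivative_at)
  qed
  ultimately show ?thesis
    unfolding cutoff_to_def smooth_iff_smooth_on using ab(1) half_gt_zero by blast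
qed

lemma cutoff_to_add_cmult:
  assumes "cutoff_to c H" "cutoff_to d G"
  shows "cutoff_to (c + r * d) (\<lambda>u. H u + r * G u)"
proof -
  obtain a b where ab: "a > 0" "\<And>x. x \<le> a \<Longrightarrow> H x = 0" "\<And>x. x \<ge> b \<Longrightarrow> H x = c" and sH: "smooth_on UNIV H"
    using assms(1) unfolding cutoff_to_def smooth_iff_smooth_on by blast
  obtain a' b' where ab': "a' > 0" "\<And>x. x \<le> a' \<Longrightarrow> G x = 0" "\<And>x. x \<ge> b' \<Longrightarrow> G x = d" and sG: "smooth_on UNIV G"
    using assms(2) unfolding cutoff_to_def smooth_iff_smooth_on by blast
  have "smooth_on UNIV (\<lambda>u. H u + r * G u)"
    by (intro smooth_on_add smooth_on_mult smooth_on_const sH sG) simp_all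
  then show ?thesis
    unfolding cutoff_to_def smooth_iff_smooth_on using ab ab'
    by (intro conjI exI[of _ "min a a'"] exI[of _ "max b b'"]) simp_all
qed

text \<open>The Euler derivative of an eventually constant function is eventually 0, so each step
  multiplies the limit by its scalar.\<close>

lemma cutoff_to_cutoff_iter:
  assumes "cutoff_to 1 h"
  shows "cutoff_to (\<Prod>i<m. s + of_nat k - 1 - of_nat i) (cutoff_iter s k m h)"
proof (induction m)
  case (Suc m)
  show ?case
    using cutoff_to_add_cmult[OF cutoff_to_theta[OF Suc] Suc, of "s + of_nat k - 1 - of_nat m"]
    by (simp add: mult.commute)
qed (use assms in simp)

lemma euler_op_cutoff:
  assumes h: "cutoff_to 1 h" and \<epsilon>: "\<epsilon> > 0"
    and \<psi>: "\<And>t. t \<in> {0<..<2} \<Longrightarrow> \<psi> t = h (t / \<epsilon>) * of_real t powr s"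
    and t: "t \<in> {0<..<2}"
  shows "euler_op k i \<psi> t = cutoff_iter s k i h (t / \<epsilon>) * of_real t powr s"
proof -
  let ?H = "\<lambda>i. cutoff_iter s k i h"
  let ?dH = "\<lambda>i u. vector_derivative (?H i) (at u)"
  have p: "complex_of_real t powr s = of_real t * of_real t powr (s - 1)" if "t > 0" for t
    using that by (simp add: powr_diff)
  show ?thesis
  proof (rule euler_op_eqI[where S = "{0<..<2}" and D = "\<lambda>i t. ?H i (t / \<epsilon>) * of_real t powr s"
      and D' = "\<lambda>i t. ?H i (t / \<epsilon>) * (s * of_real t powr (s - 1)) + of_real (1 / \<epsilon>) * ?dH i (t / \<epsilon>) * of_real t powr s"])
    fix i and x :: real assume x: "x \<in> {0<..<2}"
    have "smooth_on UNIV (?H i)"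
      using cutoff_to_cutoff_iter[OF h] unfolding cutoff_to_def smooth_iff_smooth_on by blast
    then have "(?H i has_vector_derivative ?dH i (x / \<epsilon>)) (at (x / \<epsilon>))"
      by (rule smooth_on_deriv1) simp
    moreover have "((\<lambda>x. x / \<epsilon>) has_vector_derivative 1 / \<epsilon>) (at x)"
      using \<epsilon> by (auto intro!: derivative_eq_intros)
    ultimately have 1: "((\<lambda>x. ?H i (x / \<epsilon>)) has_vector_derivative of_real (1 / \<epsilon>) * ?dH i (x / \<epsilon>)) (at x)"
      using vector_diff_chain_at[of "\<lambda>x. x / \<epsilon>" "1 / \<epsilon>" x "?H i"] by (simp add: o_def scaleR_conv_of_real)
    have "((\<lambda>z. z powr s) has_field_derivative s * complex_of_real x powr (s - 1)) (at (of_real x))"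
      using has_field_derivative_powr[of "complex_of_real x" s] x by simp
    moreover have "(complex_of_real has_vector_derivative 1) (at x)"
      using has_vector_derivative_of_real[OF DERIV_ident] by simp
    ultimately have 2: "((\<lambda>x. of_real x powr s) has_vector_derivative s * complex_of_real x powr (s - 1)) (at x)"
      using field_vector_diff_chain_at[of complex_of_real 1 x "\<lambda>z. z powr s"] by (simp add: o_def)
    show "((\<lambda>t. ?H i (t / \<epsilon>) * of_real t powr s) has_vector_derivative
       ?H i (x / \<epsilon>) * (s * of_real x powr (s - 1)) + of_real (1 / \<epsilon>) * ?dH i (x / \<epsilon>) * of_real x powr s) (at x)"
      by (rule has_vector_derivative_mult[OF 1 2])
    show "?H (Suc i) (x / \<epsilon>) * of_real x powr s =
       of_real x * (?H i (x / \<epsilon>) * (s * of_real x powr (s - 1)) + of_real (1 / \<epsilon>) * ?dH i (x / \<epsilon>) * of_real x powr s)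
       + (of_nat k - 1 - of_nat i) * (?H i (x / \<epsilon>) * of_real x powr s)"
      using x \<epsilon> by (simp add: theta_def p algebra_simps)
  qed (use \<psi> t in auto)
qed

lemma prod_eq_Gamma_quotient:
  assumes "Re z > 0"
  shows "(\<Prod>i<m. z - 1 - of_nat i) = Gamma z * rGamma (z - of_nat m :: complex)"
proof (induction m)
  case 0
  then show ?case using Gamma_times_rGamma[OF assms] by simp
next
  case (Suc m)
  have "rGamma (z - of_nat m) * (z - 1 - of_nat m) = rGamma (z - of_nat (Suc m))"
    using rGamma_plus1[of "z - 1 - of_nat m"] by (simp add: algebra_simps)
  then show ?case by (simp add: Suc mult.assoc)
qed

definition Mellin_beta :: "nat \<Rightarrow> nat \<Rightarrow> complex \<Rightarrow> complex" where
  "Mellin_beta n k s = Gamma (s + of_nat k) * rGamma (s - of_nat n + 1) * Mellin_beta0 n k s"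

lemma has_mellin_integral_alpha:
  assumes "CARD('n::finite) = n" "n \<ge> 2" "Re s > real n - 1"
  shows "has_mellin_integral (alpha TYPE('n) k) s (Mellin_alpha n k s)"
  unfolding has_mellin_integral_def mellin_cutoff_iff
proof (intro allI impI)
  fix h assume h: "cutoff_to 1 h"
  note M = alpha_density_moment[OF assms(2,3), of k]
  have "dist_apply (alpha TYPE('n) k) (\<lambda>t. h (t / \<epsilon>) * of_real t powr s) =
      (LBINT t:{0<..<1}. (alpha_density n k t * of_real t powr s) * h (t / \<epsilon>))" if \<epsilon>: "\<epsilon> > 0" for \<epsilon>
  proof -
    obtain \<psi> where \<psi>: "test_fun \<psi>" "\<And>t. t \<in> {0<..<2} \<Longrightarrow> \<psi> t = h (t / \<epsilon>) * of_real t powr s"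
      by (rule cutoff_to_powr_extension[OF h \<epsilon>, of s]) blast
    have "dist_apply (alpha TYPE('n) k) (\<lambda>t. h (t / \<epsilon>) * of_real t powr s) = alpha TYPE('n) k \<psi>"
      by (rule dist_apply_eq[OF alpha_in_carrier[OF assms(1,2)] \<psi>(1), of 1]) (simp_all add: \<psi>(2))
    also have "\<dots> = (LBINT t:{0<..<1}. (alpha_density n k t * of_real t powr s) * h (t / \<epsilon>))"
      unfolding alpha_apply[OF assms(1,2) \<psi>(1)] by (intro set_lebesgue_integral_cong) (auto simp: \<psi>(2))
    finally show ?thesis .
  qed
  then have "eventually (\<lambda>\<epsilon>. dist_apply (alpha TYPE('n) k) (\<lambda>t. h (t / \<epsilon>) * of_real t powr s) =
      (LBINT t:{0<..<1}. (alpha_density n k t * of_real t powr s) * h (t / \<epsilon>))) (at_right 0)"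
    by (intro eventually_at_right_less[THEN eventually_mono])
  then show "((\<lambda>\<epsilon>. dist_apply (alpha TYPE('n) k) (\<lambda>t. h (t / \<epsilon>) * of_real t powr s)) \<longlongrightarrow> Mellin_alpha n k s) (at_right 0)"
    using cutoff_to_tendsto[OF h M(1)] unfolding M(2) mult_1 by (simp only: tendsto_cong)
qed

text \<open>The Euler operator meets the cut-off power before the limit is taken. It returns the
  power times a cutoff with limit Gamma (s+k) / Gamma (s-n+1), and dominated convergence brings out
  this constant.\<close>

lemma has_mellin_integral_beta:
  assumes n: "n \<ge> 2" and s: "Re s > real (n + k) - 2"
  shows "has_mellin_integral (beta n k) s (Mellin_beta n k s)"
  unfolding has_mellin_integral_def mellin_cutoff_iff
proof (intro allI impI)
  fix h assume h: "cutoff_to 1 h"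
  let ?m = "n + k - 1"
  let ?H = "cutoff_iter s k ?m h"
  note M = beta_density_moment[OF n s]
  have sk: "Re (s + of_nat k) > 0" using n s by simp
  have "s + of_nat k - of_nat ?m = s - of_nat n + 1" using n by (simp add: of_nat_diff)
  then have H: "cutoff_to (Gamma (s + of_nat k) * rGamma (s - of_nat n + 1)) ?H"
    using cutoff_to_cutoff_iter[OF h, of s k ?m] prod_eq_Gamma_quotient[OF sk, of ?m] by (simp only:)
  have "dist_apply (beta n k) (\<lambda>t. h (t / \<epsilon>) * of_real t powr s) =
      (LBINT t:{0<..<1}. (beta_density n k t * of_real t powr s) * ?H (t / \<epsilon>))" if \<epsilon>: "\<epsilon> > 0" for \<epsilon>
  proof -
    obtain \<psi> where \<psi>: "test_fun \<psi>" "\<And>t. t \<in> {0<..<2} \<Longrightarrow> \<psi> t = h (t / \<epsilon>) * of_real t powr s"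
      by (rule cutoff_to_powr_extension[OF h \<epsilon>, of s]) blast
    have E: "euler_op k ?m \<psi> t = ?H (t / \<epsilon>) * of_real t powr s" if "0 < t" "t < 1" for t
      by (rule euler_op_cutoff[OF h \<epsilon>]) (use that \<psi>(2) in auto)
    have "dist_apply (beta n k) (\<lambda>t. h (t / \<epsilon>) * of_real t powr s) = beta n k \<psi>"
      by (rule dist_apply_eq[OF beta_in_carrier[OF n] \<psi>(1), of 1]) (simp_all add: \<psi>(2))
    also have "\<dots> = (LBINT t:{0<..<1}. (beta_density n k t * of_real t powr s) * ?H (t / \<epsilon>))"
      unfolding beta_apply[OF n \<psi>(1)]
      using E
      by (intro set_lebesgue_integral_cong allI impI) (simp_all add: mult_ac)
    finally show ?thesis .
  qed
  then have "eventually (\<lambda>\<epsilon>. dist_apply (beta n k) (\<lambda>t. h (t / \<epsilon>) * of_real t powr s) =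
      (LBINT t:{0<..<1}. (beta_density n k t * of_real t powr s) * ?H (t / \<epsilon>))) (at_right 0)"
    by (intro eventually_at_right_less[THEN eventually_mono])
  then show "((\<lambda>\<epsilon>. dist_apply (beta n k) (\<lambda>t. h (t / \<epsilon>) * of_real t powr s)) \<longlongrightarrow> Mellin_beta n k s) (at_right 0)"
    using cutoff_to_tendsto[OF H M(1)] unfolding M(2) Mellin_beta_def by (simp only: tendsto_cong)
qed

section \<open>Uniqueness and meromorphic continuation of the transforms\<close>

lemma has_mellin_integral_unique:
  assumes "has_mellin_integral \<gamma> s c" "has_mellin_integral \<gamma> s d"
  shows "c = d"
proof (rule tendsto_unique)
  let ?h = "\<lambda>x. complex_of_real (smooth_step (x - 1))"
  show "((\<lambda>\<epsilon>. dist_apply \<gamma> (\<lambda>t. ?h (t / \<epsilon>) * of_real t powr s)) \<longlongrightarrow> c) (at_right 0)"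
    using assms(1) mellin_cutoff_smooth_step unfolding has_mellin_integral_def by blast
  show "((\<lambda>\<epsilon>. dist_apply \<gamma> (\<lambda>t. ?h (t / \<epsilon>) * of_real t powr s)) \<longlongrightarrow> d) (at_right 0)"
    using assms(2) mellin_cutoff_smooth_step unfolding has_mellin_integral_def by blast
qed simp

lemma remove_sings_nicely_meromorphic_eq:
  assumes "F nicely_meromorphic_on A" "z \<in> A"
  shows "remove_sings F z = F z"
proof -
  consider "is_pole F z" "F z = 0" | "F \<midarrow>z\<rightarrow> F z"
    using assms unfolding nicely_meromorphic_on_def by blast
  then show ?thesis by cases (auto simp: remove_sings_eqI)
qed

text \<open>The difference is meromorphic on the connected plane and vanishes on a half-plane, so it
  vanishes off a sparse set; nice meromorphicity then fixes the remaining values through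
  \<open>remove_sings\<close>.\<close>

lemma is_mellin_transform_unique:
  assumes F: "is_mellin_transform \<gamma> F" and G: "is_mellin_transform \<gamma> G"
  shows "F = G"
proof
  fix z
  obtain \<sigma> \<sigma>' where *: "\<And>s. Re s > \<sigma> \<Longrightarrow> has_mellin_integral \<gamma> s (F s)" "\<And>s. Re s > \<sigma>' \<Longrightarrow> has_mellin_integral \<gamma> s (G s)"
    using F G unfolding is_mellin_transform_def by blast
  have nm: "F nicely_meromorphic_on UNIV" "G nicely_meromorphic_on UNIV"
    using F G unfolding is_mellin_transform_def by blast+
  define \<tau> where "\<tau> = max \<sigma> \<sigma>'"
  have eq: "F s - G s = 0" if "Re s > \<tau>" for s
    using has_mellin_integral_unique[OF *(1)[of s] *(2)[of s]] that by (simp add: \<tau>_def)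
  have "(\<lambda>z. F z - G z) meromorphic_on UNIV"
    using nm unfolding nicely_meromorphic_on_def by (intro meromorphic_intros) auto
  then consider "\<forall>\<^sub>\<approx>z\<in>UNIV. F z - G z = 0" | "\<forall>\<^sub>\<approx>z\<in>UNIV. F z - G z \<noteq> 0"
    using meromorphic_imp_constant_or_avoid[of "\<lambda>z. F z - G z" UNIV 0] by auto
  then show "F z = G z"
  proof cases
    case 1
    then have "eventually (\<lambda>w. F w = G w) (at z)"
      by (auto simp: eventually_cosparse_open_eq)
    then have "remove_sings F z = remove_sings G z" by (rule remove_sings_cong) simp
    then show ?thesis using nm by (simp add: remove_sings_nicely_meromorphic_eq)
  next
    case 2
    let ?x = "of_real (\<tau> + 1) :: complex"
    have "open {s. \<tau> < Re s}" by (rule open_halfspace_Re_gt)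
    then have "eventually (\<lambda>s. s \<in> {s. \<tau> < Re s}) (at ?x)"
      by (intro eventually_at_in_open') auto
    moreover have "eventually (\<lambda>s. F s - G s \<noteq> 0) (at ?x)"
      using 2 by (simp add: eventually_cosparse_open_eq)
    ultimately have "eventually (\<lambda>s. False) (at ?x)"
      by eventually_elim (use eq in auto)
    then show ?thesis by simp
  qed
qed

text \<open>\<open>remove_sings\<close> brings the closed form to the normal form required of a
  transform and leaves it unchanged where it is analytic, so it still gives the values of the
  integrals.\<close>

lemma mellin_eq_remove_sings:
  assumes M: "M meromorphic_on UNIV" and an: "\<And>s. Re s > \<sigma> \<Longrightarrow> M analytic_on {s}"
    and int: "\<And>s. Re s > \<sigma> \<Longrightarrow> has_mellin_integral \<gamma> s (M s)"
  shows "is_mellin_transform \<gamma> (mellin \<gamma>)" "mellin \<gamma> = remove_sings M"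
proof -
  have *: "is_mellin_transform \<gamma> (remove_sings M)"
    unfolding is_mellin_transform_def using remove_sings_nicely_meromorphic[OF M] an int
    by (auto intro!: exI[of _ \<sigma>])
  then show "mellin \<gamma> = remove_sings M"
    unfolding mellin_def by (intro the_equality * is_mellin_transform_unique[OF _ *])
  with * show "is_mellin_transform \<gamma> (mellin \<gamma>)" by simp
qed

text \<open>Gamma is the inverse of the entire function \<open>rGamma\<close>.\<close>

lemma Gamma_meromorphic_on [meromorphic_intros]:
  assumes "f analytic_on A"
  shows "(\<lambda>z. Gamma (f z) :: complex) meromorphic_on A"
proof -
  have "(\<lambda>z. inverse (rGamma (f z))) meromorphic_on A"
    using assms by (intro meromorphic_intros analytic_on_imp_meromorphic_on[OF analytic_on_rGamma])
  then show ?thesis by (simp add: rGamma_inverse_Gamma)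
qed

lemma Mellin_alpha_meromorphic: "Mellin_alpha n k meromorphic_on UNIV"
proof -
  have "(\<lambda>s. 2 powr (of_nat n - s) :: complex) meromorphic_on UNIV"
    by (intro analytic_on_imp_meromorphic_on analytic_intros) auto
  then show ?thesis
    unfolding Mellin_alpha_def[abs_def]
    by (intro meromorphic_on_mult Gamma_meromorphic_on analytic_on_imp_meromorphic_on[OF analytic_on_rGamma]
         analytic_intros meromorphic_on_const) auto
qed

lemma Mellin_beta_meromorphic: "Mellin_beta n k meromorphic_on UNIV"
  unfolding Mellin_beta_def[abs_def] Mellin_beta0_def
  by (intro meromorphic_intros Gamma_meromorphic_on analytic_on_imp_meromorphic_on[OF analytic_on_rGamma] analytic_intros) auto

lemma Mellin_alpha_analytic:
  assumes "Re s > real n - 1"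
  shows "Mellin_alpha n k analytic_on {s}"
proof -
  have "s - of_nat n + 1 \<notin> \<int>\<^sub>\<le>\<^sub>0" using assms by (intro not_nonpos_IntI) simp
  then show ?thesis
    unfolding Mellin_alpha_def[abs_def] by (intro analytic_intros analytic_on_Gamma' analytic_on_rGamma) auto
qed

lemma Mellin_beta_analytic:
  assumes "n \<ge> 2" "Re s > real (n + k) - 2"
  shows "Mellin_beta n k analytic_on {s}"
proof -
  have "s + of_nat k \<notin> \<int>\<^sub>\<le>\<^sub>0" "(s - of_nat n - of_nat k) / 2 + 1 \<notin> \<int>\<^sub>\<le>\<^sub>0"
    using assms by (auto intro!: not_nonpos_IntI simp: field_simps)
  then show ?thesis
    unfolding Mellin_beta_def[abs_def] Mellin_beta0_def by (intro analytic_intros analytic_on_Gamma' analytic_on_rGamma) auto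
qed

text \<open>Once the value at x itself is removed, the nonpositive integers still form a closed set,
  so their complement contains the values on a punctured neighbourhood of x.\<close>

lemma cosparse_affine_not_nonpos_Ints:
  fixes a b :: complex
  assumes a: "a \<noteq> 0"
  shows "\<forall>\<^sub>\<approx>s. a * s + b \<notin> \<int>\<^sub>\<le>\<^sub>0"
  unfolding eventually_cosparse_open_eq[OF open_UNIV]
proof
  fix x :: complex
  let ?S = "\<int>\<^sub>\<le>\<^sub>0 - {a * x + b}"
  have "?S \<subseteq> \<int>" by auto
  then have "open (- ?S)" by (simp only: open_Compl closed_subset_Ints)
  moreover have "((\<lambda>s. a * s + b) \<longlongrightarrow> a * x + b) (at x)" by (intro tendsto_intros)
  ultimately have "eventually (\<lambda>s. a * s + b \<in> - ?S) (at x)"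
    by (intro topological_tendstoD) auto
  moreover have "eventually (\<lambda>s. s \<noteq> x) (at x)" by (rule eventually_neq_at_within)
  ultimately show "eventually (\<lambda>s. a * s + b \<notin> \<int>\<^sub>\<le>\<^sub>0) (at x)"
    by eventually_elim (use a in auto)
qed

lemma Mellin_beta_constant:
  assumes "n \<ge> 2"
  shows "complex_of_real (1 / (2 ^ (n + k - 1) * pi powr ((real n - 1) / 2)))
    = 2 powr (1 - of_nat n - of_nat k) * of_real pi powr ((1 - of_nat n) / 2)"
proof -
  have "(2::complex) powr (1 - of_nat n - of_nat k) = 2 powr (- of_nat (n + k - 1))"
    using assms by (simp add: of_nat_diff algebra_simps)
  also have "\<dots> = inverse (2 ^ (n + k - 1))"
    unfolding powr_minus by (subst powr_nat) auto
  finally have 1: "(2::complex) powr (1 - of_nat n - of_nat k) = inverse (2 ^ (n + k - 1))" .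
  have "(1 - of_nat n) / 2 = complex_of_real (- ((real n - 1) / 2))" by (simp add: field_simps)
  then have "of_real pi powr ((1 - of_nat n) / 2) = complex_of_real pi powr of_real (- ((real n - 1) / 2))"
    by (simp only:)
  also have "\<dots> = of_real (inverse (pi powr ((real n - 1) / 2)))"
    by (subst powr_of_real) (simp_all add: powr_minus)
  finally have 2: "of_real pi powr ((1 - of_nat n) / 2) = complex_of_real (inverse (pi powr ((real n - 1) / 2)))" .
  show ?thesis unfolding 1 2 by (simp add: field_simps)
qed

lemma Mellin_beta_eq:
  assumes "n \<ge> 2"
  shows "Mellin_beta n k s = 2 powr (1 - of_nat n - of_nat k) * of_real pi powr ((1 - of_nat n) / 2)
         * (Gamma (s + of_nat k) / Gamma (s - of_nat n + 1))
         * (Gamma ((s - of_nat n - of_nat k) / 2 + 1) / Gamma ((s + of_nat k + 1) / 2))"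
  unfolding Mellin_beta_def Mellin_beta0_def Mellin_beta_constant[OF assms] rGamma_inverse_Gamma
  by (simp only: divide_inverse mult_ac)

lemma Mellin_alpha_beta:
  assumes n: "n \<ge> 2"
  shows "\<forall>\<^sub>\<approx>s. Mellin_alpha n k s * Mellin_beta n k s = 1"
proof -
  have "\<forall>\<^sub>\<approx>s. s + complex_of_nat k \<notin> \<int>\<^sub>\<le>\<^sub>0"
    using cosparse_affine_not_nonpos_Ints[of 1 "of_nat k"] by simp
  moreover have "\<forall>\<^sub>\<approx>s. s - complex_of_nat n + 1 \<notin> \<int>\<^sub>\<le>\<^sub>0"
    using cosparse_affine_not_nonpos_Ints[of 1 "1 - of_nat n"] by (simp add: algebra_simps)
  moreover have "\<forall>\<^sub>\<approx>s. (s - complex_of_nat n - of_nat k) / 2 + 1 \<notin> \<int>\<^sub>\<le>\<^sub>0"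
    using cosparse_affine_not_nonpos_Ints[of "1/2" "(- of_nat n - of_nat k) / 2 + 1"]
    by (simp add: diff_divide_distrib add_divide_distrib algebra_simps)
  moreover have "\<forall>\<^sub>\<approx>s. (s + complex_of_nat k) / 2 \<notin> \<int>\<^sub>\<le>\<^sub>0"
    using cosparse_affine_not_nonpos_Ints[of "1/2" "of_nat k / 2"] by (simp add: add_divide_distrib)
  moreover have "\<forall>\<^sub>\<approx>s. (s + complex_of_nat k + 1) / 2 \<notin> \<int>\<^sub>\<le>\<^sub>0"
    using cosparse_affine_not_nonpos_Ints[of "1/2" "of_nat k / 2 + 1/2"] by (simp add: add_divide_distrib add_ac)
  ultimately show ?thesis
  proof eventually_elim
    case (elim s)
    have nz: "Gamma (s + of_nat k) \<noteq> 0" "Gamma (s - of_nat n + 1) \<noteq> 0"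
      using elim(1,2) by (simp_all add: Gamma_eq_zero_iff)
    have "Mellin_alpha n k s * Mellin_beta n k s =
       Gamma (s + of_nat k) * rGamma (s - of_nat n + 1) * (Gamma (s - of_nat n + 1) * rGamma (s + of_nat k))"
      unfolding Mellin_alpha_beta0[OF n elim(3-5), symmetric] Mellin_beta_def by (simp only: mult_ac)
    also have "\<dots> = 1"
      using nz by (simp add: rGamma_inverse_Gamma field_simps)
    finally show ?case .
  qed
qed

theorem theorem4p4p1:
  fixes n k :: nat
  assumes "CARD('n::finite) = n" and "n \<ge> 2"
  shows "alpha TYPE('n) k \<in> Units conv_algebra \<and>
    inv\<^bsub>conv_algebra\<^esub> (alpha TYPE('n) k) = beta n k \<and>
    is_mellin_transform (alpha TYPE('n) k) (mellin (alpha TYPE('n) k)) \<and>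
    (\<forall>s. Re s > real n - 1 \<longrightarrow>
       has_mellin_integral (alpha TYPE('n) k) s (mellin (alpha TYPE('n) k) s)) \<and>
    is_mellin_transform (beta n k) (mellin (beta n k)) \<and>
    (\<forall>\<^sub>\<approx>s.
       mellin (beta n k) s = 1 / mellin (alpha TYPE('n) k) s \<and>
       1 / mellin (alpha TYPE('n) k) s =
         2 powr (1 - of_nat n - of_nat k) * of_real pi powr ((1 - of_nat n) / 2)
         * (Gamma (s + of_nat k) / Gamma (s - of_nat n + 1))
         * (Gamma ((s - of_nat n - of_nat k) / 2 + 1) / Gamma ((s + of_nat k + 1) / 2)))"
proof -
  note carrier = alpha_in_carrier[OF assms, of k] beta_in_carrier[OF assms(2), of k]
  note unit = Units_inv_conv_algebraI[OF carrier dist_conv_alpha_beta[OF assms]]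
  note A = mellin_eq_remove_sings[where \<sigma> = "real n - 1", OF Mellin_alpha_meromorphic Mellin_alpha_analytic
      has_mellin_integral_alpha[OF assms]]
  note B = mellin_eq_remove_sings[where \<sigma> = "real (n + k) - 2", OF Mellin_beta_meromorphic
      Mellin_beta_analytic[OF assms(2)] has_mellin_integral_beta[OF assms(2)]]
  have \<alpha>: "is_mellin_transform (alpha TYPE('n) k) (mellin (alpha TYPE('n) k))" by (rule A(1))
  have \<alpha>_eq: "mellin (alpha TYPE('n) k) = remove_sings (Mellin_alpha n k)" by (rule A(2))
  have \<beta>: "is_mellin_transform (beta n k) (mellin (beta n k))" by (rule B(1))
  have \<beta>_eq: "mellin (beta n k) = remove_sings (Mellin_beta n k)" by (rule B(2))
  \<comment> \<open>The identities hold off a sparse set, since division by 0 and the value of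
    \<open>remove_sings\<close> at a pole are default values.\<close>
  have "\<forall>\<^sub>\<approx>s. remove_sings (Mellin_alpha n k) s = Mellin_alpha n k s"
    by (rule eventually_remove_sings_eq[OF Mellin_alpha_meromorphic])
  moreover have "\<forall>\<^sub>\<approx>s. remove_sings (Mellin_beta n k) s = Mellin_beta n k s"
    by (rule eventually_remove_sings_eq[OF Mellin_beta_meromorphic])
  moreover note Mellin_alpha_beta[OF assms(2), of k]
  ultimately have "\<forall>\<^sub>\<approx>s. mellin (beta n k) s = 1 / mellin (alpha TYPE('n) k) s \<and> 1 / mellin (alpha TYPE('n) k) s = Mellin_beta n k s"
  proof eventually_elim
    case (elim s)
    have "Mellin_alpha n k s \<noteq> 0" using elim(3) by auto
    then have "Mellin_beta n k s = 1 / Mellin_alpha n k s" using elim(3) by (simp add: field_simps)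
    then show ?case unfolding \<alpha>_eq \<beta>_eq elim(1,2) by simp
  qed
  moreover have "has_mellin_integral (alpha TYPE('n) k) s (mellin (alpha TYPE('n) k) s)" if "Re s > real n - 1" for s
    using has_mellin_integral_alpha[OF assms that, of k] Mellin_alpha_analytic[OF that] unfolding \<alpha>_eq by simp
  ultimately show ?thesis
    using unit \<alpha> \<beta> unfolding Mellin_beta_eq[OF assms(2)] by blast
qed

end
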